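(* For any $\varepsilon>0$, we have \[ \dim_H \left( \mathscr M (\mathbf H_6) \cap \left[0, \tfrac{4}{\sqrt{3}} + \varepsilon\right) \right) \ge \dim_H \left( \mathscr L (\mathbf H_6) \cap \left[0, \tfrac{4}{\sqrt{3}} + \varepsilon\right) \right) > 0 . \]
   Context: $\dim_H$ denotes Hausdorff dimension (of subsets of $\mathbb R$). $\mathbf H_6$ is the subgroup of $\mathrm{PSL}_2(\mathbb R)$ generated by $S=\begin{pmatrix}0&-1\\1&0\end{pmatrix}$ and $T=\begin{pmatrix}1&\sqrt3\\0&1\end{pmatrix}$, acting on $\mathbb R\cup\{\infty\}$ by $g(z)=\frac{az+b}{cz+d}$ for $g=\begin{pmatrix}a&b\\c&d\end{pmatrix}$; write $a=a(g)$, $c=c(g)$ (determined up to a common sign). $\mathbb Q(\mathbf H_6)\subset\mathbb R\cup\{\infty\}$ is the set of points fixed by parabolic elements of $\mathbf H_6$. Lagrange spectrum: for $\xi\in\mathbb R\setminus\mathbb Q(\mathbf H_6)$ put $L_{\mathbf H_6}(\xi)=\limsup_{g\in\mathbf H_6}\left(c(g)^2\,|\xi-g(\infty)|\right)^{-1}\in[0,\infty]$, where the limit superior is taken as $|c(g)|\to\infty$, i.e. it is $\lim_{N\to\infty}\sup\{(c(g)^2|\xi-g(\infty)|)^{-1}: g\in\mathbf H_6,\ |c(g)|>N\}$. Then $\mathscr L(\mathbf H_6)=\{L_{\mathbf H_6}(\xi):\xi\in\mathbb R\setminus\mathbb Q(\mathbf H_6)\}$. Markoff spectrum: for a real binary quadratic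 form $f(x,y)=\alpha x^2+\beta xy+\gamma y^2$ with discriminant $\Delta(f)=\beta^2-4\alpha\gamma>0$ put $f(g)=f(a(g),c(g))$ and $m_{\mathbf H_6}(f)=\sup_{g\in\mathbf H_6}\frac{\sqrt{\Delta(f)}}{|f(g)|}\in[0,\infty]$, where the quotient is $+\infty$ if $f(g)=0$. Then $\mathscr M(\mathbf H_6)=\{m_{\mathbf H_6}(f):\Delta(f)>0\}$. *)

theory Defs
  imports "HOL-Analysis.Analysis" "HOL-Algebra.Coset" "HOL-Algebra.Generated_Groups"
begin

text \<open>
  The \<open>s\<close>-th power of the diameter of a bounded set, with the conventions that the empty set
  contributes \<open>0\<close> for every \<open>s\<close> and that a nonempty set contributes \<open>1\<close> for \<open>s = 0\<close>
  (whereas \<^term>\<open>(0::real) powr 0\<close> is \<open>0\<close>).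
\<close>

definition diam_pow :: "real \<Rightarrow> 'a::metric_space set \<Rightarrow> real" where
  "diam_pow s U = (if U = {} then 0 else if s = 0 then 1 else diameter U powr s)"

text \<open>
  Coverings are sequences, so finite coverings are padded with empty sets.
  Boundedness is required because \<^const>\<open>diameter\<close> is unspecified on unbounded sets.
\<close>

definition hausdorff_premeasure :: "real \<Rightarrow> real \<Rightarrow> 'a::metric_space set \<Rightarrow> ennreal" where
  "hausdorff_premeasure s \<delta> A =
     Inf {(\<Sum>i. ennreal (diam_pow s (U i))) | U :: nat \<Rightarrow> 'a set.
            A \<subseteq> (\<Union>i. U i) \<and> (\<forall>i. bounded (U i) \<and> diameter (U i) \<le> \<delta>)}"

definition hausdorff_measure :: "real \<Rightarrow> 'a::metric_space set \<Rightarrow> ennreal" where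
  "hausdorff_measure s A = (SUP \<delta>\<in>{0<..}. hausdorff_premeasure s \<delta> A)"

definition hausdorff_dim :: "'a::metric_space set \<Rightarrow> ennreal" where
  "hausdorff_dim A = Inf {ennreal s | s. s \<ge> 0 \<and> hausdorff_measure s A = 0}"

definition SL2R :: "(real^2^2) monoid" where
  "SL2R = \<lparr>carrier = {A. det A = 1}, monoid.mult = (**), one = mat 1\<rparr>"

definition PSL2R :: "(real^2^2) set monoid" where
  "PSL2R = SL2R Mod {mat 1, - mat 1}"

definition psl :: "real^2^2 \<Rightarrow> (real^2^2) set" where
  "psl A = {mat 1, - mat 1} #>\<^bsub>SL2R\<^esub> A"

definition mat_S :: "real^2^2" where
  "mat_S = vector [vector [0, -1], vector [1, 0]]"

definition mat_T :: "real^2^2" where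
  "mat_T = vector [vector [1, sqrt 3], vector [0, 1]]"

definition H6 :: "(real^2^2) set set" where
  "H6 = generate PSL2R {psl mat_S, psl mat_T}"

text \<open>
  An element of \<open>PSL\<^sub>2(\<real>)\<close> is a coset \<open>{A, -A}\<close>; its matrix entries are read off from an
  arbitrarily chosen representative. Everything below is invariant under a common sign change
  of the entries.
\<close>

definition rep :: "(real^2^2) set \<Rightarrow> real^2^2" where
  "rep g = (SOME A. A \<in> g)"

definition ent_a :: "(real^2^2) set \<Rightarrow> real" where "ent_a g = rep g $ 1 $ 1"
definition ent_b :: "(real^2^2) set \<Rightarrow> real" where "ent_b g = rep g $ 1 $ 2"
definition ent_c :: "(real^2^2) set \<Rightarrow> real" where "ent_c g = rep g $ 2 $ 1"
definition ent_d :: "(real^2^2) set \<Rightarrow> real" where "ent_d g = rep g $ 2 $ 2"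

datatype proj_real = Fin (coord: real) | Infty

fun moebius :: "(real^2^2) set \<Rightarrow> proj_real \<Rightarrow> proj_real" where
  "moebius g (Fin z) =
     (if ent_c g * z + ent_d g = 0 then Infty
      else Fin ((ent_a g * z + ent_b g) / (ent_c g * z + ent_d g)))"
| "moebius g Infty = (if ent_c g = 0 then Infty else Fin (ent_a g / ent_c g))"

definition parabolic :: "(real^2^2) set \<Rightarrow> bool" where
  "parabolic g \<longleftrightarrow> g \<in> carrier PSL2R \<and> g \<noteq> \<one>\<^bsub>PSL2R\<^esub> \<and> \<bar>trace (rep g)\<bar> = 2"

definition Q_H6 :: "proj_real set" where
  "Q_H6 = {z. \<exists>g\<in>H6. parabolic g \<and> moebius g z = z}"

text \<open>
  The filter below expresses \<open>\<bar>c(g)\<bar> \<rightarrow> \<infinity>\<close> with \<open>g\<close> in \<open>H\<^sub>6\<close>. On it \<open>c(g) \<noteq> 0\<close>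
  eventually, so that \<open>g(\<infinity>)\<close> is finite and \<^const>\<open>coord\<close> is meaningful.
\<close>

definition lagrange_const :: "real \<Rightarrow> ennreal" where
  "lagrange_const \<xi> =
     Limsup (inf (filtercomap (\<lambda>g. \<bar>ent_c g\<bar>) at_top) (principal H6))
       (\<lambda>g. inverse (ennreal ((ent_c g)\<^sup>2 * \<bar>\<xi> - coord (moebius g Infty)\<bar>)))"

definition lagrange_spectrum :: "ennreal set" where
  "lagrange_spectrum = {lagrange_const \<xi> | \<xi>. Fin \<xi> \<notin> Q_H6}"

definition qform :: "real \<Rightarrow> real \<Rightarrow> real \<Rightarrow> real \<Rightarrow> real \<Rightarrow> real" where
  "qform \<alpha> \<beta> \<gamma> x y = \<alpha> * x\<^sup>2 + \<beta> * x * y + \<gamma> * y\<^sup>2"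

definition qdisc :: "real \<Rightarrow> real \<Rightarrow> real \<Rightarrow> real" where
  "qdisc \<alpha> \<beta> \<gamma> = \<beta>\<^sup>2 - 4 * \<alpha> * \<gamma>"

definition markoff_const :: "real \<Rightarrow> real \<Rightarrow> real \<Rightarrow> ennreal" where
  "markoff_const \<alpha> \<beta> \<gamma> =
     (SUP g\<in>H6. let v = qform \<alpha> \<beta> \<gamma> (ent_a g) (ent_c g) in
        if v = 0 then \<infinity> else ennreal (sqrt (qdisc \<alpha> \<beta> \<gamma>) / \<bar>v\<bar>))"

definition markoff_spectrum :: "ennreal set" where
  "markoff_spectrum = {markoff_const \<alpha> \<beta> \<gamma> | \<alpha> \<beta> \<gamma>. qdisc \<alpha> \<beta> \<gamma> > 0}"

lemma SL2R_simps [simp]: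
  "carrier SL2R = {A. det A = 1}" "A \<otimes>\<^bsub>SL2R\<^esub> B = A ** B" "\<one>\<^bsub>SL2R\<^esub> = mat 1"
  by (simp_all add: SL2R_def)

lemma det_uminus_2: "det (- A) = det (A :: real^2^2)"
  by (simp add: det_2)

lemma minus_one_mult: "(- mat 1) ** A = - (A :: real^2^2)" "A ** (- mat 1) = - A"
  by (simp_all add: matrix_matrix_mult_def mat_def vec_eq_iff sum_2 forall_2)

lemma group_SL2R: "group SL2R"
proof (rule groupI)
  fix A assume "A \<in> carrier SL2R"
  then have "det A = 1" by simp
  then obtain B where B: "B ** A = mat 1"
    using invertible_det_nz[of A] by (auto simp: invertible_def)
  then have "det B * det A = 1" by (metis det_mul det_I)
  with \<open>det A = 1\<close> B show "\<exists>B\<in>carrier SL2R. B \<otimes>\<^bsub>SL2R\<^esub> A = \<one>\<^bsub>SL2R\<^esub>" by auto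
qed (simp_all add: det_mul matrix_mul_assoc)

lemma psl_eq: "psl A = {A, - A}"
  by (simp add: psl_def r_coset_def minus_one_mult insert_commute)

lemma normal_pm_one: "{mat 1, - mat 1} \<lhd> SL2R"
proof -
  interpret group SL2R by (rule group_SL2R)
  have "subgroup {mat 1, - mat 1} SL2R"
  proof (rule subgroupI)
    fix A :: "real^2^2" assume "A \<in> {mat 1, - mat 1}"
    then show "inv\<^bsub>SL2R\<^esub> A \<in> {mat 1, - mat 1}"
      using inv_equality[of A A] by (auto simp: minus_one_mult det_uminus_2)
  qed (auto simp: minus_one_mult det_uminus_2)
  then show ?thesis
    by (rule normalI) (auto simp: r_coset_def l_coset_def minus_one_mult)
qed

lemma group_PSL2R: "group PSL2R"
  unfolding PSL2R_def by (rule normal.factorgroup_is_group[OF normal_pm_one])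

lemma carrier_PSL2R: "carrier PSL2R = psl ` {A. det A = 1}"
  by (auto simp: PSL2R_def FactGroup_def RCOSETS_def psl_def)

lemma generators_PSL2R: "psl mat_S \<in> carrier PSL2R" "psl mat_T \<in> carrier PSL2R"
  by (auto simp: carrier_PSL2R mat_S_def mat_T_def det_2)

lemma rep_psl: "rep (psl A) = A \<or> rep (psl A) = - A"
  using someI[of "\<lambda>B. B \<in> psl A" A] by (auto simp: rep_def psl_eq)

lemma lagrange_const_tendsto:
  "((\<lambda>N. SUP g\<in>{g \<in> H6. \<bar>ent_c g\<bar> > N}.
      inverse (ennreal ((ent_c g)\<^sup>2 * \<bar>\<xi> - coord (moebius g Infty)\<bar>)))
    \<longlongrightarrow> lagrange_const \<xi>) at_top"
proof -
  define f where "f g = inverse (ennreal ((ent_c g)\<^sup>2 * \<bar>\<xi> - coord (moebius g Infty)\<bar>))" for g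
  define s where "s N = (SUP g\<in>{g \<in> H6. \<bar>ent_c g\<bar> > N}. f g)" for N
  let ?F = "inf (filtercomap (\<lambda>g. \<bar>ent_c g\<bar>) at_top) (principal H6)"
  have ev: "eventually P ?F \<longleftrightarrow> (\<exists>N. \<forall>g\<in>H6. \<bar>ent_c g\<bar> > N \<longrightarrow> P g)" for P
    unfolding eventually_inf_principal eventually_filtercomap_at_top_dense by blast
  have anti: "s N \<le> s M" if "M \<le> N" for M N
    unfolding s_def using that by (intro SUP_subset_mono) auto
  have L: "lagrange_const \<xi> = (INF N. s N)"
  proof (rule antisym)
    show "lagrange_const \<xi> \<le> (INF N. s N)"
    proof (rule INF_greatest)
      fix N
      have "eventually (\<lambda>g. g \<in> H6 \<and> \<bar>ent_c g\<bar> > N) ?F"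
        unfolding ev by blast
      then have "Limsup ?F f \<le> (SUP g\<in>{g. g \<in> H6 \<and> \<bar>ent_c g\<bar> > N}. f g)"
        unfolding Limsup_def by (intro INF_lower2) auto
      then show "lagrange_const \<xi> \<le> s N"
        by (simp add: lagrange_const_def s_def f_def[symmetric] del: moebius.simps)
    qed
    show "(INF N. s N) \<le> lagrange_const \<xi>"
      unfolding lagrange_const_def Limsup_def f_def[symmetric]
    proof (rule INF_greatest)
      fix P assume "P \<in> {P. eventually P ?F}"
      then obtain N where N: "\<forall>g\<in>H6. \<bar>ent_c g\<bar> > N \<longrightarrow> P g" by (auto simp: ev)
      have "s N \<le> Sup (f ` Collect P)"
        unfolding s_def using N by (intro SUP_subset_mono) auto
      then show "(INF N. s N) \<le> Sup (f ` Collect P)"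
        by (rule INF_lower2[OF UNIV_I])
    qed
  qed
  have "(s \<longlongrightarrow> (INF N. s N)) at_top"
  proof (rule order_tendstoI)
    fix a assume "a < (INF N. s N)"
    then show "\<forall>\<^sub>F N in at_top. a < s N"
      by (intro always_eventually allI) (meson INF_lower UNIV_I less_le_trans)
  next
    fix a assume "(INF N. s N) < a"
    then obtain M where "s M < a" by (auto simp: INF_less_iff)
    then show "\<forall>\<^sub>F N in at_top. s N < a"
      unfolding eventually_at_top_linorder using anti le_less_trans by blast
  qed
  then show ?thesis
    unfolding L s_def f_def .
qed

end

theory Submission
  imports Defs "HOL-Library.Discrete_Functions" "HOL-Real_Asymp.Real_Asymp"
begin

text \<open>
  Write \<open>f(x, y) = y (x - \<xi> y)\<close>, a form of discriminant 1. For \<open>g\<close> in the Hecke group the number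
  \<open>c\<^sup>2 \<bar>\<xi> - a/c\<bar>\<close> is \<open>\<bar>f(a, c)\<bar>\<close>, so \<open>L(\<xi>)\<close> is the limit superior of the quotients whose supremum is
  the Markoff constant of \<open>f\<close>.

  Comparison of the spectra. Choose \<open>g\<^sub>n\<close> with \<open>\<bar>c(g\<^sub>n)\<bar> \<rightarrow> \<infinity>\<close> and \<open>\<bar>f(g\<^sub>n)\<bar> \<rightarrow> 1/L(\<xi>)\<close>. After translations by
  powers of \<open>T\<close> the forms \<open>f \<circ> g\<^sub>n\<close> have bounded coefficients, and a limit form has Markoff constant
  exactly \<open>L(\<xi>)\<close>. Discreteness of the group enters in \<open>cusp_distance\<close>, and a Dirichlet theorem
  (\<open>hecke_dirichlet\<close>) gives \<open>L(\<xi>) > 0\<close>. Hence every finite element of the Lagrange spectrum lies in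
  the Markoff spectrum (\<open>lagrange_const_in_markoff_spectrum\<close>), and Hausdorff dimension is monotone.

  Positive dimension. The images of the ideal hexagon with vertices
  \<open>\<infinity>, 0, 1/\<surd>3, \<surd>3/2, 2/\<surd>3, \<surd>3\<close> tile the upper half plane; a geodesic that enters through the side
  \<open>(0, \<infinity>)\<close> leaves through one of five sides, and reading off the sides codes its endpoint by digits.
  A horoball that the geodesic enters deeply belongs to a side that it crosses
  (\<open>good_approximation_is_convergent\<close>), so \<open>L(\<xi>)\<close> is a limit superior over the positions of the code of
  \<open>[d\<^sub>n d\<^sub>n\<^sub>+\<^sub>1 \<dots>] + [d\<^sub>n\<^sub>-\<^sub>1 \<dots> d\<^sub>0]\<close> and of the sum of the reciprocals (\<open>lagrange_const_eq\<close>).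

  The periodic geodesic coded by \<open>\<dots>2424\<dots>\<close> has an asymptotic neighbour \<open>\<dots>2424 3 2424\<dots>\<close> whose highest
  excursion is exactly \<open>4/\<surd>3\<close> (\<open>\<eta>_sum\<close>). Words \<open>3 (24)\<^bsup>k\<^sub>0\<^esup> 3 (24)\<^bsup>k\<^sub>1\<^esup> \<dots>\<close> with large exponents therefore
  have Lagrange constants close to \<open>4/\<surd>3\<close>. The heights at the digits 3 depend monotonically on the
  exponents. Each digit 3 has two high cusps, one on either side; the first is highest when the exponents
  before the digit are large and those after it are small, the second in the opposite case.
  So for a sequence of exponents that contains, with \<open>j\<close> growing, the patterns
  \<open>(m+3)\<^bsup>j\<^esup> m b\<^sub>0 \<dots> b\<^sub>j\<^sub>-\<^sub>1\<close>, where \<open>b\<^sub>l \<in> {m+1, m+2}\<close>, the limit superior is attained along the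
  markers \<open>m\<close> (\<open>marked_lagrange_const\<close>). Its value is a constant plus an expansion with free exponents
  \<open>b\<^sub>0, b\<^sub>1, \<dots>\<close>, and such values fill a Cantor set. Sending \<open>v \<in> [0, 1)\<close> to the
  value whose \<open>b\<close> spells the binary digits of \<open>v\<close> gives a map whose inverse is Hoelder continuous, and the existence of such a map bounds the dimension
  from below (\<open>hausdorff_dim_ge_of_expanding\<close>).
\<close>

section \<open>Hausdorff dimension\<close>

lemma hausdorff_dim_mono:
  assumes "A \<subseteq> B"
  shows "hausdorff_dim A \<le> hausdorff_dim B"
proof -
  have "hausdorff_premeasure s \<delta> A \<le> hausdorff_premeasure s \<delta> B" for s \<delta>
    unfolding hausdorff_premeasure_def using assms by (intro Inf_superset_mono) blast
  then have "hausdorff_measure s A \<le> hausdorff_measure s B" for s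
    unfolding hausdorff_measure_def by (intro SUP_mono) auto
  then have "hausdorff_measure s A = 0" if "hausdorff_measure s B = 0" for s
    using that by (metis le_zero_eq)
  then show ?thesis
    unfolding hausdorff_dim_def by (intro Inf_superset_mono) blast
qed

lemma real_set_in_interval:
  fixes P :: "real set"
  assumes "\<And>y y'. y \<in> P \<Longrightarrow> y' \<in> P \<Longrightarrow> \<bar>y - y'\<bar> \<le> K" and "0 \<le> K"
  shows "\<exists>a b. a \<le> b \<and> b - a \<le> K \<and> P \<subseteq> {a..b}"
proof (cases "P = {}")
  case True
  then show ?thesis using assms by (intro exI[of _ 0]) auto
next
  case False
  then obtain y0 where y0: "y0 \<in> P" by auto
  have bdd: "bdd_above P" "bdd_below P"
    using assms(1)[OF _ y0] by (force intro!: bdd_aboveI[of _ "y0 + K"] bdd_belowI[of _ "y0 - K"] simp: abs_le_iff)+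
  have 1: "Sup P \<le> y' + K" if "y' \<in> P" for y'
  proof (rule cSup_least)
    show "x \<le> y' + K" if "x \<in> P" for x
      using assms(1)[OF that \<open>y' \<in> P\<close>] by linarith
  qed (fact False)
  have 2: "Sup P - K \<le> Inf P"
    using 1 False by (intro cInf_greatest) (auto simp: algebra_simps)
  have 3: "P \<subseteq> {Inf P..Sup P}"
    using bdd by (auto intro: cInf_lower cSup_upper)
  with y0 have "Inf P \<le> Sup P" by fastforce
  with 2 3 show ?thesis by (intro exI[of _ "Inf P"] exI[of _ "Sup P"]) auto
qed

text \<open>
  A cover of \<open>A\<close> by sets \<open>U\<^sub>i\<close> pulls back under \<open>E\<close> to a cover of \<open>[0, 1)\<close> by sets of diameter at most
  \<open>C diam(U\<^sub>i)\<^sup>s\<close>. The lengths of the latter add up to at least 1, so \<open>\<Sum> diam(U\<^sub>i)\<^sup>s \<ge> 1/C\<close>; for exponents below \<open>s\<close>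
  the sum only grows when the diameters are at most 1.
\<close>

lemma hausdorff_dim_ge_of_expanding:
  fixes E :: "real \<Rightarrow> real"
  assumes C: "C > 0" and s: "s > 0" and A: "E ` {0..<1} \<subseteq> A"
    and E: "\<And>y y'. y \<in> {0..<1} \<Longrightarrow> y' \<in> {0..<1} \<Longrightarrow> \<bar>y - y'\<bar> \<le> C * \<bar>E y - E y'\<bar> powr s"
  shows "ennreal s \<le> hausdorff_dim A"
  unfolding hausdorff_dim_def
proof (rule Inf_greatest)
  fix v assume "v \<in> {ennreal s' | s'. s' \<ge> 0 \<and> hausdorff_measure s' A = 0}"
  then obtain s' where v: "v = ennreal s'" and s': "0 \<le> s'" and null: "hausdorff_measure s' A = 0"
    by blast
  have "s \<le> s'"
  proof (rule ccontr)
    assume "\<not> s \<le> s'"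
    then have less: "s' < s" by simp
    have "ennreal (1 / C) \<le> (\<Sum>i. ennreal (diam_pow s' (U i)))"
      if cov: "A \<subseteq> (\<Union>i. U i)" and U: "\<And>i. bounded (U i) \<and> diameter (U i) \<le> 1" for U :: "nat \<Rightarrow> real set"
    proof -
      define P where "P i = {y \<in> {0..<1}. E y \<in> U i}" for i
      have "\<exists>a b. a \<le> b \<and> b - a \<le> C * diam_pow s' (U i) \<and> P i \<subseteq> {a..b}" for i
      proof (rule real_set_in_interval)
        show "0 \<le> C * diam_pow s' (U i)" using C by (simp add: diam_pow_def)
        fix y y' assume y: "y \<in> P i" "y' \<in> P i"
        have dist: "\<bar>E y - E y'\<bar> \<le> diameter (U i)"
          using diameter_bounded_bound[of "U i" "E y" "E y'"] y U by (auto simp: P_def dist_real_def)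
        have "\<bar>E y - E y'\<bar> powr s \<le> diameter (U i) powr s"
          using dist s by (intro powr_mono2) auto
        also have "\<dots> \<le> diam_pow s' (U i)"
        proof (cases "s' = 0")
          case True
          then show ?thesis using y U[of i] s dist by (auto simp: diam_pow_def P_def intro!: powr_le1)
        next
          case False
          then show ?thesis using y U[of i] less s' dist by (auto simp: diam_pow_def P_def intro!: powr_mono')
        qed
        finally have "C * \<bar>E y - E y'\<bar> powr s \<le> C * diam_pow s' (U i)"
          using C by simp
        then show "\<bar>y - y'\<bar> \<le> C * diam_pow s' (U i)"
          using E[of y y'] y by (auto simp: P_def)
      qed
      then obtain a b where ab: "\<And>i. a i \<le> b i" "\<And>i. b i - a i \<le> C * diam_pow s' (U i)"
        "\<And>i. P i \<subseteq> {a i..b i}" by metis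
      have "{0..<1} \<subseteq> (\<Union>i. {a i..b i})"
      proof
        fix y :: real assume y: "y \<in> {0..<1}"
        then obtain i where "E y \<in> U i" using A cov by blast
        then show "y \<in> (\<Union>i. {a i..b i})" using y subsetD[OF ab(3)[of i], of y] by (auto simp: P_def intro: exI[of _ i])
      qed
      then have "emeasure lborel {0..<1::real} \<le> emeasure lborel (\<Union>i. {a i..b i})"
        by (intro emeasure_mono) auto
      also have "\<dots> \<le> (\<Sum>i. emeasure lborel {a i..b i})"
        by (intro emeasure_subadditive_countably) auto
      also have "\<dots> \<le> (\<Sum>i. ennreal C * ennreal (diam_pow s' (U i)))"
      proof (intro suminf_le summableI)
        fix i
        have "emeasure lborel {a i..b i} = ennreal (b i - a i)" using ab(1) by simp
        also have "\<dots> \<le> ennreal (C * diam_pow s' (U i))" using ab(2) by (intro ennreal_leI)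
        finally show "emeasure lborel {a i..b i} \<le> ennreal C * ennreal (diam_pow s' (U i))"
          using C by (simp add: ennreal_mult' diam_pow_def)
      qed
      also have "\<dots> = ennreal C * (\<Sum>i. ennreal (diam_pow s' (U i)))"
        by simp
      finally have "1 \<le> ennreal C * (\<Sum>i. ennreal (diam_pow s' (U i)))" by simp
      then have "ennreal (1 / C) * 1 \<le> ennreal (1 / C) * (ennreal C * (\<Sum>i. ennreal (diam_pow s' (U i))))"
        by (intro mult_left_mono) auto
      also have "\<dots> = (\<Sum>i. ennreal (diam_pow s' (U i)))"
        using C by (simp add: mult.assoc[symmetric] ennreal_mult'[symmetric])
      finally show ?thesis by simp
    qed
    then have "ennreal (1 / C) \<le> hausdorff_premeasure s' 1 A"
      unfolding hausdorff_premeasure_def by (intro Inf_greatest) blast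
    also have "\<dots> \<le> hausdorff_measure s' A"
      unfolding hausdorff_measure_def by (intro SUP_upper) auto
    finally have "ennreal (1 / C) = 0" using null by simp
    then have "1 / C \<le> 0" by (simp only: ennreal_eq_0_iff)
    then show False using C by (simp add: divide_le_0_iff)
  qed
  then show "ennreal s \<le> v" unfolding v by (rule ennreal_leI)
qed

section \<open>The Hecke group as a group of real matrices\<close>

definition mat2 :: "real \<Rightarrow> real \<Rightarrow> real \<Rightarrow> real \<Rightarrow> real^2^2" where
  "mat2 a b c d = vector [vector [a, b], vector [c, d]]"

text \<open>
  Membership of a matrix in the preimage of \<open>H\<^sub>6\<close> in \<open>SL\<^sub>2(\<real>)\<close>. Working with four real entries avoids
  both cosets and the choice of representatives.
\<close>

definition in_H6 :: "real \<Rightarrow> real \<Rightarrow> real \<Rightarrow> real \<Rightarrow> bool" where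
  "in_H6 a b c d \<longleftrightarrow> a * d - b * c = 1 \<and> psl (mat2 a b c d) \<in> H6"

lemma mat2_nth [simp]:
  "mat2 a b c d $ 1 $ 1 = a" "mat2 a b c d $ 1 $ 2 = b"
  "mat2 a b c d $ 2 $ 1 = c" "mat2 a b c d $ 2 $ 2 = d"
  by (simp_all add: mat2_def)

lemma mat2_eta: "A = mat2 (A $ 1 $ 1) (A $ 1 $ 2) (A $ 2 $ 1) (A $ 2 $ 2)"
  by (simp add: vec_eq_iff forall_2)

lemma mat2_eq_iff: "mat2 a b c d = mat2 a' b' c' d' \<longleftrightarrow> a = a' \<and> b = b' \<and> c = c' \<and> d = d'"
  by (auto simp: vec_eq_iff forall_2)

lemma uminus_mat2: "- mat2 a b c d = mat2 (- a) (- b) (- c) (- d)"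
  by (simp add: vec_eq_iff forall_2)

lemma det_mat2: "det (mat2 a b c d) = a * d - b * c"
  by (simp add: det_2)

lemma mult_mat2:
  "mat2 a b c d ** mat2 a' b' c' d' =
    mat2 (a * a' + b * c') (a * b' + b * d') (c * a' + d * c') (c * b' + d * d')"
  by (simp add: vec_eq_iff forall_2 matrix_matrix_mult_def sum_2)

lemma mat_1_eq_mat2: "mat 1 = mat2 1 0 0 1"
  by (simp add: vec_eq_iff forall_2 mat_def)

lemma psl_mult: "det A = 1 \<Longrightarrow> det B = 1 \<Longrightarrow> psl A \<otimes>\<^bsub>PSL2R\<^esub> psl B = psl (A ** B)"
  using normal.rcos_sum[OF normal_pm_one, of A B]
  by (simp add: psl_def PSL2R_def FactGroup_def)

lemma psl_one: "psl (mat 1) = \<one>\<^bsub>PSL2R\<^esub>"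
  by (simp add: psl_eq PSL2R_def FactGroup_def)

lemma psl_uminus: "psl (- A) = psl A"
  by (simp add: psl_eq insert_commute)

lemma psl_inverse:
  assumes "a * d - b * c = 1"
  shows "inv\<^bsub>PSL2R\<^esub> (psl (mat2 a b c d)) = psl (mat2 d (- b) (- c) a)"
proof (rule group.inv_equality[OF group_PSL2R])
  have "psl (mat2 d (- b) (- c) a) \<otimes>\<^bsub>PSL2R\<^esub> psl (mat2 a b c d) = psl (mat 1)"
    using assms by (subst psl_mult) (auto simp: det_mat2 mult_mat2 mat_1_eq_mat2 mat2_eq_iff algebra_simps)
  then show "psl (mat2 d (- b) (- c) a) \<otimes>\<^bsub>PSL2R\<^esub> psl (mat2 a b c d) = \<one>\<^bsub>PSL2R\<^esub>"
    by (simp add: psl_one)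
qed (use assms in \<open>auto simp: carrier_PSL2R det_mat2 algebra_simps intro!: imageI\<close>)

lemma subgroup_H6: "subgroup H6 PSL2R"
  unfolding H6_def
  by (rule group.generate_is_subgroup[OF group_PSL2R]) (use generators_PSL2R in auto)

lemma in_H6_det: "in_H6 a b c d \<Longrightarrow> a * d - b * c = 1"
  by (simp add: in_H6_def)

lemma in_H6_mult:
  assumes "in_H6 a b c d" "in_H6 a' b' c' d'"
  shows "in_H6 (a * a' + b * c') (a * b' + b * d') (c * a' + d * c') (c * b' + d * d')"
proof -
  have "psl (mat2 a b c d) \<otimes>\<^bsub>PSL2R\<^esub> psl (mat2 a' b' c' d') \<in> H6"
    using assms subgroup.m_closed[OF subgroup_H6] by (simp add: in_H6_def)
  moreover have "(a * a' + b * c') * (c * b' + d * d') - (a * b' + b * d') * (c * a' + d * c')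
     = (a * d - b * c) * (a' * d' - b' * c')" by (simp add: algebra_simps)
  ultimately show ?thesis
    using assms by (simp add: psl_mult in_H6_def det_mat2 mult_mat2)
qed

lemma in_H6_inverse: "in_H6 a b c d \<Longrightarrow> in_H6 d (- b) (- c) a"
  using subgroup.m_inv_closed[OF subgroup_H6, of "psl (mat2 a b c d)"]
  by (simp add: in_H6_def psl_inverse algebra_simps)

lemma in_H6_uminus: "in_H6 a b c d \<Longrightarrow> in_H6 (- a) (- b) (- c) (- d)"
  using psl_uminus[of "mat2 a b c d"] by (simp add: in_H6_def uminus_mat2)

lemma in_H6_one: "in_H6 1 0 0 1"
  using subgroup.one_closed[OF subgroup_H6] by (simp add: in_H6_def psl_one flip: mat_1_eq_mat2)

lemma in_H6_S: "in_H6 0 (- 1) 1 0"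
  by (auto simp: in_H6_def H6_def mat2_def mat_S_def intro: generate.incl)

lemma in_H6_T: "in_H6 1 (sqrt 3) 0 1"
  by (auto simp: in_H6_def H6_def mat2_def mat_T_def intro: generate.incl)

lemma in_H6_T_nat: "in_H6 1 (sqrt 3 * real n) 0 1"
proof (induction n)
  case (Suc n)
  show ?case using in_H6_mult[OF Suc in_H6_T] by (simp add: algebra_simps)
qed (use in_H6_one in simp)

lemma in_H6_T_int: "in_H6 1 (sqrt 3 * of_int k) 0 1"
proof (cases k rule: int_cases2)
  case (nonneg n)
  then show ?thesis using in_H6_T_nat[of n] by simp
next
  case (nonpos n)
  then show ?thesis using in_H6_inverse[OF in_H6_T_nat[of n]] by simp
qed

text \<open>
  Right multiplication by \<open>T\<^sup>k\<close>: the cusp \<open>a/c\<close> stays and the second column moves along it.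
\<close>

lemma in_H6_translate:
  assumes "in_H6 a b c d"
  shows "in_H6 a (b + sqrt 3 * of_int k * a) c (d + sqrt 3 * of_int k * c)"
  using in_H6_mult[OF assms in_H6_T_int[of k]] by (simp add: algebra_simps)

lemma in_H6_swap: "in_H6 a b c d \<Longrightarrow> in_H6 b (- a) d (- c)"
  using in_H6_mult[OF _ in_H6_S, of a b c d] by simp

lemma psl_eqD: "psl A = psl B \<Longrightarrow> A = B \<or> A = - B"
  by (auto simp: psl_eq doubleton_eq_iff)

lemma rep_in_H6:
  assumes "g \<in> H6"
  shows "in_H6 (ent_a g) (ent_b g) (ent_c g) (ent_d g)"
proof -
  have "g \<in> carrier PSL2R" using assms subgroup.subset[OF subgroup_H6] by auto
  then obtain A where A: "g = psl A" "det A = 1" by (auto simp: carrier_PSL2R)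
  let ?R = "rep g"
  have R: "?R = A \<or> ?R = - A" using rep_psl[of A] A by simp
  then have "det ?R = 1" "psl ?R = g" using A by (auto simp: det_uminus_2 psl_uminus)
  moreover have "mat2 (ent_a g) (ent_b g) (ent_c g) (ent_d g) = ?R"
    by (simp add: ent_a_def ent_b_def ent_c_def ent_d_def flip: mat2_eta)
  ultimately show ?thesis using assms by (metis in_H6_def det_mat2)
qed

lemma in_H6_rep:
  assumes "in_H6 a b c d"
  shows "\<exists>g\<in>H6. ent_a g = a \<and> ent_b g = b \<and> ent_c g = c \<and> ent_d g = d \<or>
     ent_a g = - a \<and> ent_b g = - b \<and> ent_c g = - c \<and> ent_d g = - d"
proof (intro bexI)
  show "psl (mat2 a b c d) \<in> H6" using assms by (simp add: in_H6_def)
  have "rep (psl (mat2 a b c d)) = mat2 a b c d \<or> rep (psl (mat2 a b c d)) = mat2 (- a) (- b) (- c) (- d)"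
    using rep_psl[of "mat2 a b c d"] by (simp add: uminus_mat2)
  then show "ent_a (psl (mat2 a b c d)) = a \<and> ent_b (psl (mat2 a b c d)) = b \<and>
        ent_c (psl (mat2 a b c d)) = c \<and> ent_d (psl (mat2 a b c d)) = d \<or>
      ent_a (psl (mat2 a b c d)) = - a \<and> ent_b (psl (mat2 a b c d)) = - b \<and>
        ent_c (psl (mat2 a b c d)) = - c \<and> ent_d (psl (mat2 a b c d)) = - d"
    by (auto simp: ent_a_def ent_b_def ent_c_def ent_d_def)
qed

lemma sqrt3_mult: "sqrt 3 * (sqrt 3 * x) = 3 * x"
  by (simp add: mult.assoc[symmetric])

lemma sqrt3_mult2: "sqrt 3 * x * (sqrt 3 * y) = 3 * x * y"
  by (simp add: algebra_simps sqrt3_mult)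

text \<open>
  The generators \<open>T\<close> and \<open>S\<close> are of the first and the second of these shapes, and the shapes
  multiply like the group with two elements. This is the source of all discreteness below.
\<close>

definition hecke_shape :: "real \<Rightarrow> real \<Rightarrow> real \<Rightarrow> real \<Rightarrow> bool" where
  "hecke_shape a b c d \<longleftrightarrow> a * d - b * c = 1 \<and>
     ((\<exists>p q r s. a = real_of_int p \<and> b = sqrt 3 * real_of_int q \<and> c = sqrt 3 * real_of_int r \<and> d = real_of_int s) \<or>
      (\<exists>p q r s. a = sqrt 3 * real_of_int p \<and> b = real_of_int q \<and> c = real_of_int r \<and> d = sqrt 3 * real_of_int s))"

lemma hecke_shape_integral:
  fixes p q r s :: int
  assumes "p * s - 3 * q * r = 1"
  shows "hecke_shape p (sqrt 3 * q) (sqrt 3 * r) s"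
proof -
  have "real_of_int (p * s - 3 * q * r) = 1" using assms by simp
  then show ?thesis unfolding hecke_shape_def by (auto simp: sqrt3_mult algebra_simps)
qed

lemma hecke_shape_twisted:
  fixes p q r s :: int
  assumes "3 * p * s - q * r = 1"
  shows "hecke_shape (sqrt 3 * p) q r (sqrt 3 * s)"
proof -
  have "real_of_int (3 * p * s - q * r) = 1" using assms by simp
  then show ?thesis unfolding hecke_shape_def by (auto simp: sqrt3_mult algebra_simps)
qed

lemma hecke_shape_cases [consumes 1, case_names integral twisted]:
  assumes "hecke_shape a b c d"
  obtains p q r s :: int where "a = p" "b = sqrt 3 * q" "c = sqrt 3 * r" "d = s" "p * s - 3 * q * r = 1"
    | p q r s :: int where "a = sqrt 3 * p" "b = q" "c = r" "d = sqrt 3 * s" "3 * p * s - q * r = 1"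
proof -
  have det: "a * d - b * c = 1" using assms by (simp add: hecke_shape_def)
  from assms consider
      (1) p q r s :: int where "a = p" "b = sqrt 3 * q" "c = sqrt 3 * r" "d = s"
    | (2) p q r s :: int where "a = sqrt 3 * p" "b = q" "c = r" "d = sqrt 3 * s"
    unfolding hecke_shape_def by metis
  then show ?thesis
  proof cases
    case 1
    have "real_of_int (p * s - 3 * q * r) = 1" using det[unfolded 1 sqrt3_mult2] by simp
    then have "p * s - 3 * q * r = 1" by linarith
    then show ?thesis using that(1) 1 by blast
  next
    case 2
    have "real_of_int (3 * p * s - q * r) = 1" using det[unfolded 2 sqrt3_mult2] by simp
    then have "3 * p * s - q * r = 1" by linarith
    then show ?thesis using that(2) 2 by blast
  qed
qed

lemma hecke_shape_mult:
  assumes "hecke_shape a b c d" "hecke_shape a' b' c' d'"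
  shows "hecke_shape (a * a' + b * c') (a * b' + b * d') (c * a' + d * c') (c * b' + d * d')"
proof -
  have det: "(a * a' + b * c') * (c * b' + d * d') - (a * b' + b * d') * (c * a' + d * c')
     = (a * d - b * c) * (a' * d' - b' * c')" by (simp add: algebra_simps)
  from assms(1) show ?thesis
  proof (cases rule: hecke_shape_cases)
    case A: (integral p q r s)
    from assms(2) show ?thesis
    proof (cases rule: hecke_shape_cases)
      case B: (integral p' q' r' s')
      show ?thesis unfolding hecke_shape_def det using assms
        by (intro conjI disjI1 exI[of _ "p * p' + 3 * q * r'"] exI[of _ "p * q' + q * s'"]
              exI[of _ "r * p' + s * r'"] exI[of _ "3 * r * q' + s * s'"])
          (auto simp: A(1-4) B(1-4) hecke_shape_def sqrt3_mult algebra_simps)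
    next
      case B: (twisted p' q' r' s')
      show ?thesis unfolding hecke_shape_def det using assms
        by (intro conjI disjI2 exI[of _ "p * p' + q * r'"] exI[of _ "p * q' + 3 * q * s'"]
              exI[of _ "3 * r * p' + s * r'"] exI[of _ "r * q' + s * s'"])
          (auto simp: A(1-4) B(1-4) hecke_shape_def sqrt3_mult algebra_simps)
    qed
  next
    case A: (twisted p q r s)
    from assms(2) show ?thesis
    proof (cases rule: hecke_shape_cases)
      case B: (integral p' q' r' s')
      show ?thesis unfolding hecke_shape_def det using assms
        by (intro conjI disjI2 exI[of _ "p * p' + q * r'"] exI[of _ "3 * p * q' + q * s'"]
              exI[of _ "r * p' + 3 * s * r'"] exI[of _ "r * q' + s * s'"])
          (auto simp: A(1-4) B(1-4) hecke_shape_def sqrt3_mult algebra_simps)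
    next
      case B: (twisted p' q' r' s')
      show ?thesis unfolding hecke_shape_def det using assms
        by (intro conjI disjI1 exI[of _ "3 * p * p' + q * r'"] exI[of _ "p * q' + q * s'"]
              exI[of _ "r * p' + s * r'"] exI[of _ "r * q' + 3 * s * s'"])
          (auto simp: A(1-4) B(1-4) hecke_shape_def sqrt3_mult algebra_simps)
    qed
  qed
qed

lemma hecke_shape_uminus:
  assumes "hecke_shape a b c d" shows "hecke_shape (- a) (- b) (- c) (- d)"
  using assms
proof (cases rule: hecke_shape_cases)
  case (integral p q r s)
  then show ?thesis using hecke_shape_integral[of "- p" "- s" "- q" "- r"] by simp
next
  case (twisted p q r s)
  then show ?thesis using hecke_shape_twisted[of "- p" "- s" "- q" "- r"] by simp
qed

lemma hecke_shape_gens: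
  "hecke_shape 1 0 0 1" "hecke_shape 0 (- 1) 1 0" "hecke_shape 0 1 (- 1) 0"
  "hecke_shape 1 (sqrt 3) 0 1" "hecke_shape 1 (- sqrt 3) 0 1"
  using hecke_shape_integral[of 1 1 0 0] hecke_shape_integral[of 1 1 1 0] hecke_shape_integral[of 1 1 "-1" 0]
    hecke_shape_twisted[of 0 0 1 "-1"] hecke_shape_twisted[of 0 0 "-1" 1] by simp_all

lemma in_H6_shape:
  assumes "in_H6 a b c d"
  shows "hecke_shape a b c d"
proof -
  have "\<exists>a b c d. g = psl (mat2 a b c d) \<and> hecke_shape a b c d" if "g \<in> H6" for g
    using that unfolding H6_def
  proof (induction rule: generate.induct)
    case one
    show ?case using hecke_shape_gens(1) by (metis psl_one mat_1_eq_mat2)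
  next
    case (incl h)
    then show ?case using hecke_shape_gens(2,4) by (auto simp: mat_S_def mat_T_def mat2_def)
  next
    case (inv h)
    then have "h = psl (mat2 0 (- 1) 1 0) \<or> h = psl (mat2 1 (sqrt 3) 0 1)"
      by (auto simp: mat_S_def mat_T_def mat2_def)
    then have "inv\<^bsub>PSL2R\<^esub> h = psl (mat2 0 1 (- 1) 0) \<or> inv\<^bsub>PSL2R\<^esub> h = psl (mat2 1 (- sqrt 3) 0 1)"
      by (auto simp: psl_inverse)
    then show ?case using hecke_shape_gens(3,5) by metis
  next
    case (eng g h)
    then obtain a b c d a' b' c' d' where
      gh: "g = psl (mat2 a b c d)" "hecke_shape a b c d" "h = psl (mat2 a' b' c' d')" "hecke_shape a' b' c' d'"
      by metis
    then have "g \<otimes>\<^bsub>PSL2R\<^esub> h = psl (mat2 a b c d ** mat2 a' b' c' d')"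
      by (simp add: psl_mult det_mat2 hecke_shape_def)
    then show ?case using hecke_shape_mult[OF gh(2,4)] by (metis mult_mat2)
  qed
  then obtain a' b' c' d' where "psl (mat2 a b c d) = psl (mat2 a' b' c' d')" "hecke_shape a' b' c' d'"
    using assms unfolding in_H6_def by metis
  then show ?thesis
    using hecke_shape_uminus by (auto dest!: psl_eqD simp: uminus_mat2 mat2_eq_iff)
qed

lemma in_H6_entry_ge_1:
  assumes "in_H6 a b c d"
  shows "a \<noteq> 0 \<Longrightarrow> 1 \<le> \<bar>a\<bar>" "b \<noteq> 0 \<Longrightarrow> 1 \<le> \<bar>b\<bar>" "c \<noteq> 0 \<Longrightarrow> 1 \<le> \<bar>c\<bar>" "d \<noteq> 0 \<Longrightarrow> 1 \<le> \<bar>d\<bar>"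
proof -
  have 1: "1 \<le> \<bar>real_of_int p\<bar>" if "real_of_int p \<noteq> 0" for p
    using that by (simp flip: of_int_abs)
  have 2: "1 \<le> \<bar>sqrt 3 * real_of_int p\<bar>" if "sqrt 3 * real_of_int p \<noteq> 0" for p
    using mult_mono[of 1 "sqrt 3" 1 "\<bar>real_of_int p\<bar>"] 1[of p] that by (simp add: abs_mult)
  show "a \<noteq> 0 \<Longrightarrow> 1 \<le> \<bar>a\<bar>" "b \<noteq> 0 \<Longrightarrow> 1 \<le> \<bar>b\<bar>" "c \<noteq> 0 \<Longrightarrow> 1 \<le> \<bar>c\<bar>" "d \<noteq> 0 \<Longrightarrow> 1 \<le> \<bar>d\<bar>"
    using in_H6_shape[OF assms] 1 2 unfolding hecke_shape_def by auto
qed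

section \<open>Lagrange constants and parabolic fixed points\<close>

text \<open>
  The filter in \<^const>\<open>lagrange_const\<close> in terms of bounds on \<open>\<bar>c\<bar>\<close>. The four lemmas after
  \<open>inverse_ennreal_le_iff\<close> use it to replace every later appeal to the limit superior by statements
  about real numbers.
\<close>

lemma eventually_H6_iff:
  "eventually P (inf (filtercomap (\<lambda>g. \<bar>ent_c g\<bar>) at_top) (principal H6)) \<longleftrightarrow>
     (\<exists>N. \<forall>g\<in>H6. \<bar>ent_c g\<bar> > N \<longrightarrow> P g)"
  unfolding eventually_inf_principal eventually_filtercomap_at_top_dense by blast

lemma height_eq:
  assumes "ent_c g \<noteq> 0"
  shows "(ent_c g)\<^sup>2 * \<bar>\<xi> - coord (moebius g Infty)\<bar> = \<bar>ent_c g * (ent_a g - \<xi> * ent_c g)\<bar>"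
proof -
  have "ent_c g * (ent_a g - \<xi> * ent_c g) = - ((ent_c g)\<^sup>2 * (\<xi> - ent_a g / ent_c g))"
    using assms by (simp add: field_simps power2_eq_square)
  then have "\<bar>ent_c g * (ent_a g - \<xi> * ent_c g)\<bar> = \<bar>(ent_c g)\<^sup>2 * (\<xi> - ent_a g / ent_c g)\<bar>"
    by simp
  then show ?thesis using assms by (simp add: abs_mult)
qed

lemma inverse_ennreal_le_iff:
  assumes "v > 0" "x \<ge> 0"
  shows "inverse (ennreal x) \<le> ennreal v \<longleftrightarrow> 1 \<le> v * x"
proof (cases "x = 0")
  case False
  then show ?thesis using assms by (simp add: inverse_ennreal field_simps)
qed (use assms in \<open>simp add: top_unique\<close>)

lemma lagrange_const_leI:
  assumes V: "V > 0"
    and le: "\<And>V'. V' > V \<Longrightarrow> \<exists>N. \<forall>a b c d. in_H6 a b c d \<longrightarrow> \<bar>c\<bar> > N \<longrightarrow> 1 \<le> V' * \<bar>c * (a - \<xi> * c)\<bar>"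
  shows "lagrange_const \<xi> \<le> ennreal V"
proof (rule dense_ge)
  fix y assume "ennreal V < y"
  then obtain V' where V': "ennreal V < ennreal V'" "ennreal V' < y" 
    by (metis dense ennreal_cases less_top not_less_iff_gr_or_eq top.extremum_strict)
  then have "V' > V" using V by (metis ennreal_leI leD leI)
  then obtain N where N: "\<And>a b c d. in_H6 a b c d \<Longrightarrow> \<bar>c\<bar> > N \<Longrightarrow> 1 \<le> V' * \<bar>c * (a - \<xi> * c)\<bar>"
    using le by metis
  have "lagrange_const \<xi> \<le> ennreal V'"
    unfolding lagrange_const_def
  proof (intro Limsup_bounded, unfold eventually_H6_iff, intro exI ballI impI)
    fix g assume g: "g \<in> H6" "max N 0 < \<bar>ent_c g\<bar>"
    then have "1 \<le> V' * \<bar>ent_c g * (ent_a g - \<xi> * ent_c g)\<bar>"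
      using N[OF rep_in_H6] by simp
    moreover have "ent_c g \<noteq> 0" using g by auto
    ultimately show "inverse (ennreal ((ent_c g)\<^sup>2 * \<bar>\<xi> - coord (moebius g Infty)\<bar>)) \<le> ennreal V'"
      using \<open>V' > V\<close> V by (simp del: moebius.simps add: height_eq inverse_ennreal_le_iff)
  qed
  then show "lagrange_const \<xi> \<le> y" using V' by (meson less_imp_le order.trans)
qed

lemma lagrange_const_less_imp:
  assumes V: "V > 0" and less: "lagrange_const \<xi> < ennreal V"
  obtains N where "\<And>a b c d. in_H6 a b c d \<Longrightarrow> \<bar>c\<bar> > N \<Longrightarrow> 1 \<le> V * \<bar>c * (a - \<xi> * c)\<bar>"
proof -
  obtain N where N: "\<forall>g\<in>H6. \<bar>ent_c g\<bar> > N \<longrightarrow>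
      inverse (ennreal ((ent_c g)\<^sup>2 * \<bar>\<xi> - coord (moebius g Infty)\<bar>)) < ennreal V"
    using Limsup_lessD[OF less[unfolded lagrange_const_def]] unfolding eventually_H6_iff by blast
  show ?thesis
  proof (rule that[of "max N 0"])
    fix a b c d assume h: "in_H6 a b c d" "\<bar>c\<bar> > max N 0"
    from in_H6_rep[OF h(1)] obtain g where g: "g \<in> H6"
      "ent_a g = a \<and> ent_c g = c \<or> ent_a g = - a \<and> ent_c g = - c" by blast
    from g h have c: "\<bar>ent_c g\<bar> > N" "ent_c g \<noteq> 0" by auto
    then have "inverse (ennreal \<bar>ent_c g * (ent_a g - \<xi> * ent_c g)\<bar>) \<le> ennreal V"
      using N g(1) by (metis height_eq less_imp_le)
    then have "1 \<le> V * \<bar>ent_c g * (ent_a g - \<xi> * ent_c g)\<bar>"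
      using V by (simp only: inverse_ennreal_le_iff abs_ge_zero)
    moreover have "ent_c g * (ent_a g - \<xi> * ent_c g) = c * (a - \<xi> * c)"
      using g(2) by (auto simp: algebra_simps)
    ultimately show "1 \<le> V * \<bar>c * (a - \<xi> * c)\<bar>" by simp
  qed
qed

lemma lagrange_const_geI:
  assumes V: "V > 0"
    and ge: "\<And>V' N. 0 < V' \<Longrightarrow> V' < V \<Longrightarrow> \<exists>a b c d. in_H6 a b c d \<and> \<bar>c\<bar> > N \<and> V' * \<bar>c * (a - \<xi> * c)\<bar> < 1"
  shows "ennreal V \<le> lagrange_const \<xi>"
proof (rule ccontr)
  assume "\<not> ?thesis"
  then obtain y where y: "lagrange_const \<xi> < y" "y < ennreal V"
    using dense[of "lagrange_const \<xi>" "ennreal V"] by (auto simp: not_le)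
  then obtain V' where V': "y = ennreal V'" "0 \<le> V'" by (cases y) auto
  then have "V' < V" using y by (simp add: ennreal_less_iff)
  moreover have "0 < V'" using V' y(1) by (metis ennreal_0 gr_zeroI less_eq_real_def not_less_zero)
  ultimately show False
    using lagrange_const_less_imp[of V' \<xi>] V' y(1) ge[of V'] by (metis leD)
qed

lemma less_lagrange_const_imp:
  assumes V: "V > 0" and less: "ennreal V < lagrange_const \<xi>"
  shows "\<exists>a b c d. in_H6 a b c d \<and> \<bar>c\<bar> > N \<and> V * \<bar>c * (a - \<xi> * c)\<bar> < 1"
proof (rule ccontr)
  assume n: "\<not> ?thesis"
  have "lagrange_const \<xi> \<le> ennreal V"
  proof (rule lagrange_const_leI[OF V], intro exI allI impI)
    fix V' a b c d assume "V < V'" "in_H6 a b c d" "\<bar>c\<bar> > N"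
    then have "1 \<le> V * \<bar>c * (a - \<xi> * c)\<bar>" using n by (meson not_less)
    also have "\<dots> \<le> V' * \<bar>c * (a - \<xi> * c)\<bar>" using \<open>V < V'\<close> by (intro mult_right_mono) auto
    finally show "1 \<le> V' * \<bar>c * (a - \<xi> * c)\<bar>" .
  qed
  then show False using less by simp
qed

text \<open>
  A parabolic element has trace \<open>\<plusminus>2\<close>, so its fixed-point equation has a double root \<open>(a - d)/(2c)\<close>, and the
  two shapes of a matrix in the group both make this a rational multiple of \<open>\<surd>3\<close>.
\<close>

lemma Q_H6_imp_multiple_sqrt3:
  assumes "Fin \<xi> \<in> Q_H6"
  obtains u w :: int where "w > 0" "\<xi> = sqrt 3 * u / w"
proof -
  from assms obtain g where g: "g \<in> H6" "parabolic g" "moebius g (Fin \<xi>) = Fin \<xi>"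
    by (auto simp: Q_H6_def)
  define a b c d where abcd: "a = ent_a g" "b = ent_b g" "c = ent_c g" "d = ent_d g"
  have h: "in_H6 a b c d" using rep_in_H6[OF g(1)] by (simp add: abcd)
  have tr: "(a + d)\<^sup>2 = 4"
  proof -
    have "\<bar>a + d\<bar> = 2"
      using g(2) by (simp add: parabolic_def trace_def sum_2 abcd ent_a_def ent_d_def)
    then have "\<bar>a + d\<bar>\<^sup>2 = 4" by simp
    then show ?thesis by simp
  qed
  have fixp: "c * \<xi> + d \<noteq> 0" "a * \<xi> + b = \<xi> * (c * \<xi> + d)"
    using g(3) by (auto simp: abcd field_simps split: if_splits)
  have det: "a * d - b * c = 1" using h by (rule in_H6_det)
  have "(2 * c * \<xi> - (a - d))\<^sup>2 = (a + d)\<^sup>2 - 4 * (a * d - b * c) + 4 * c * (c * \<xi>\<^sup>2 + d * \<xi> - a * \<xi> - b)"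
    by (simp add: algebra_simps power2_eq_square)
  also have "\<dots> = 0" using tr det fixp(2) by (simp add: algebra_simps power2_eq_square)
  finally have root: "2 * c * \<xi> = a - d" by simp
  have cnz: "c \<noteq> 0"
  proof
    assume c: "c = 0"
    then have "a = d" using root by simp
    then have a: "a * a = 1" using det c by simp
    then have "b = 0" using fixp(2) c \<open>a = d\<close> by simp
    moreover have "a = 1 \<or> a = - 1" using a by (simp add: square_eq_1_iff)
    ultimately have "rep g = mat 1 \<or> rep g = - mat 1"
      using c \<open>a = d\<close> by (subst (1 2) mat2_eta) (auto simp: mat_1_eq_mat2 uminus_mat2 mat2_eq_iff abcd
         ent_a_def ent_b_def ent_c_def ent_d_def)
    moreover have "g \<in> carrier PSL2R" using g(2) by (simp add: parabolic_def)
    then obtain A where A: "g = psl A" by (auto simp: carrier_PSL2R)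
    have "psl (rep g) = g" using rep_psl[of A] by (auto simp: A psl_uminus)
    ultimately have "g = psl (mat 1)" by (metis psl_uminus)
    then show False using g(2) by (simp add: parabolic_def psl_one)
  qed
  have "\<exists>u w. w \<noteq> 0 \<and> \<xi> = sqrt 3 * real_of_int u / real_of_int w"
    using in_H6_shape[OF h]
  proof (cases rule: hecke_shape_cases)
    case (integral p q r s)
    have "sqrt 3 * (2 * c * \<xi>) = sqrt 3 * (a - d)" using root by simp
    then have "6 * r * \<xi> = sqrt 3 * of_int (p - s)"
      using integral by (simp add: sqrt3_mult algebra_simps)
    moreover have "6 * r \<noteq> 0" using integral cnz by auto
    ultimately have "\<xi> = sqrt 3 * of_int (p - s) / of_int (6 * r)" "6 * r \<noteq> 0"
      by (simp_all add: field_simps)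
    then show ?thesis by (intro exI[of _ "p - s"] exI[of _ "6 * r"]) simp
  next
    case (twisted p q r s)
    then have "\<xi> = sqrt 3 * of_int (p - s) / of_int (2 * r)" "2 * r \<noteq> 0"
      using root cnz by (auto simp: field_simps)
    then show ?thesis by (intro exI[of _ "p - s"] exI[of _ "2 * r"]) simp
  qed
  then obtain u w where "w \<noteq> 0" "\<xi> = sqrt 3 * real_of_int u / real_of_int w" by blast
  then show ?thesis using that[of w u] that[of "- w" "- u"] by (cases "w > 0") auto
qed

text \<open>
  The parabolic element is the conjugate of \<open>T\<close> by the given matrix.
\<close>

lemma in_H6_fraction_in_Q_H6:
  assumes h: "in_H6 a b c d" and c: "c \<noteq> 0"
  shows "Fin (a / c) \<in> Q_H6"
proof -
  have det: "a * d - b * c = 1" using h by (rule in_H6_det)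
  define s where "s = sqrt 3"
  have s: "s > 0" by (simp add: s_def)
  have "in_H6 (a * 1 + b * 0) (a * s + b * 1) (c * 1 + d * 0) (c * s + d * 1)"
    unfolding s_def by (rule in_H6_mult[OF h in_H6_T])
  from in_H6_mult[OF this in_H6_inverse[OF h]]
  have "in_H6 (a * d - (a * s + b) * c) ((a * s + b) * a - a * b) (c * d - (c * s + d) * c) ((c * s + d) * a - c * b)"
    by (simp add: algebra_simps)
  moreover have "a * d - (a * s + b) * c = 1 - s * a * c" "(c * s + d) * a - c * b = 1 + s * a * c"
    using det by (simp_all add: algebra_simps)
  moreover have "(a * s + b) * a - a * b = s * a\<^sup>2" "c * d - (c * s + d) * c = - s * c\<^sup>2"
    by (simp_all add: algebra_simps power2_eq_square)
  ultimately have P: "in_H6 (1 - s * a * c) (s * a\<^sup>2) (- s * c\<^sup>2) (1 + s * a * c)" by simp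
  from in_H6_rep[OF P] obtain g where g: "g \<in> H6"
    and ent: "ent_a g = 1 - s * a * c \<and> ent_b g = s * a\<^sup>2 \<and> ent_c g = - s * c\<^sup>2 \<and> ent_d g = 1 + s * a * c \<or>
     ent_a g = - (1 - s * a * c) \<and> ent_b g = - (s * a\<^sup>2) \<and> ent_c g = - (- s * c\<^sup>2) \<and> ent_d g = - (1 + s * a * c)"
    by blast
  have 1: "s * c\<^sup>2 * (a / c) = s * a * c" "s * a * c * (a / c) = s * a\<^sup>2"
    using c by (simp_all add: power2_eq_square)
  have "ent_c g * (a / c) + ent_d g = 1 \<and> ent_a g * (a / c) + ent_b g = a / c \<or>
      ent_c g * (a / c) + ent_d g = - 1 \<and> ent_a g * (a / c) + ent_b g = - (a / c)"
    using ent
  proof (elim disjE conjE, goal_cases)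
    case 1
    then show ?case using \<open>s * c\<^sup>2 * (a / c) = s * a * c\<close> \<open>s * a * c * (a / c) = s * a\<^sup>2\<close>
      by (simp only: left_diff_distrib) simp
  next
    case 2
    then show ?case using \<open>s * c\<^sup>2 * (a / c) = s * a * c\<close> \<open>s * a * c * (a / c) = s * a\<^sup>2\<close>
      by (simp only: left_diff_distrib minus_diff_eq mult_minus_left) simp
  qed
  then have "moebius g (Fin (a / c)) = Fin (a / c)" by auto
  moreover have "parabolic g"
  proof -
    have "g \<noteq> \<one>\<^bsub>PSL2R\<^esub>"
    proof
      assume "g = \<one>\<^bsub>PSL2R\<^esub>"
      then have "rep g = mat 1 \<or> rep g = - mat 1" using rep_psl[of "mat 1"] by (simp add: psl_one)
      then have "ent_c g = 0" by (auto simp: ent_c_def mat_1_eq_mat2 uminus_mat2)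
      then show False using ent s c by auto
    qed
    moreover have "trace (rep g) = ent_a g + ent_d g" by (simp add: trace_def sum_2 ent_a_def ent_d_def)
    then have "\<bar>trace (rep g)\<bar> = 2" using ent by auto
    ultimately show ?thesis using g subgroup.subset[OF subgroup_H6] by (auto simp: parabolic_def)
  qed
  ultimately show ?thesis using g(1) unfolding Q_H6_def by blast
qed

section \<open>Discreteness and Dirichlet's theorem\<close>

lemma finite_bounded_columns:
  "finite {(a, c). \<exists>b d. in_H6 a b c d \<and> \<bar>a\<bar> \<le> K \<and> \<bar>c\<bar> \<le> K}"
proof -
  define Z where "Z = {- \<lceil>K\<rceil> .. \<lceil>K\<rceil>}"
  define X where "X = real_of_int ` Z \<union> (\<lambda>p. sqrt 3 * real_of_int p) ` Z"
  have 1: "real_of_int p \<in> X" if "\<bar>real_of_int p\<bar> \<le> K" for p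
  proof -
    have "p \<in> Z" using that unfolding Z_def by (simp add: abs_le_iff) linarith
    then show ?thesis by (simp add: X_def)
  qed
  have 2: "sqrt 3 * real_of_int p \<in> X" if "\<bar>sqrt 3 * real_of_int p\<bar> \<le> K" for p
  proof -
    have "1 * \<bar>real_of_int p\<bar> \<le> sqrt 3 * \<bar>real_of_int p\<bar>" by (intro mult_right_mono) auto
    then have "\<bar>real_of_int p\<bar> \<le> K" using that by (simp add: abs_mult)
    then have "p \<in> Z" unfolding Z_def by (simp add: abs_le_iff) linarith
    then show ?thesis by (simp add: X_def)
  qed
  have "{(a, c). \<exists>b d. in_H6 a b c d \<and> \<bar>a\<bar> \<le> K \<and> \<bar>c\<bar> \<le> K} \<subseteq> X \<times> X"
    using 1 2 by (auto dest!: in_H6_shape elim!: hecke_shape_cases)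
  moreover have "finite (X \<times> X)" by (simp add: X_def Z_def)
  ultimately show ?thesis by (rule finite_subset)
qed

text \<open>
  Only finitely many columns \<open>(a, c)\<close> satisfy both bounds \<open>\<bar>c\<bar> \<le> N\<close> and \<open>\<bar>a - \<xi> c\<bar> \<le> 1\<close>, and none of them has
  \<open>a = \<xi> c\<close> because \<open>\<xi>\<close> is not a cusp.
\<close>

lemma cusp_distance:
  assumes "Fin \<xi> \<notin> Q_H6"
  obtains \<mu> where "\<mu> > 0" "\<And>a b c d. in_H6 a b c d \<Longrightarrow> \<bar>c\<bar> \<le> N \<Longrightarrow> \<mu> \<le> \<bar>a - \<xi> * c\<bar>"
proof -
  define K where "K = 1 + \<bar>\<xi>\<bar> * N + N"
  define F where "F = {(a, c). \<exists>b d. in_H6 a b c d \<and> \<bar>a\<bar> \<le> K \<and> \<bar>c\<bar> \<le> K}"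
  define D where "D = insert 1 ((\<lambda>(a, c). \<bar>a - \<xi> * c\<bar>) ` F)"
  have fin: "finite D" unfolding D_def F_def using finite_bounded_columns by simp
  have nz: "a - \<xi> * c \<noteq> 0" if h: "in_H6 a b c d" for a b c d
  proof
    assume 0: "a - \<xi> * c = 0"
    show False
    proof (cases "c = 0")
      case True
      then show False using 0 in_H6_det[OF h] by simp
    next
      case False
      then have "\<xi> = a / c" using 0 by (simp add: field_simps)
      then show False using in_H6_fraction_in_Q_H6[OF h False] assms by simp
    qed
  qed
  show ?thesis
  proof (rule that[of "Min D"])
    have "\<forall>x\<in>D. 0 < x" using nz by (force simp: D_def F_def)
    then show "0 < Min D" using fin by (simp add: D_def)
    fix a b c d assume h: "in_H6 a b c d" "\<bar>c\<bar> \<le> N"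
    show "Min D \<le> \<bar>a - \<xi> * c\<bar>"
    proof (cases "\<bar>a - \<xi> * c\<bar> \<le> 1")
      case True
      have "\<bar>\<xi> * c\<bar> \<le> \<bar>\<xi>\<bar> * N" using h(2) by (simp add: abs_mult mult_left_mono)
      moreover have "0 \<le> \<bar>\<xi>\<bar> * N" using h(2) by simp
      ultimately have "\<bar>a\<bar> \<le> K" "\<bar>c\<bar> \<le> K" using True h(2) unfolding K_def by linarith+
      then have "(a, c) \<in> F" using h(1) by (auto simp: F_def)
      then have "\<bar>a - \<xi> * c\<bar> \<in> D" by (force simp: D_def)
      then show ?thesis using fin by simp
    next
      case False
      then show ?thesis using Min_le[OF fin, of 1] by (simp add: D_def)
    qed
  qed
qed

text \<open>
  Replacing \<open>x\<close> by \<open>x + \<surd>3 k y\<close> in a form with leading coefficient \<open>\<alpha>\<close> changes half its middle coefficient by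
  \<open>\<surd>3 k \<alpha>\<close>; this is the reduction step for forms.
\<close>

lemma translate_into_strip:
  assumes "\<alpha> \<noteq> 0"
  obtains k :: int where "\<bar>B + sqrt 3 * k * \<alpha>\<bar> \<le> sqrt 3 / 2 * \<bar>\<alpha>\<bar>"
proof -
  define x where "x = - B / (sqrt 3 * \<alpha>)"
  have B: "B = - (sqrt 3 * \<alpha> * x)" using assms by (simp add: x_def)
  have "\<bar>of_int (round x) - x\<bar> \<le> 1 / 2" by (rule of_int_round_abs_le)
  then have "sqrt 3 * \<bar>\<alpha>\<bar> * \<bar>of_int (round x) - x\<bar> \<le> sqrt 3 * \<bar>\<alpha>\<bar> * (1 / 2)"
    by (intro mult_left_mono) auto
  moreover have "B + sqrt 3 * of_int (round x) * \<alpha> = sqrt 3 * \<alpha> * (of_int (round x) - x)"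
    by (simp add: B algebra_simps)
  ultimately show ?thesis by (intro that[of "round x"]) (simp add: abs_mult)
qed

text \<open>
  For \<open>t > 0\<close> the definite form \<open>Q(a, c) = (a - \<xi> c)\<^sup>2 + t\<^sup>2 c\<^sup>2\<close> has discriminant \<open>-4 t\<^sup>2\<close>. Minimising it over the group and
  reducing with \<open>T\<close> and \<open>S\<close>, as for the fundamental domain, gives a column with \<open>Q(a, c) \<le> 3 t\<close>. The inequality
  between arithmetic and geometric mean bounds \<open>\<bar>c (a - \<xi> c)\<bar>\<close>, and \<open>t \<rightarrow> 0\<close> forces \<open>\<bar>c\<bar>\<close> to grow. The infimum
  is only approached up to the factor \<open>8/7\<close>, which is enough since \<open>7/8 > 3/4\<close>.
\<close>

lemma hecke_dirichlet:
  assumes \<xi>: "Fin \<xi> \<notin> Q_H6"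
  shows "\<exists>a b c d. in_H6 a b c d \<and> \<bar>c\<bar> > N \<and> \<bar>c * (a - \<xi> * c)\<bar> \<le> 3 / 2"
proof -
  obtain \<mu> where \<mu>: "\<mu> > 0" "\<And>a b c d. in_H6 a b c d \<Longrightarrow> \<bar>c\<bar> \<le> N \<Longrightarrow> \<mu> \<le> \<bar>a - \<xi> * c\<bar>"
    using cusp_distance[OF \<xi>] by metis
  \<comment> \<open>Small enough that \<open>Q(a, c) \<le> 3 t\<close> forces \<open>\<bar>a - \<xi> c\<bar> < \<mu>\<close>, hence \<open>\<bar>c\<bar> > N\<close>.\<close>
  define t where "t = \<mu>\<^sup>2 / 4"
  have t: "t > 0" "3 * t < \<mu>\<^sup>2" using \<mu>(1) by (auto simp: t_def)
  define Q where "Q a c = (a - \<xi> * c)\<^sup>2 + t\<^sup>2 * c\<^sup>2" for a c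
  define S where "S = {Q a c | a b c d. in_H6 a b c d}"
  have low: "min 1 (t\<^sup>2) \<le> x" if "x \<in> S" for x
  proof -
    obtain a b c d where h: "in_H6 a b c d" "x = Q a c" using \<open>x \<in> S\<close> by (auto simp: S_def)
    show ?thesis
    proof (cases "c = 0")
      case True
      then have "a \<noteq> 0" using in_H6_det[OF h(1)] by auto
      then have "1 \<le> \<bar>a\<bar>" using in_H6_entry_ge_1[OF h(1)] by simp
      then have "1 \<le> \<bar>a\<bar>\<^sup>2" by (rule one_le_power)
      then show ?thesis using True h(2) by (simp add: Q_def)
    next
      case False
      then have "1 \<le> \<bar>c\<bar>" using in_H6_entry_ge_1[OF h(1)] by simp
      then have "1 \<le> \<bar>c\<bar>\<^sup>2" by (rule one_le_power)
      then have "t\<^sup>2 * 1 \<le> t\<^sup>2 * c\<^sup>2" by (intro mult_left_mono) auto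
      then have "t\<^sup>2 \<le> x" unfolding h(2) Q_def by (smt (verit) zero_le_power2)
      then show ?thesis by simp
    qed
  qed
  have ne: "S \<noteq> {}" using in_H6_one by (auto simp: S_def)
  define m where "m = Inf S"
  have "min 1 (t\<^sup>2) \<le> m" unfolding m_def using low ne by (intro cInf_greatest) auto
  then have m: "m > 0" using t by (smt (verit) zero_less_power2)
  have mle: "m \<le> x" if "x \<in> S" for x
    unfolding m_def using low that by (intro cInf_lower bdd_belowI[of _ "min 1 (t\<^sup>2)"]) auto
  obtain x where "x \<in> S" "x < 8 / 7 * m" using cInf_lessD[OF ne, of "8 / 7 * m"] m by (auto simp: m_def)
  then obtain a b c d where h: "in_H6 a b c d" and small: "Q a c < 8 / 7 * m" by (auto simp: S_def)
  define \<alpha> where "\<alpha> = Q a c"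
  have "\<alpha> \<in> S" using h by (auto simp: \<alpha>_def S_def)
  then have \<alpha>: "\<alpha> > 0" using mle m by fastforce
  obtain k :: int where k: "\<bar>((a - \<xi> * c) * (b - \<xi> * d) + t\<^sup>2 * c * d) + sqrt 3 * k * \<alpha>\<bar> \<le> sqrt 3 / 2 * \<bar>\<alpha>\<bar>"
    using translate_into_strip[of \<alpha>] \<alpha> by (metis less_irrefl)
  define b' d' where "b' = b + sqrt 3 * k * a" and "d' = d + sqrt 3 * k * c"
  have h': "in_H6 a b' c d'" using in_H6_translate[OF h] by (simp add: b'_def d'_def)
  define B where "B = (a - \<xi> * c) * (b' - \<xi> * d') + t\<^sup>2 * c * d'"
  have "B = ((a - \<xi> * c) * (b - \<xi> * d) + t\<^sup>2 * c * d) + sqrt 3 * k * \<alpha>"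
    by (simp add: B_def b'_def d'_def \<alpha>_def Q_def algebra_simps power2_eq_square)
  then have "\<bar>B\<bar> \<le> sqrt 3 / 2 * \<alpha>" using k \<alpha> by simp
  then have "\<bar>B\<bar>\<^sup>2 \<le> (sqrt 3 / 2 * \<alpha>)\<^sup>2" by (intro power_mono) auto
  then have B: "B\<^sup>2 \<le> 3 / 4 * \<alpha>\<^sup>2" by (simp add: power_mult_distrib power_divide)
  define \<gamma> where "\<gamma> = Q b' d'"
  have "\<gamma> \<in> S" using in_H6_swap[OF h'] by (auto simp: \<gamma>_def S_def)
  then have \<gamma>: "7 / 8 * \<alpha> \<le> \<gamma>" using mle[of \<gamma>] small by (simp add: \<alpha>_def)
  have "\<alpha> * \<gamma> - B\<^sup>2 = t\<^sup>2 * (a * d' - b' * c)\<^sup>2"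
    by (simp add: \<alpha>_def \<gamma>_def B_def Q_def algebra_simps power2_eq_square)
  then have "\<alpha> * \<gamma> - B\<^sup>2 = t\<^sup>2" using in_H6_det[OF h'] by simp
  moreover have "\<alpha> * (7 / 8 * \<alpha>) \<le> \<alpha> * \<gamma>" using \<gamma> \<alpha> by (intro mult_left_mono) auto
  ultimately have "\<alpha>\<^sup>2 \<le> 8 * t\<^sup>2" using B by (simp add: power2_eq_square)
  then have "\<alpha>\<^sup>2 \<le> (3 * t)\<^sup>2" by (simp add: power_mult_distrib) (smt (verit) zero_le_power2)
  then have \<alpha>t: "\<alpha> \<le> 3 * t" by (rule power2_le_imp_le) (use t(1) in simp)
  have amgm: "2 * t * \<bar>c * X\<bar> \<le> X\<^sup>2 + t\<^sup>2 * c\<^sup>2" for X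
  proof -
    have "0 \<le> (\<bar>X\<bar> - t * \<bar>c\<bar>)\<^sup>2" by (rule zero_le_power2)
    also have "\<dots> = \<bar>X\<bar>\<^sup>2 + t\<^sup>2 * \<bar>c\<bar>\<^sup>2 - 2 * t * (\<bar>c\<bar> * \<bar>X\<bar>)"
      unfolding power2_diff by (simp add: power_mult_distrib)
    finally show ?thesis by (simp add: abs_mult)
  qed
  have "2 * t * \<bar>c * (a - \<xi> * c)\<bar> \<le> \<alpha>" unfolding \<alpha>_def Q_def by (rule amgm)
  also note \<alpha>t
  finally have 1: "\<bar>c * (a - \<xi> * c)\<bar> \<le> 3 / 2" using t(1) by (simp add: mult.assoc)
  have "(a - \<xi> * c)\<^sup>2 \<le> \<alpha>" by (simp add: \<alpha>_def Q_def)
  then have "\<bar>a - \<xi> * c\<bar>\<^sup>2 < \<mu>\<^sup>2" using \<alpha>t t(2) by simp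
  then have "\<bar>a - \<xi> * c\<bar> < \<mu>" by (rule power_less_imp_less_base) (use \<mu>(1) in simp)
  then have "\<bar>c\<bar> > N" using \<mu>(2)[OF h] by linarith
  with 1 h show ?thesis by blast
qed

lemma lagrange_const_ge:
  assumes "Fin \<xi> \<notin> Q_H6"
  shows "ennreal (2 / 3) \<le> lagrange_const \<xi>"
proof (rule lagrange_const_geI)
  fix V' N :: real assume V': "0 < V'" "V' < 2 / 3"
  obtain a b c d where h: "in_H6 a b c d" "\<bar>c\<bar> > N" "\<bar>c * (a - \<xi> * c)\<bar> \<le> 3 / 2"
    using hecke_dirichlet[OF assms] by blast
  have "V' * \<bar>c * (a - \<xi> * c)\<bar> \<le> V' * (3 / 2)" using h V' by (intro mult_left_mono) auto
  also have "\<dots> < 1" using V' by simp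
  finally show "\<exists>a b c d. in_H6 a b c d \<and> \<bar>c\<bar> > N \<and> V' * \<bar>c * (a - \<xi> * c)\<bar> < 1"
    using h by blast
qed simp

section \<open>The Lagrange spectrum inside the Markoff spectrum\<close>

text \<open>
  The bound on the middle coefficient is obtained by a translation, which changes neither \<open>c\<close> nor the
  leading coefficient \<open>c (a - \<xi> c)\<close>. The factor \<open>(n+1)/(n+2)\<close> makes the approximation to \<open>L\<close> explicit.
\<close>

lemma lagrange_const_extremal_sequence:
  assumes \<xi>: "Fin \<xi> \<notin> Q_H6" and L: "lagrange_const \<xi> = ennreal L" "L > 0"
  shows "\<exists>a b c d. in_H6 a b c d \<and> \<bar>c\<bar> > N \<and> L * (real n + 1) / (real n + 2) * \<bar>c * (a - \<xi> * c)\<bar> < 1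
    \<and> \<bar>a * d + b * c - 2 * \<xi> * c * d\<bar> \<le> sqrt 3 * \<bar>c * (a - \<xi> * c)\<bar>"
proof -
  have "L * (real n + 1) / (real n + 2) < L" using L(2) by (simp add: field_simps)
  then have "ennreal (L * (real n + 1) / (real n + 2)) < lagrange_const \<xi>"
    using L by (simp add: ennreal_less_iff)
  moreover have "L * (real n + 1) / (real n + 2) > 0" using L(2) by simp
  ultimately obtain a b c d where h: "in_H6 a b c d" "\<bar>c\<bar> > max N 0"
      "L * (real n + 1) / (real n + 2) * \<bar>c * (a - \<xi> * c)\<bar> < 1"
    using less_lagrange_const_imp[of "L * (real n + 1) / (real n + 2)" \<xi> "max N 0"] by blast
  define \<alpha> where "\<alpha> = c * (a - \<xi> * c)"
  obtain \<mu> where "\<mu> > 0" "\<mu> \<le> \<bar>a - \<xi> * c\<bar>"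
    using cusp_distance[OF \<xi>, of "\<bar>c\<bar>"] h(1) by (metis order_refl)
  then have "\<alpha> \<noteq> 0" using h(2) by (auto simp: \<alpha>_def)
  then obtain k :: int where k: "\<bar>(a * d + b * c - 2 * \<xi> * c * d) / 2 + sqrt 3 * k * \<alpha>\<bar> \<le> sqrt 3 / 2 * \<bar>\<alpha>\<bar>"
    using translate_into_strip by metis
  define b' d' where "b' = b + sqrt 3 * k * a" and "d' = d + sqrt 3 * k * c"
  have h': "in_H6 a b' c d'" using in_H6_translate[OF h(1)] by (simp add: b'_def d'_def)
  have "a * d' + b' * c - 2 * \<xi> * c * d' = 2 * ((a * d + b * c - 2 * \<xi> * c * d) / 2 + sqrt 3 * k * \<alpha>)"
    by (simp add: b'_def d'_def \<alpha>_def field_simps)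
  then have "\<bar>a * d' + b' * c - 2 * \<xi> * c * d'\<bar> \<le> sqrt 3 * \<bar>\<alpha>\<bar>"
    using k by (simp only: abs_mult) simp
  then show ?thesis using h' h(2,3) unfolding \<alpha>_def by (intro exI[of _ a] exI[of _ b'] exI[of _ c] exI[of _ d']) simp
qed

text \<open>
  The forms \<open>f \<circ> g\<^sub>n = \<alpha> x\<^sup>2 + \<beta> x y + \<gamma> y\<^sup>2\<close> are bounded and converge along a subsequence. The identity matrix shows that
  the Markoff constant of the limit form is at least \<open>L\<close>. Conversely, \<open>f \<circ> g\<^sub>n\<close> takes at \<open>h\<close> the value of \<open>f\<close> at \<open>g\<^sub>n h\<close>,
  which has modulus almost \<open>1/L\<close> or more as soon as \<open>c(g\<^sub>n h)\<close> is large. If \<open>c(g\<^sub>n h)\<close> stayed bounded, the middle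
  coefficient of \<open>f \<circ> g\<^sub>n h\<close> would bound \<open>d(g\<^sub>n h)\<close> and thereby \<open>c(g\<^sub>n)\<close>, which tends to infinity.
\<close>

lemma lagrange_const_in_markoff_spectrum:
  assumes \<xi>: "Fin \<xi> \<notin> Q_H6" and fin: "lagrange_const \<xi> < \<infinity>"
  shows "lagrange_const \<xi> \<in> markoff_spectrum"
proof -
  obtain L where L: "lagrange_const \<xi> = ennreal L" "L \<ge> 0" using fin by (cases "lagrange_const \<xi>") auto
  have Lpos: "L > 0"
    using lagrange_const_ge[OF \<xi>] L by (simp add: ennreal_le_iff)
  have upper: "\<exists>N. \<forall>a b c d. in_H6 a b c d \<longrightarrow> \<bar>c\<bar> > N \<longrightarrow> 1 \<le> V * \<bar>c * (a - \<xi> * c)\<bar>" if "V > L" for V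
    using lagrange_const_less_imp[of V \<xi>] that L Lpos by (metis ennreal_less_iff order.strict_trans)
  obtain N0 where N0: "\<And>a b c d. in_H6 a b c d \<Longrightarrow> \<bar>c\<bar> > N0 \<Longrightarrow> 1 \<le> 2 * L * \<bar>c * (a - \<xi> * c)\<bar>"
    using upper[of "2 * L"] Lpos by (metis less_add_same_cancel1 mult_2)
  have "\<forall>n. \<exists>a b c d. in_H6 a b c d \<and> \<bar>c\<bar> > real n + \<bar>N0\<bar> \<and>
      L * (real n + 1) / (real n + 2) * \<bar>c * (a - \<xi> * c)\<bar> < 1 \<and>
      \<bar>a * d + b * c - 2 * \<xi> * c * d\<bar> \<le> sqrt 3 * \<bar>c * (a - \<xi> * c)\<bar>"
    using lagrange_const_extremal_sequence[OF \<xi> L(1) Lpos] by blast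
  then obtain a b c d :: "nat \<Rightarrow> real" where
    h: "\<And>n. in_H6 (a n) (b n) (c n) (d n)" and
    cn: "\<And>n. \<bar>c n\<bar> > real n + \<bar>N0\<bar>" and
    lower: "\<And>n. L * (real n + 1) / (real n + 2) * \<bar>c n * (a n - \<xi> * c n)\<bar> < 1" and
    strip: "\<And>n. \<bar>a n * d n + b n * c n - 2 * \<xi> * c n * d n\<bar> \<le> sqrt 3 * \<bar>c n * (a n - \<xi> * c n)\<bar>"
    by metis
  define \<alpha> \<beta> \<gamma> where "\<alpha> n = c n * (a n - \<xi> * c n)"
    and "\<beta> n = a n * d n + b n * c n - 2 * \<xi> * c n * d n"
    and "\<gamma> n = d n * (b n - \<xi> * d n)" for n
  have disc: "(\<beta> n)\<^sup>2 - 4 * \<alpha> n * \<gamma> n = 1" for n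
  proof -
    have "(\<beta> n)\<^sup>2 - 4 * \<alpha> n * \<gamma> n = (a n * d n - b n * c n)\<^sup>2"
      by (simp add: \<alpha>_def \<beta>_def \<gamma>_def algebra_simps power2_eq_square)
    then show ?thesis using in_H6_det[OF h] by simp
  qed
  have \<alpha>_ge: "1 / (2 * L) \<le> \<bar>\<alpha> n\<bar>" for n
    using N0[OF h, of n] cn[of n] Lpos by (simp add: \<alpha>_def field_simps)
  have \<alpha>_le: "\<bar>\<alpha> n\<bar> \<le> 2 / L" for n
  proof -
    have "L * (1 / 2) \<le> L * ((real n + 1) / (real n + 2))"
      using Lpos by (intro mult_left_mono) (auto simp: field_simps)
    then have "L * (1 / 2) * \<bar>\<alpha> n\<bar> \<le> L * ((real n + 1) / (real n + 2)) * \<bar>\<alpha> n\<bar>"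
      by (rule mult_right_mono) simp
    also have "\<dots> < 1" using lower[of n] by (simp add: \<alpha>_def)
    finally show ?thesis using Lpos by (simp add: field_simps)
  qed
  have \<beta>_le: "\<bar>\<beta> n\<bar> \<le> sqrt 3 * (2 / L)" for n
    using strip[of n] mult_left_mono[OF \<alpha>_le[of n], of "sqrt 3"] by (simp add: \<alpha>_def \<beta>_def)
  have \<gamma>_le: "\<bar>\<gamma> n\<bar> \<le> ((sqrt 3 * (2 / L))\<^sup>2 + 1) * L" for n
  proof -
    have "\<bar>\<beta> n\<bar>\<^sup>2 \<le> (sqrt 3 * (2 / L))\<^sup>2" using \<beta>_le by (intro power_mono) auto
    then have b: "\<bar>(\<beta> n)\<^sup>2 - 1\<bar> \<le> (sqrt 3 * (2 / L))\<^sup>2 + 1"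
      by (simp add: abs_le_iff)
    have "1 * \<bar>\<gamma> n\<bar> \<le> 2 * L * \<bar>\<alpha> n\<bar> * \<bar>\<gamma> n\<bar>"
      using \<alpha>_ge[of n] Lpos by (intro mult_right_mono) (auto simp: field_simps)
    also have "\<dots> = L / 2 * \<bar>(\<beta> n)\<^sup>2 - 1\<bar>"
    proof -
      have "(\<beta> n)\<^sup>2 - 1 = 4 * \<alpha> n * \<gamma> n" using disc[of n] by simp
      then show ?thesis by (simp add: abs_mult)
    qed
    also have "\<dots> \<le> L * ((sqrt 3 * (2 / L))\<^sup>2 + 1)"
      using b Lpos by (intro mult_mono) auto
    finally show ?thesis by (simp add: mult.commute)
  qed
  have "bounded (range (\<lambda>n. (\<alpha> n, \<beta> n, \<gamma> n)))"
  proof (rule bounded_subset)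
    show "bounded ({- (2 / L)..2 / L} \<times> {- (sqrt 3 * (2 / L))..sqrt 3 * (2 / L)} \<times>
       {- (((sqrt 3 * (2 / L))\<^sup>2 + 1) * L)..((sqrt 3 * (2 / L))\<^sup>2 + 1) * L})"
      by (intro bounded_Times bounded_closed_interval)
    show "range (\<lambda>n. (\<alpha> n, \<beta> n, \<gamma> n)) \<subseteq> {- (2 / L)..2 / L} \<times> {- (sqrt 3 * (2 / L))..sqrt 3 * (2 / L)} \<times>
       {- (((sqrt 3 * (2 / L))\<^sup>2 + 1) * L)..((sqrt 3 * (2 / L))\<^sup>2 + 1) * L}"
      using \<alpha>_le \<beta>_le \<gamma>_le by (auto simp only: abs_le_iff mem_Times_iff atLeastAtMost_iff fst_conv snd_conv minus_le_iff)
  qed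
  then obtain l r where r: "strict_mono r" and lim: "((\<lambda>n. (\<alpha> n, \<beta> n, \<gamma> n)) \<circ> r) \<longlonglongrightarrow> l"
    using bounded_imp_convergent_subsequence by blast
  obtain \<alpha>' \<beta>' \<gamma>' where l: "l = (\<alpha>', \<beta>', \<gamma>')" by (cases l)
  have "(\<lambda>n. fst (((\<lambda>n. (\<alpha> n, \<beta> n, \<gamma> n)) \<circ> r) n)) \<longlonglongrightarrow> fst l"
    "(\<lambda>n. fst (snd (((\<lambda>n. (\<alpha> n, \<beta> n, \<gamma> n)) \<circ> r) n))) \<longlonglongrightarrow> fst (snd l)"
    "(\<lambda>n. snd (snd (((\<lambda>n. (\<alpha> n, \<beta> n, \<gamma> n)) \<circ> r) n))) \<longlonglongrightarrow> snd (snd l)"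
    by (intro tendsto_intros lim)+
  then have lims: "(\<lambda>n. \<alpha> (r n)) \<longlonglongrightarrow> \<alpha>'" "(\<lambda>n. \<beta> (r n)) \<longlonglongrightarrow> \<beta>'" "(\<lambda>n. \<gamma> (r n)) \<longlonglongrightarrow> \<gamma>'"
    by (simp_all add: l o_def)
  have crn: "\<bar>c (r n)\<bar> > real n" for n
    using cn[of "r n"] seq_suble[OF r, of n] by (smt (verit) of_nat_le_iff)
  have "(\<lambda>n. (\<beta> (r n))\<^sup>2 - 4 * \<alpha> (r n) * \<gamma> (r n)) \<longlonglongrightarrow> \<beta>'\<^sup>2 - 4 * \<alpha>' * \<gamma>'"
    by (intro tendsto_intros lims)
  then have disc': "qdisc \<alpha>' \<beta>' \<gamma>' = 1"
    using disc by (simp add: qdisc_def LIMSEQ_const_iff)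
  have "markoff_const \<alpha>' \<beta>' \<gamma>' = ennreal L"
  proof (rule antisym)
    have "(\<lambda>n. L * (real (r n) + 1) / (real (r n) + 2) * \<bar>\<alpha> (r n)\<bar>) \<longlonglongrightarrow> L * \<bar>\<alpha>'\<bar>"
    proof -
      have "(\<lambda>n. L * (real n + 1) / (real n + 2)) \<longlonglongrightarrow> L" by real_asymp
      then have "(\<lambda>n. L * (real (r n) + 1) / (real (r n) + 2)) \<longlonglongrightarrow> L"
        using LIMSEQ_subseq_LIMSEQ[OF _ r] by (fastforce simp: o_def)
      then show ?thesis by (intro tendsto_intros lims)
    qed
    then have le: "L * \<bar>\<alpha>'\<bar> \<le> 1"
      by (rule LIMSEQ_le_const2) (use less_imp_le[OF lower] in \<open>auto simp only: \<alpha>_def\<close>)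
    have \<alpha>'nz: "\<alpha>' \<noteq> 0"
    proof -
      have "1 / (2 * L) \<le> \<bar>\<alpha>'\<bar>"
        using \<alpha>_ge by (intro LIMSEQ_le_const[OF tendsto_rabs[OF lims(1)]]) auto
      then show ?thesis using Lpos by (auto simp: field_simps)
    qed
    obtain g where g: "g \<in> H6" "(ent_a g = 1 \<or> ent_a g = - 1) \<and> ent_c g = 0"
      using in_H6_rep[OF in_H6_one] by auto
    have "ennreal L \<le> ennreal (1 / \<bar>\<alpha>'\<bar>)"
      using le \<alpha>'nz by (intro ennreal_leI) (simp add: field_simps)
    also have "\<dots> = (let v = qform \<alpha>' \<beta>' \<gamma>' (ent_a g) (ent_c g) in
        if v = 0 then \<infinity> else ennreal (sqrt (qdisc \<alpha>' \<beta>' \<gamma>') / \<bar>v\<bar>))"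
      using g(2) \<alpha>'nz by (auto simp: qform_def disc')
    also have "\<dots> \<le> markoff_const \<alpha>' \<beta>' \<gamma>'"
      unfolding markoff_const_def by (rule SUP_upper[OF g(1)])
    finally show "ennreal L \<le> markoff_const \<alpha>' \<beta>' \<gamma>'" .
  next
    show "markoff_const \<alpha>' \<beta>' \<gamma>' \<le> ennreal L"
      unfolding markoff_const_def
    proof (rule SUP_least)
      fix g assume g: "g \<in> H6"
      define p q u w where "p = ent_a g" and "q = ent_b g" and "u = ent_c g" and "w = ent_d g"
      have hg: "in_H6 p q u w" using rep_in_H6[OF g] by (simp add: p_def q_def u_def w_def)
      define v where "v = qform \<alpha>' \<beta>' \<gamma>' p u"
      define P Q C D where "P n = a (r n) * p + b (r n) * u" and "Q n = a (r n) * q + b (r n) * w"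
        and "C n = c (r n) * p + d (r n) * u" and "D n = c (r n) * q + d (r n) * w" for n
      have hn: "in_H6 (P n) (Q n) (C n) (D n)" for n
        unfolding P_def Q_def C_def D_def by (rule in_H6_mult[OF h hg])
      have vn: "qform (\<alpha> (r n)) (\<beta> (r n)) (\<gamma> (r n)) p u = C n * (P n - \<xi> * C n)" for n
        by (simp add: qform_def \<alpha>_def \<beta>_def \<gamma>_def P_def C_def algebra_simps power2_eq_square)
      have limv: "(\<lambda>n. C n * (P n - \<xi> * C n)) \<longlonglongrightarrow> v"
        unfolding v_def vn[symmetric] unfolding qform_def by (intro tendsto_intros lims)
      \<comment> \<open>It suffices to compare \<open>1/\<bar>v\<bar>\<close> with numbers slightly larger than \<open>L\<close>.\<close>
      have "1 \<le> V * \<bar>v\<bar>" if V: "V > L" for V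
      proof (rule ccontr)
        assume "\<not> 1 \<le> V * \<bar>v\<bar>"
        then have less: "V * \<bar>v\<bar> < 1" by simp
        obtain N where N: "\<And>a b c d. in_H6 a b c d \<Longrightarrow> \<bar>c\<bar> > N \<Longrightarrow> 1 \<le> V * \<bar>c * (a - \<xi> * c)\<bar>"
          using upper[OF V] by blast
        have "(\<lambda>n. V * \<bar>C n * (P n - \<xi> * C n)\<bar>) \<longlonglongrightarrow> V * \<bar>v\<bar>"
          by (intro tendsto_intros limv)
        then have "eventually (\<lambda>n. V * \<bar>C n * (P n - \<xi> * C n)\<bar> < 1) sequentially"
          using less by (rule order_tendstoD(2))
        then have C_le: "eventually (\<lambda>n. \<bar>C n\<bar> \<le> N) sequentially"
          by (rule eventually_mono) (meson N[OF hn] not_less)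
        obtain \<mu> where \<mu>: "\<mu> > 0" "\<And>a b c d. in_H6 a b c d \<Longrightarrow> \<bar>c\<bar> \<le> N \<Longrightarrow> \<mu> \<le> \<bar>a - \<xi> * c\<bar>"
          using cusp_distance[OF \<xi>] by metis
        \<comment> \<open>The middle coefficient of \<open>f \<circ> g\<^sub>n h\<close>.\<close>
        define b2 where "b2 n = 2 * \<alpha> (r n) * p * q + \<beta> (r n) * (p * w + q * u) + 2 * \<gamma> (r n) * u * w" for n
        have b2: "b2 n = 2 * D n * (P n - \<xi> * C n) - 1" for n
        proof -
          have "b2 n = P n * D n + Q n * C n - 2 * \<xi> * C n * D n"
            by (simp add: b2_def \<alpha>_def \<beta>_def \<gamma>_def P_def Q_def C_def D_def algebra_simps power2_eq_square)
          then show ?thesis using in_H6_det[OF hn, of n] by (simp add: algebra_simps)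
        qed
        have "(\<lambda>n. 2 * \<alpha> (r n) * p * q + \<beta> (r n) * (p * w + q * u) + 2 * \<gamma> (r n) * u * w)
            \<longlonglongrightarrow> 2 * \<alpha>' * p * q + \<beta>' * (p * w + q * u) + 2 * \<gamma>' * u * w"
          by (intro tendsto_intros lims)
        then have "convergent b2" unfolding b2_def by (rule convergentI)
        then have "Bseq b2" by (rule convergent_imp_Bseq)
        then obtain K where K: "K > 0" "\<And>n. \<bar>b2 n\<bar> \<le> K" unfolding Bseq_def by auto
        have c_eq: "c (r n) = C n * w - D n * u" for n
        proof -
          have "C n * w - D n * u = c (r n) * (p * w - q * u)" by (simp add: C_def D_def algebra_simps)
          then show ?thesis using in_H6_det[OF hg] by simp
        qed
        define M where "M = \<bar>N\<bar> * \<bar>w\<bar> + (K + 1) / (2 * \<mu>) * \<bar>u\<bar>"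
        have "eventually (\<lambda>n. real n \<le> M) sequentially"
          using C_le
        proof eventually_elim
          case (elim n)
          have "\<bar>D n\<bar> * (2 * \<mu>) \<le> \<bar>D n\<bar> * (2 * \<bar>P n - \<xi> * C n\<bar>)"
            using \<mu>(2)[OF hn elim] by (intro mult_left_mono) auto
          also have "\<dots> = \<bar>b2 n + 1\<bar>" by (simp add: b2 abs_mult)
          also have "\<dots> \<le> K + 1" using K(2)[of n] by linarith
          finally have D: "\<bar>D n\<bar> \<le> (K + 1) / (2 * \<mu>)" using \<mu>(1) by (simp add: field_simps)
          have "\<bar>c (r n)\<bar> \<le> \<bar>C n\<bar> * \<bar>w\<bar> + \<bar>D n\<bar> * \<bar>u\<bar>"
            unfolding c_eq by (metis abs_mult abs_triangle_ineq4)
          also have "\<dots> \<le> M" unfolding M_def using elim D by (intro add_mono mult_right_mono) auto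
          finally show ?case using crn[of n] by linarith
        qed
        moreover have "eventually (\<lambda>n. real n > M) sequentially"
          using filterlim_real_sequentially by (simp add: filterlim_at_top_dense)
        ultimately have "eventually (\<lambda>n. False) sequentially" by eventually_elim simp
        then show False by simp
      qed
      then have v: "1 \<le> L * \<bar>v\<bar>"
      proof -
        assume *: "\<And>V. V > L \<Longrightarrow> 1 \<le> V * \<bar>v\<bar>"
        have "(\<lambda>n. (L + inverse (real (Suc n))) * \<bar>v\<bar>) \<longlonglongrightarrow> (L + 0) * \<bar>v\<bar>"
          by (intro tendsto_intros LIMSEQ_inverse_real_of_nat)
        then show ?thesis using LIMSEQ_le_const[of _ "L * \<bar>v\<bar>" 1] * by fastforce
      qed
      then have vnz: "v \<noteq> 0" by auto
      then have "1 / \<bar>v\<bar> \<le> L" using v by (simp add: field_simps)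
      then have "ennreal (1 / \<bar>v\<bar>) \<le> ennreal L" by (rule ennreal_leI)
      then show "(let v = qform \<alpha>' \<beta>' \<gamma>' (ent_a g) (ent_c g) in
          if v = 0 then \<infinity> else ennreal (sqrt (qdisc \<alpha>' \<beta>' \<gamma>') / \<bar>v\<bar>)) \<le> ennreal L"
        using vnz by (simp add: Let_def disc' v_def p_def u_def)
    qed
  qed
  then show ?thesis
    unfolding markoff_spectrum_def using L(1) disc' by (metis (mono_tags, lifting) mem_Collect_eq zero_less_one)
qed

section \<open>Digits of the hexagon tessellation\<close>

text \<open>
  The sides of the ideal hexagon cut \<open>(0, \<infinity>)\<close> into five intervals. The digits stand for the second,
  third and fourth of them, namely \<open>(1/\<surd>3, \<surd>3/2)\<close>, \<open>(\<surd>3/2, 2/\<surd>3)\<close> and \<open>(2/\<surd>3, \<surd>3)\<close>. The matrix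
  \<open>(a b; c a)\<close> with entries \<open>da\<close>, \<open>db\<close>, \<open>dc\<close> maps \<open>(0, \<infinity>)\<close> onto the interval of its digit. That its two diagonal
  entries agree is the reason why the backward endpoint of a geodesic is coded by the same maps as
  the forward endpoint.
\<close>

datatype digit = D2 | D3 | D4

fun da :: "digit \<Rightarrow> real" where
  "da D2 = sqrt 3" | "da D3 = 2" | "da D4 = sqrt 3"
fun db :: "digit \<Rightarrow> real" where
  "db D2 = 1" | "db D3 = sqrt 3" | "db D4 = 2"
fun dc :: "digit \<Rightarrow> real" where
  "dc D2 = 2" | "dc D3 = sqrt 3" | "dc D4 = 1"
fun flip_digit :: "digit \<Rightarrow> digit" where
  "flip_digit D2 = D4" | "flip_digit D3 = D3" | "flip_digit D4 = D2"

definition mob :: "digit \<Rightarrow> real \<Rightarrow> real" where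
  "mob e x = (da e * x + db e) / (dc e * x + da e)"

lemma sqrt3_bounds: "1.732 < sqrt 3" "sqrt 3 < 1.7321"
  by (rule real_less_rsqrt, simp add: power2_eq_square)
     (rule real_less_lsqrt, simp_all add: power2_eq_square)

lemma digit_ge_1: "1 \<le> da e" "1 \<le> db e" "1 \<le> dc e"
  by (cases e; simp)+

lemma digit_det: "da e * da e - db e * dc e = 1"
  by (cases e) simp_all

text \<open>
  Each digit matrix is a power of \<open>T S\<close> times \<open>T\<close>, where \<open>T S\<close> rotates the hexagon by one vertex.
\<close>

lemma in_H6_digit: "in_H6 (da e) (db e) (dc e) (da e)"
proof -
  have TS: "in_H6 (sqrt 3) (- 1) 1 0"
    using in_H6_mult[OF in_H6_T in_H6_S] by simp
  have 4: "in_H6 (sqrt 3) 2 1 (sqrt 3)"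
    using in_H6_mult[OF TS in_H6_T] by simp
  have 3: "in_H6 2 (sqrt 3) (sqrt 3) 2"
    using in_H6_mult[OF TS 4] by simp
  have 2: "in_H6 (sqrt 3) 1 2 (sqrt 3)"
    using in_H6_mult[OF TS 3] by (simp add: algebra_simps)
  show ?thesis using 2 3 4 by (cases e) simp_all
qed

lemma mob_pos: "x > 0 \<Longrightarrow> mob e x > 0"
  using digit_ge_1[of e] by (simp add: mob_def add_pos_pos)

lemma mob_diff:
  assumes "x > 0" "y > 0"
  shows "mob e x - mob e y = (x - y) / ((dc e * x + da e) * (dc e * y + da e))"
proof -
  have nz: "dc e * x + da e \<noteq> 0" "dc e * y + da e \<noteq> 0"
    using assms digit_ge_1[of e] by (smt (verit) mult_pos_pos)+
  have "mob e x - mob e y = (x - y) * (da e * da e - db e * dc e) / ((dc e * x + da e) * (dc e * y + da e))"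
    unfolding mob_def diff_frac_eq[OF nz] by (simp add: algebra_simps)
  then show ?thesis by (simp add: digit_det)
qed

lemma mob_strict_mono: "0 < x \<Longrightarrow> x < y \<Longrightarrow> mob e x < mob e y"
  using mob_diff[of y x e] digit_ge_1[of e]
  by (smt (verit) divide_pos_pos mult_pos_pos)

lemma mob_mono: "0 < x \<Longrightarrow> x \<le> y \<Longrightarrow> mob e x \<le> mob e y"
  using mob_strict_mono[of x y e] by (cases "x = y") auto

lemma mob_half: "0.68 \<le> mob D2 (1/2)" "0.95 \<le> mob D3 (1/2)" "1.28 \<le> mob D4 (1/2)"
  using sqrt3_bounds by (simp_all add: mob_def field_simps)

lemma mob_two: "mob D2 2 \<le> 0.78" "mob D3 2 \<le> 1.05" "mob D4 2 \<le> 1.47"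
  using sqrt3_bounds by (simp_all add: mob_def field_simps)

lemma mob_D2_range: "x \<in> {1/2..2} \<Longrightarrow> mob D2 x \<in> {0.68..0.78}"
  using mob_half(1) mob_two(1) mob_mono[of "1/2" x D2] mob_mono[of x 2 D2] by auto
lemma mob_D3_range: "x \<in> {1/2..2} \<Longrightarrow> mob D3 x \<in> {0.95..1.05}"
  using mob_half(2) mob_two(2) mob_mono[of "1/2" x D3] mob_mono[of x 2 D3] by auto
lemma mob_D4_range: "x \<in> {1/2..2} \<Longrightarrow> mob D4 x \<in> {1.28..1.47}"
  using mob_half(3) mob_two(3) mob_mono[of "1/2" x D4] mob_mono[of x 2 D4] by auto

lemma mob_range: "x \<in> {1/2..2} \<Longrightarrow> mob e x \<in> {1/2..2}"
  using mob_D2_range[of x] mob_D3_range[of x] mob_D4_range[of x] by (cases e) auto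

lemma mob_denominator:
  assumes "x \<in> {1/2..2}"
  shows "2 \<le> dc e * x + da e" "dc e * x + da e \<le> 6"
proof -
  have "1/2 * dc e \<le> dc e * x" "dc e * x \<le> dc e * 2"
    using assms digit_ge_1(3)[of e] by (simp_all add: mult.commute)
  moreover have "2 \<le> 1/2 * dc e + da e" "dc e * 2 + da e \<le> 6"
    using sqrt3_bounds by (cases e; simp)+
  ultimately show "2 \<le> dc e * x + da e" "dc e * x + da e \<le> 6" by linarith+
qed

lemma mob_dist:
  assumes "x \<in> {1/2..2}" "y \<in> {1/2..2}"
  shows "\<bar>mob e x - mob e y\<bar> \<le> \<bar>x - y\<bar> / 4" "\<bar>x - y\<bar> / 36 \<le> \<bar>mob e x - mob e y\<bar>"
proof -
  define D where "D = (dc e * x + da e) * (dc e * y + da e)"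
  have "2 * 2 \<le> D" "D \<le> 6 * 6"
    unfolding D_def using mob_denominator[OF assms(1), of e] mob_denominator[OF assms(2), of e]
    by (intro mult_mono; simp)+
  then have D: "4 \<le> D" "D \<le> 36" by simp_all
  have "\<bar>mob e x - mob e y\<bar> = \<bar>x - y\<bar> / D"
    using D mob_diff[of x y e] assms by (simp add: D_def)
  then show "\<bar>mob e x - mob e y\<bar> \<le> \<bar>x - y\<bar> / 4" "\<bar>x - y\<bar> / 36 \<le> \<bar>mob e x - mob e y\<bar>"
    using divide_left_mono[of 4 D "\<bar>x - y\<bar>"] divide_left_mono[of D 36 "\<bar>x - y\<bar>"] D by simp_all
qed

text \<open>
  Inversion \<open>x \<mapsto> 1/x\<close> is a symmetry of the hexagon that reverses the order of the intervals.
\<close>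

lemma inverse_mob: "x > 0 \<Longrightarrow> 1 / mob e x = mob (flip_digit e) (1 / x)"
proof -
  assume x: "x > 0"
  have "(A * (1 / x) + B) / (C * (1 / x) + A) = (B * x + A) / (A * x + C)" for A B C
  proof -
    have "A * (1 / x) + B = (B * x + A) / x" "C * (1 / x) + A = (A * x + C) / x"
      using x by (simp_all add: field_simps)
    then show ?thesis using x by simp
  qed
  then show ?thesis by (cases e) (simp_all add: mob_def)
qed

text \<open>
  The four alternatives say that one of the inner vertices \<open>1/\<surd>3\<close>, \<open>2/\<surd>3\<close>, \<open>\<surd>3/2\<close>, \<open>\<surd>3\<close> of the hexagon lies strictly
  between the images of \<open>0\<close> and \<open>\<infinity>\<close>. Writing one coordinate of the vertex as a combination of the columns, with the two
  determinants as positive coefficients, leaves no room unless the matrix is the identity.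
\<close>

lemma vertex_integral:
  fixes p q r s :: int
  assumes nn: "0 \<le> p" "0 \<le> q" "0 \<le> r" "0 \<le> s" and det: "p * s - 3 * q * r = 1"
    and "p > 3 * r \<and> s > q \<or> p > 2 * r \<and> 2 * s > 3 * q \<or> 2 * p > 3 * r \<and> s > 2 * q \<or> p > r \<and> s > 3 * q"
  shows "p = 1 \<and> q = 0 \<and> r = 0 \<and> s = 1"
proof -
  have "0 \<le> q * r" using nn by simp
  then have "p * s > 0" using det by (simp add: mult.assoc)
  then have ps: "p \<ge> 1" "s \<ge> 1" using nn by (auto simp: zero_less_mult_iff)
  have bound: "z = 0" if "x * y + w * z = 1" "x \<ge> 1" "y \<ge> 1" "w \<ge> 1" "z \<ge> 0" for x y z w :: int
  proof -
    have "1 * 1 \<le> x * y" "1 * z \<le> w * z" using that by (intro mult_mono; simp)+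
    then show ?thesis using that by linarith
  qed
  have one: "p = 1 \<and> s = 1" if "p * s = 1" using that ps pos_zmult_eq_1_iff[of p s] by simp
  consider "p > 3 * r" "s > q" | "p > 2 * r" "2 * s > 3 * q" | "2 * p > 3 * r" "s > 2 * q" | "p > r" "s > 3 * q"
    using assms(6) by blast
  then show ?thesis
  proof cases
    case 1
    then have "r = 0" using bound[of "p - 3 * r" s "3 * (s - q)" r] ps nn det by (simp add: algebra_simps)
    then show ?thesis using one det 1 nn by auto
  next
    case 2
    then have "r = 0" using bound[of "p - 2 * r" s "2 * s - 3 * q" r] ps nn det by (simp add: algebra_simps)
    then show ?thesis using one det 2 nn by auto
  next
    case 3
    then have "q = 0" using bound[of "s - 2 * q" p "2 * p - 3 * r" q] ps nn det by (simp add: algebra_simps)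
    then show ?thesis using one det 3 nn by auto
  next
    case 4
    then have "q = 0" using bound[of "s - 3 * q" p "3 * (p - r)" q] ps nn det by (simp add: algebra_simps)
    then show ?thesis using one det 4 nn by auto
  qed
qed

text \<open>
  For matrices of the second shape the same combination has a coefficient divisible by 3, so it is at
  least 3, whereas the coordinate in question gives 1 or 2.
\<close>

lemma vertex_twisted:
  fixes p q r s :: int
  assumes nn: "0 \<le> p" "0 \<le> q" "0 \<le> r" "0 \<le> s" and det: "3 * p * s - q * r = 1"
    and "p > r \<and> 3 * s > q \<or> 3 * p > 2 * r \<and> 2 * s > q \<or> 2 * p > r \<and> 3 * s > 2 * q \<or> 3 * p > r \<and> s > q"
  shows False
proof -
  have "0 \<le> q * r" using nn by simp
  then have "p * s > 0" using det by (simp add: mult.assoc)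
  then have ps: "p \<ge> 1" "s \<ge> 1" using nn by (auto simp: zero_less_mult_iff)
  have bound: "3 \<le> 3 * x * y + w * z" if "x \<ge> 1" "y \<ge> 1" "w \<ge> 1" "z \<ge> 0" for x y z w :: int
  proof -
    have "1 * 1 \<le> x * y" "0 * 0 \<le> w * z" using that by (intro mult_mono; simp)+
    then show ?thesis by simp
  qed
  consider "p > r" "3 * s > q" | "3 * p > 2 * r" "2 * s > q" | "2 * p > r" "3 * s > 2 * q" | "3 * p > r" "s > q"
    using assms(6) by blast
  then show False
  proof cases
    case 1
    then show ?thesis using bound[of "p - r" s "3 * s - q" r] ps nn det by (simp add: algebra_simps)
  next
    case 2
    then show ?thesis using bound[of "2 * s - q" p "3 * p - 2 * r" q] ps nn det by (simp add: algebra_simps)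
  next
    case 3
    then show ?thesis using bound[of "2 * p - r" s "3 * s - 2 * q" r] ps nn det by (simp add: algebra_simps)
  next
    case 4
    then show ?thesis using bound[of "s - q" p "3 * p - r" q] ps nn det by (simp add: algebra_simps)
  qed
qed

text \<open>
  Let an image of the side \<open>(0, \<infinity>)\<close> have its ends in \<open>[0, \<infinity>]\<close> and an inner vertex of the hexagon strictly
  between them. Then it is that side itself: images of sides do not cross, and no diagonal of the
  hexagon is one.
\<close>

lemma no_vertex_inside:
  assumes h: "in_H6 a b c d" and nn: "0 \<le> a" "0 \<le> b" "0 \<le> c" "0 \<le> d"
    and xy: "(x, y) = (da e, dc e) \<or> (x, y) = (db e, da e)"
    and inside: "c * x < a * y" "b * y < d * x"
  shows "a = 1 \<and> b = 0 \<and> c = 0 \<and> d = 1"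
proof -
  have xy': "(x, y) \<in> {(sqrt 3, 1), (2, sqrt 3), (sqrt 3, 2), (1, sqrt 3)}"
    using xy by (cases e) auto
  have iff: "sqrt 3 * u < sqrt 3 * v \<longleftrightarrow> u < v" for u v by simp
  show ?thesis
    using in_H6_shape[OF h]
  proof (cases rule: hecke_shape_cases)
    case (integral p q r s)
    then have nn': "0 \<le> p" "0 \<le> q" "0 \<le> r" "0 \<le> s" using nn by (auto simp: zero_le_mult_iff)
    have "p > 3 * r \<and> s > q \<or> p > 2 * r \<and> 2 * s > 3 * q \<or> 2 * p > 3 * r \<and> s > 2 * q \<or> p > r \<and> s > 3 * q"
    proof -
      from xy' consider "x = sqrt 3" "y = 1" | "x = 2" "y = sqrt 3" | "x = sqrt 3" "y = 2" | "x = 1" "y = sqrt 3" by auto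
      then show ?thesis
      proof cases
        case 1
        then have "real_of_int (3 * r) < real_of_int p" "sqrt 3 * real_of_int q < sqrt 3 * real_of_int s"
          using inside integral(1-4) by (simp_all add: mult.commute mult.left_commute sqrt3_mult)
        then show ?thesis unfolding iff by linarith
      next
        case 2
        then have "sqrt 3 * real_of_int (2 * r) < sqrt 3 * real_of_int p" "real_of_int (3 * q) < real_of_int (2 * s)"
          using inside integral(1-4) by (simp_all add: mult.commute mult.left_commute sqrt3_mult)
        then show ?thesis unfolding iff by linarith
      next
        case 3
        then have "real_of_int (3 * r) < real_of_int (2 * p)" "sqrt 3 * real_of_int (2 * q) < sqrt 3 * real_of_int s"
          using inside integral(1-4) by (simp_all add: mult.commute mult.left_commute sqrt3_mult)
        then show ?thesis unfolding iff by linarith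
      next
        case 4
        then have "sqrt 3 * real_of_int r < sqrt 3 * real_of_int p" "real_of_int (3 * q) < real_of_int s"
          using inside integral(1-4) by (simp_all add: mult.commute mult.left_commute sqrt3_mult)
        then show ?thesis unfolding iff by linarith
      qed
    qed
    from vertex_integral[OF nn' integral(5) this] show ?thesis using integral by simp
  next
    case (twisted p q r s)
    then have nn': "0 \<le> p" "0 \<le> q" "0 \<le> r" "0 \<le> s" using nn by (auto simp: zero_le_mult_iff)
    have "p > r \<and> 3 * s > q \<or> 3 * p > 2 * r \<and> 2 * s > q \<or> 2 * p > r \<and> 3 * s > 2 * q \<or> 3 * p > r \<and> s > q"
    proof -
      from xy' consider "x = sqrt 3" "y = 1" | "x = 2" "y = sqrt 3" | "x = sqrt 3" "y = 2" | "x = 1" "y = sqrt 3" by auto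
      then show ?thesis
      proof cases
        case 1
        then have "sqrt 3 * real_of_int r < sqrt 3 * real_of_int p" "real_of_int q < real_of_int (3 * s)"
          using inside twisted(1-4) by (simp_all add: mult.commute mult.left_commute sqrt3_mult)
        then show ?thesis unfolding iff by linarith
      next
        case 2
        then have "real_of_int (2 * r) < real_of_int (3 * p)" "sqrt 3 * real_of_int q < sqrt 3 * real_of_int (2 * s)"
          using inside twisted(1-4) by (simp_all add: mult.commute mult.left_commute sqrt3_mult)
        then show ?thesis unfolding iff by linarith
      next
        case 3
        then have "sqrt 3 * real_of_int r < sqrt 3 * real_of_int (2 * p)" "real_of_int (2 * q) < real_of_int (3 * s)"
          using inside twisted(1-4) by (simp_all add: mult.commute mult.left_commute sqrt3_mult)
        then show ?thesis unfolding iff by linarith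
      next
        case 4
        then have "real_of_int r < real_of_int (3 * p)" "sqrt 3 * real_of_int q < sqrt 3 * real_of_int s"
          using inside twisted(1-4) by (simp_all add: mult.commute mult.left_commute sqrt3_mult)
        then show ?thesis unfolding iff by linarith
      qed
    qed
    from vertex_twisted[OF nn' twisted(5) this] show ?thesis ..
  qed
qed

section \<open>Expansions and their best approximations\<close>

primrec digit_row :: "(nat \<Rightarrow> digit) \<Rightarrow> real \<times> real \<Rightarrow> nat \<Rightarrow> real \<times> real" where
  "digit_row \<delta> v 0 = v"
| "digit_row \<delta> v (Suc n) = (case digit_row \<delta> v n of (x, y) \<Rightarrow>
     (x * da (\<delta> n) + y * dc (\<delta> n), x * db (\<delta> n) + y * da (\<delta> n)))"

text \<open>
  A point \<open>t 0\<close> with given digits and its tails \<open>t n\<close>. The matrix with rows \<open>(p n, p' n)\<close> and \<open>(q n, q' n)\<close> is the product of the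
  first \<open>n\<close> digit matrices; \<open>t n\<close> and \<open>- r n\<close> are the preimages under it of \<open>t 0\<close> and of \<open>\<infinity>\<close>.
\<close>

locale digit_expansion =
  fixes \<delta> :: "nat \<Rightarrow> digit" and t :: "nat \<Rightarrow> real"
  assumes t_Suc: "t n = mob (\<delta> n) (t (Suc n))" and t_range: "t n \<in> {1/2..2}"
begin

definition p where "p n = fst (digit_row \<delta> (1, 0) n)"
definition p' where "p' n = snd (digit_row \<delta> (1, 0) n)"
definition q where "q n = fst (digit_row \<delta> (0, 1) n)"
definition q' where "q' n = snd (digit_row \<delta> (0, 1) n)"
definition r where "r n = q' n / q n"

lemma row_0 [simp]: "p 0 = 1" "p' 0 = 0" "q 0 = 0" "q' 0 = 1"
  by (simp_all add: p_def p'_def q_def q'_def)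

lemma row_Suc:
  "p (Suc n) = p n * da (\<delta> n) + p' n * dc (\<delta> n)" "p' (Suc n) = p n * db (\<delta> n) + p' n * da (\<delta> n)"
  "q (Suc n) = q n * da (\<delta> n) + q' n * dc (\<delta> n)" "q' (Suc n) = q n * db (\<delta> n) + q' n * da (\<delta> n)"
  by (simp_all add: p_def p'_def q_def q'_def split: prod.split)

lemma in_H6_convergent: "in_H6 (p n) (p' n) (q n) (q' n)"
proof (induction n)
  case 0
  show ?case using in_H6_one by simp
next
  case (Suc n)
  show ?case using in_H6_mult[OF Suc in_H6_digit[of "\<delta> n"]] by (simp add: row_Suc)
qed

lemma t_pos: "t n > 0"
  using t_range[of n] by simp

lemma q_nonneg: "0 \<le> q n \<and> 1 \<le> q' n"
proof (induction n)
  case (Suc n)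
  have "0 \<le> q n * da (\<delta> n)" "0 \<le> q n * db (\<delta> n)"
    using Suc digit_ge_1[of "\<delta> n"] by (auto intro!: mult_nonneg_nonneg)
  moreover have "1 * 1 \<le> q' n * da (\<delta> n)" "1 * 1 \<le> q' n * dc (\<delta> n)"
    using Suc digit_ge_1[of "\<delta> n"] by (intro mult_mono; simp)+
  ultimately show ?case unfolding row_Suc by linarith
qed simp

lemma q_Suc_ge: "q n + q' n \<le> q (Suc n)" "q n + q' n \<le> q' (Suc n)"
proof -
  have "q n * 1 \<le> q n * da (\<delta> n)" "q n * 1 \<le> q n * db (\<delta> n)"
    "q' n * 1 \<le> q' n * da (\<delta> n)" "q' n * 1 \<le> q' n * dc (\<delta> n)"
    using q_nonneg[of n] digit_ge_1[of "\<delta> n"] by (intro mult_left_mono; simp)+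
  then show "q n + q' n \<le> q (Suc n)" "q n + q' n \<le> q' (Suc n)" unfolding row_Suc by linarith+
qed

lemma q_mono: "m \<le> n \<Longrightarrow> q m \<le> q n \<and> q' m \<le> q' n"
proof (induction n rule: dec_induct)
  case (step n)
  then show ?case using q_Suc_ge[of n] q_nonneg[of n] by linarith
qed simp

lemma q_ge: "real n \<le> q n \<and> real n \<le> q' n"
proof (induction n)
  case (Suc n)
  then show ?case using q_Suc_ge[of n] q_nonneg[of n] by simp
qed (use q_nonneg in auto)

lemma q_pos: "n \<ge> 1 \<Longrightarrow> q n > 0"
  using q_ge[of n] by simp

lemma denominator_pos: "q n * t n + q' n > 0"
  using q_nonneg[of n] t_pos[of n] by (smt (verit) mult_nonneg_nonneg)

lemma t_0_eq: "t 0 * (q n * t n + q' n) = p n * t n + p' n"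
proof (induction n)
  case (Suc n)
  define s where "s = t (Suc n)"
  define D where "D = dc (\<delta> n) * s + da (\<delta> n)"
  have D: "D > 0" using digit_ge_1[of "\<delta> n"] t_pos[of "Suc n"] by (simp add: D_def s_def add_pos_pos)
  then have tn: "t n * D = da (\<delta> n) * s + db (\<delta> n)"
    using t_Suc[of n] by (simp add: mob_def D_def s_def)
  have "t 0 * (q n * (t n * D) + q' n * D) = p n * (t n * D) + p' n * D"
    using arg_cong[OF Suc, of "\<lambda>x. x * D"] by (simp add: algebra_simps)
  then show ?case unfolding tn s_def[symmetric] by (simp add: D_def row_Suc algebra_simps)
qed simp

lemma convergent_error:
  "p n - t 0 * q n = 1 / (q n * t n + q' n)" "p' n - t 0 * q' n = - t n / (q n * t n + q' n)"
proof -
  define D where "D = q n * t n + q' n"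
  have D: "D \<noteq> 0" using denominator_pos[of n] by (simp add: D_def)
  have det: "p n * q' n - p' n * q n = 1" using in_H6_det[OF in_H6_convergent] by simp
  have eq: "t 0 * D = p n * t n + p' n" using t_0_eq[of n] by (simp add: D_def)
  have "(p n - t 0 * q n) * D = p n * D - q n * (t 0 * D)" by (simp add: algebra_simps)
  also have "\<dots> = p n * q' n - p' n * q n" unfolding eq by (simp add: D_def algebra_simps)
  finally show "p n - t 0 * q n = 1 / (q n * t n + q' n)"
    using D det unfolding D_def[symmetric] by (simp add: field_simps)
  have "(p' n - t 0 * q' n) * D = p' n * D - q' n * (t 0 * D)" by (simp add: algebra_simps)
  also have "\<dots> = - t n * (p n * q' n - p' n * q n)" unfolding eq by (simp add: D_def algebra_simps)
  finally show "p' n - t 0 * q' n = - t n / (q n * t n + q' n)"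
    using D det unfolding D_def[symmetric] by (simp add: field_simps)
qed

text \<open>
  \<open>t n + r n\<close> is the distance of the endpoints of the geodesic from \<open>\<infinity>\<close> to \<open>t 0\<close>, as seen after the \<open>n\<close>-th digit
  from the cusp \<open>\<infinity>\<close>. The second column plays the same role for the cusp \<open>0\<close>.
\<close>

lemma height_first_column:
  assumes "n \<ge> 1"
  shows "\<bar>q n * (p n - t 0 * q n)\<bar> * (t n + r n) = 1"
proof -
  have "t n + r n = (q n * t n + q' n) / q n" using q_pos[OF assms] by (simp add: r_def field_simps)
  moreover have "\<bar>q n * (p n - t 0 * q n)\<bar> = q n / (q n * t n + q' n)"
    using q_pos[OF assms] denominator_pos[of n] by (simp add: convergent_error abs_mult)
  ultimately show ?thesis using q_pos[OF assms] denominator_pos[of n] by simp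
qed

lemma height_second_column:
  assumes "n \<ge> 1"
  shows "\<bar>q' n * (p' n - t 0 * q' n)\<bar> * (1 / t n + 1 / r n) = 1"
proof -
  have q': "q' n > 0" using q_nonneg[of n] by simp
  have "1 / t n + 1 / r n = (q n * t n + q' n) / (q' n * t n)"
    using q' t_pos[of n] by (simp add: r_def field_simps)
  moreover have "\<bar>q' n * (p' n - t 0 * q' n)\<bar> = q' n * t n / (q n * t n + q' n)"
    using q' t_pos[of n] denominator_pos[of n] by (simp add: convergent_error abs_mult)
  ultimately show ?thesis using q' t_pos[of n] denominator_pos[of n] by simp
qed

lemma r_Suc: "n \<ge> 1 \<Longrightarrow> r (Suc n) = mob (\<delta> n) (r n)"
proof -
  assume "n \<ge> 1"
  then have q: "q n > 0" by (rule q_pos)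
  have "db (\<delta> n) * q n + da (\<delta> n) * q' n = q n * (da (\<delta> n) * r n + db (\<delta> n))"
    "da (\<delta> n) * q n + dc (\<delta> n) * q' n = q n * (dc (\<delta> n) * r n + da (\<delta> n))"
    using q by (simp_all add: r_def field_simps)
  then show ?thesis using q by (simp add: r_def[of "Suc n"] row_Suc mob_def mult.commute add.commute)
qed

lemma r_1: "r (Suc 0) = da (\<delta> 0) / dc (\<delta> 0)"
  by (simp add: r_def row_Suc)

lemma r_range: "n \<ge> 1 \<Longrightarrow> r n \<in> {1/2..2}"
proof (induction n rule: dec_induct)
  case base
  show ?case using sqrt3_bounds by (cases "\<delta> 0") (auto simp: r_1 field_simps)
next
  case (step n)
  then show ?case using mob_range r_Suc by simp
qed

text \<open>
  If \<open>t 0\<close> were a rational multiple of \<open>\<surd>3\<close> with denominator \<open>w\<close>, the shapes of the matrices would keep the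
  nonzero numbers \<open>p n - t 0 q n\<close> at distance at least \<open>1/w\<close> from zero, yet they tend to zero.
\<close>

lemma t_0_not_in_Q_H6: "Fin (t 0) \<notin> Q_H6"
proof
  assume "Fin (t 0) \<in> Q_H6"
  then obtain u w :: int where w: "w > 0" "t 0 = sqrt 3 * u / w"
    by (rule Q_H6_imp_multiple_sqrt3)
  have low: "1 / real_of_int w \<le> \<bar>p n - t 0 * q n\<bar>" for n
  proof -
    have nz: "p n - t 0 * q n \<noteq> 0" using denominator_pos[of n] by (simp add: convergent_error)
    have "1 \<le> \<bar>(p n - t 0 * q n) * w\<bar>"
      using in_H6_shape[OF in_H6_convergent[of n]]
    proof (cases rule: hecke_shape_cases)
      case (integral i j k l)
      have "(p n - t 0 * q n) * w = p n * w - t 0 * w * q n" by (simp add: algebra_simps)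
      also have "\<dots> = real_of_int (i * w - 3 * u * k)"
        using w integral(1,3) by (simp add: sqrt3_mult2)
      finally have "(p n - t 0 * q n) * w = real_of_int (i * w - 3 * u * k)" .
      moreover from this have "real_of_int (i * w - 3 * u * k) \<noteq> 0" using nz w by auto
      then have "1 \<le> \<bar>i * w - 3 * u * k\<bar>" by linarith
      ultimately show ?thesis by (metis of_int_1_le_iff of_int_abs)
    next
      case (twisted i j k l)
      have eq: "(p n - t 0 * q n) * w = sqrt 3 * real_of_int (i * w - u * k)"
        using w twisted by (simp add: field_simps)
      moreover from this have "real_of_int (i * w - u * k) \<noteq> 0" using nz w by auto
      then have "1 \<le> \<bar>i * w - u * k\<bar>" by linarith
      then have "1 \<le> \<bar>real_of_int (i * w - u * k)\<bar>" by (metis of_int_1_le_iff of_int_abs)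
      then have "1 * 1 \<le> sqrt 3 * \<bar>real_of_int (i * w - u * k)\<bar>" by (intro mult_mono) auto
      ultimately show ?thesis by (simp add: abs_mult)
    qed
    then show ?thesis using w(1) by (simp add: abs_mult pos_divide_le_eq)
  qed
  obtain n where n: "real n > real_of_int w" using reals_Archimedean2 by blast
  have "real n \<le> q n * t n + q' n" using q_ge[of n] q_nonneg[of n] t_pos[of n]
    by (smt (verit) mult_nonneg_nonneg)
  then have "real_of_int w < q n * t n + q' n" using n by linarith
  then have "1 / (q n * t n + q' n) < 1 / real_of_int w" using w by (intro divide_strict_left_mono) auto
  then show False using low[of n] denominator_pos[of n] by (simp add: convergent_error)
qed

text \<open>
  A Euclidean algorithm for matrices: if the interval from \<open>b/d\<close> to \<open>a/c\<close> contains \<open>t n\<close>, then by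
  \<open>no_vertex_inside\<close> it is contained in the interval of the next digit, and splitting off that digit matrix
  leaves a nonnegative matrix with a smaller sum of entries around the next tail, until the identity remains.
\<close>

lemma positive_matrix_is_convergent:
  assumes "in_H6 a b c d" "0 \<le> a" "0 \<le> b" "0 \<le> c" "0 \<le> d" "b < t n * d" "c * t n < a"
    and "a + b + c + d \<le> real K"
  shows "\<exists>m. p m = p n * a + p' n * c \<and> p' m = p n * b + p' n * d \<and>
             q m = q n * a + q' n * c \<and> q' m = q n * b + q' n * d"
  using assms
proof (induction K arbitrary: n a b c d)
  case 0
  have "0 \<le> c * t n" using "0.prems"(4) t_pos[of n] by simp
  then show ?case using "0.prems" by linarith
next
  case (Suc K)
  define e where "e = \<delta> n"
  define s where "s = t (Suc n)"
  have s: "s > 0" using t_pos s_def by simp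
  have e1: "1 \<le> da e" "1 \<le> db e" "1 \<le> dc e" by (rule digit_ge_1)+
  define D where "D = dc e * s + da e"
  have D: "D > 0" using e1 s by (simp add: D_def add_pos_pos)
  have tD: "t n * D = da e * s + db e" using D t_Suc[of n] by (simp add: mob_def D_def s_def e_def)
  have t: "t n > 0" by (rule t_pos)
  have "0 \<le> c * t n" using Suc.prems(4) t by simp
  then have a: "a > 0" using Suc.prems(7) by linarith
  have d: "d > 0" using Suc.prems(3,5,6) by (cases "d = 0") auto
  have detd: "da e * da e - db e * dc e = 1" by (rule digit_det)
  have left: "db e < t n * da e"
  proof -
    have "(t n * da e - db e) * D = s * (da e * da e - db e * dc e)"
      using arg_cong[OF tD, of "\<lambda>x. da e * x"] by (simp add: D_def algebra_simps)
    then have "(t n * da e - db e) * D > 0" using detd s by simp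
    then show ?thesis using D by (simp add: zero_less_mult_iff)
  qed
  have right: "t n * dc e < da e"
  proof -
    have "(da e - t n * dc e) * D = da e * da e - db e * dc e"
      using arg_cong[OF tD, of "\<lambda>x. dc e * x"] by (simp add: D_def algebra_simps)
    then have "(da e - t n * dc e) * D > 0" using detd by simp
    then show ?thesis using D by (simp add: zero_less_mult_iff)
  qed
  show ?case
  proof (cases "a = 1 \<and> b = 0 \<and> c = 0 \<and> d = 1")
    case True
    then show ?thesis by (intro exI[of _ n]) simp
  next
    case False
    have "b * dc e < d * da e"
    proof -
      have "b * dc e < t n * d * dc e" using Suc.prems(6) e1 by (intro mult_strict_right_mono) auto
      also have "\<dots> = d * (t n * dc e)" by simp
      also have "\<dots> \<le> d * da e" using right d by (intro mult_left_mono) auto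
      finally show ?thesis .
    qed
    then have c': "a * dc e \<le> c * da e"
      using no_vertex_inside[OF Suc.prems(1-5), of "da e" "dc e" e] False by force
    have "c * db e < a * da e"
    proof -
      have "c * db e \<le> c * (t n * da e)" using left Suc.prems(4) by (intro mult_left_mono) auto
      also have "\<dots> = c * t n * da e" by simp
      also have "\<dots> < a * da e" using Suc.prems(7) e1 by (intro mult_strict_right_mono) auto
      finally show ?thesis .
    qed
    then have b': "d * db e \<le> b * da e"
      using no_vertex_inside[OF Suc.prems(1-5), of "db e" "da e" e] False by force
    define A B C E where "A = da e * a - db e * c" and "B = da e * b - db e * d"
      and "C = da e * c - dc e * a" and "E = da e * d - dc e * b"
    have h: "in_H6 A B C E"
      using in_H6_mult[OF in_H6_inverse[OF in_H6_digit[of e]] Suc.prems(1)]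
      by (simp add: A_def B_def C_def E_def algebra_simps)
    have nn: "0 < A" "0 \<le> B" "0 \<le> C" "0 < E"
      using \<open>c * db e < a * da e\<close> \<open>b * dc e < d * da e\<close> b' c' by (simp_all add: A_def B_def C_def E_def algebra_simps)
    have abcd: "a = da e * A + db e * C" "b = da e * B + db e * E" "c = dc e * A + da e * C" "d = dc e * B + da e * E"
    proof -
      have "da e * A + db e * C = (da e * da e - db e * dc e) * a" by (simp add: A_def C_def algebra_simps)
      moreover have "da e * B + db e * E = (da e * da e - db e * dc e) * b" by (simp add: B_def E_def algebra_simps)
      moreover have "dc e * A + da e * C = (da e * da e - db e * dc e) * c" by (simp add: A_def C_def algebra_simps)
      moreover have "dc e * B + da e * E = (da e * da e - db e * dc e) * d" by (simp add: B_def E_def algebra_simps)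
      ultimately show "a = da e * A + db e * C" "b = da e * B + db e * E" "c = dc e * A + da e * C" "d = dc e * B + da e * E"
        using detd by simp_all
    qed
    have BE: "B < s * E"
    proof -
      have "s * E - B = (t n * D) * d - b * D" unfolding tD by (simp add: B_def E_def D_def algebra_simps)
      also have "\<dots> = (t n * d - b) * D" by (simp add: algebra_simps)
      finally have "s * E - B > 0" using Suc.prems(6) D by simp
      then show ?thesis by simp
    qed
    have CA: "C * s < A"
    proof -
      have "A - C * s = a * D - c * (t n * D)" unfolding tD by (simp add: A_def C_def D_def algebra_simps)
      also have "\<dots> = (a - c * t n) * D" by (simp add: algebra_simps)
      finally have "A - C * s > 0" using Suc.prems(7) D by simp
      then show ?thesis by simp
    qed
    have "A + B + C + E \<le> real K"
    proof -
      have "1 * A \<le> da e * A" "1 * C \<le> db e * C" "1 * B \<le> da e * B" "1 * E \<le> db e * E"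
        "1 * A \<le> dc e * A" "1 * C \<le> da e * C" "1 * B \<le> dc e * B" "1 * E \<le> da e * E"
        using e1 nn by (intro mult_right_mono; simp)+
      moreover have "1 \<le> A" using in_H6_entry_ge_1(1)[OF h] nn(1) by simp
      ultimately have "A + B + C + E + 1 \<le> a + b + c + d" using nn unfolding abcd by linarith
      then show ?thesis using Suc.prems(8) by simp
    qed
    then obtain m where m: "p m = p (Suc n) * A + p' (Suc n) * C \<and> p' m = p (Suc n) * B + p' (Suc n) * E \<and>
             q m = q (Suc n) * A + q' (Suc n) * C \<and> q' m = q (Suc n) * B + q' (Suc n) * E"
      using Suc.IH[OF h, of "Suc n"] nn BE CA by (auto simp: s_def)
    then show ?thesis
      by (intro exI[of _ m]) (simp add: row_Suc e_def[symmetric] abcd algebra_simps)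
  qed
qed

lemma separating_matrix_is_convergent:
  assumes h: "in_H6 a b c d" and cd: "c > 0" "d > 0" and sep: "b < t 0 * d" "c * t 0 < a"
  shows "\<exists>m. p m = a \<and> p' m = b \<and> q m = c \<and> q' m = d"
proof -
  have det: "a * d - b * c = 1" using in_H6_det[OF h] .
  have a: "a > 0" using sep(2) cd t_pos[of 0] by (smt (verit) mult_pos_pos)
  \<comment> \<open>A negative \<open>b\<close> would be at most \<open>-1\<close> and push the determinant above \<open>1\<close>.\<close>
  have "b \<ge> 0"
  proof (rule ccontr)
    assume "\<not> b \<ge> 0"
    then have "b \<le> - 1" "c \<ge> 1" using in_H6_entry_ge_1(2,3)[OF h] cd by auto
    then have "1 * 1 \<le> (- b) * c" by (intro mult_mono) auto
    moreover have "a * d > 0" using a cd by simp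
    ultimately show False using det by simp
  qed
  obtain K where "a + b + c + d \<le> real K" using real_arch_simple by blast
  from positive_matrix_is_convergent[OF h _ \<open>b \<ge> 0\<close> _ _ sep this] a cd
  show ?thesis by auto
qed

text \<open>
  In the coordinates where the cusp \<open>a/c\<close> is \<open>\<infinity>\<close>, the endpoints of the geodesic are more than \<open>\<surd>3\<close> apart. A
  translate of the side \<open>(0, \<infinity>)\<close> by a multiple of \<open>\<surd>3\<close> therefore separates them. This side has \<open>t 0\<close> on one side and
  \<open>\<infinity>\<close> on the other, so it is one of the sides recorded by the expansion.
\<close>

lemma good_approximation_is_convergent:
  assumes h: "in_H6 a b c d" and c: "c > 0" and good: "sqrt 3 * \<bar>c * (a - t 0 * c)\<bar> < 1"
  shows "\<exists>m. (a = p m \<and> c = q m) \<or> (a = p' m \<and> c = q' m)"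
proof -
  define \<alpha> where "\<alpha> = c * (a - t 0 * c)"
  obtain \<mu> where "\<mu> > 0" "\<mu> \<le> \<bar>a - t 0 * c\<bar>"
    using cusp_distance[OF t_0_not_in_Q_H6, of "\<bar>c\<bar>"] h by (metis order_refl)
  then have \<alpha>: "\<alpha> \<noteq> 0" using c by (auto simp: \<alpha>_def)
  then obtain k :: int where k: "\<bar>(a * d + b * c - 2 * t 0 * c * d) / 2 + sqrt 3 * k * \<alpha>\<bar> \<le> sqrt 3 / 2 * \<bar>\<alpha>\<bar>"
    using translate_into_strip by metis
  define b' d' where "b' = b + sqrt 3 * k * a" and "d' = d + sqrt 3 * k * c"
  have h': "in_H6 a b' c d'" using in_H6_translate[OF h] by (simp add: b'_def d'_def)
  have det: "a * d' - b' * c = 1" by (rule in_H6_det[OF h'])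
  define \<beta> where "\<beta> = a * d' + b' * c - 2 * t 0 * c * d'"
  have "\<beta> = 2 * ((a * d + b * c - 2 * t 0 * c * d) / 2 + sqrt 3 * k * \<alpha>)"
    by (simp add: \<beta>_def b'_def d'_def \<alpha>_def field_simps)
  then have "\<bar>\<beta>\<bar> \<le> sqrt 3 * \<bar>\<alpha>\<bar>" using k by (simp only: abs_mult) simp
  then have "\<bar>\<beta>\<bar> < 1" using good by (simp add: \<alpha>_def)
  then have "\<beta>\<^sup>2 < 1" by (simp add: abs_square_less_1)
  have disc: "\<beta>\<^sup>2 - 4 * \<alpha> * (d' * (b' - t 0 * d')) = (a * d' - b' * c)\<^sup>2"
    by (simp add: \<alpha>_def \<beta>_def algebra_simps power2_eq_square)
  \<comment> \<open>The reduced form has middle coefficient below \<open>1\<close> in modulus, but discriminant \<open>1\<close>. So its outer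
    coefficients have opposite signs.\<close>
  have neg: "(a - t 0 * c) * (d' * (b' - t 0 * d')) < 0"
  proof -
    have "c * ((a - t 0 * c) * (d' * (b' - t 0 * d'))) = \<alpha> * (d' * (b' - t 0 * d'))"
      by (simp add: \<alpha>_def)
    also have "\<dots> < 0" using \<open>\<beta>\<^sup>2 < 1\<close> disc unfolding det by simp
    finally show ?thesis using c by (simp only: mult_less_0_iff) auto
  qed
  have det2: "d' * (a - t 0 * c) - c * (b' - t 0 * d') = 1" using det by (simp add: algebra_simps)
  \<comment> \<open>In the second case the columns must be exchanged to obtain positive denominators.\<close>
  show ?thesis
  proof (cases "d' > 0")
    case True
    have "a - t 0 * c > 0"
    proof (rule ccontr)
      assume "\<not> ?thesis"
      moreover from this neg have "a - t 0 * c < 0" "b' - t 0 * d' > 0"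
        using True by (auto simp: mult_less_0_iff zero_less_mult_iff)
      ultimately have "d' * (a - t 0 * c) < 0" "c * (b' - t 0 * d') > 0"
        using True c by (auto simp: mult_less_0_iff)
      then show False using det2 by linarith
    qed
    moreover from this have "b' - t 0 * d' < 0" using neg True by (auto simp: mult_less_0_iff zero_less_mult_iff)
    ultimately have "\<exists>m. p m = a \<and> p' m = b' \<and> q m = c \<and> q' m = d'"
      using True c by (intro separating_matrix_is_convergent[OF h']) (auto simp: mult.commute)
    then show ?thesis by auto
  next
    case False
    moreover have "d' \<noteq> 0" using neg by auto
    ultimately have d': "d' < 0" by simp
    have "a - t 0 * c < 0"
    proof (rule ccontr)
      assume n: "\<not> ?thesis"
      have "a - t 0 * c \<noteq> 0" using neg by auto
      with n have p: "a - t 0 * c > 0" by simp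
      then have "b' - t 0 * d' > 0" using neg d' by (auto simp: mult_less_0_iff zero_less_mult_iff)
      then have "c * (b' - t 0 * d') > 0" "d' * (a - t 0 * c) < 0" using c d' p by (auto simp: mult_less_0_iff)
      then show False using det2 by linarith
    qed
    moreover from this have "b' - t 0 * d' < 0" using neg d' by (auto simp: mult_less_0_iff zero_less_mult_iff)
    moreover have "in_H6 (- b') a (- d') c"
      using in_H6_uminus[OF in_H6_swap[OF h']] by simp
    ultimately have "\<exists>m. p m = - b' \<and> p' m = a \<and> q m = - d' \<and> q' m = c"
      using d' c by (intro separating_matrix_is_convergent) (auto simp: mult.commute)
    then show ?thesis by auto
  qed
qed

text \<open>
  Since \<open>V\<close> exceeds \<open>\<surd>3\<close>, columns that are not columns of the digit products do not influence the limit
  superior. As the denominators increase, \<open>\<bar>c\<bar> \<rightarrow> \<infinity>\<close> amounts to \<open>n \<rightarrow> \<infinity>\<close>.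
\<close>

theorem lagrange_const_eq:
  assumes V: "V > sqrt 3"
    and up: "\<And>e. e > 0 \<Longrightarrow> eventually (\<lambda>n. t n + r n \<le> V + e \<and> 1 / t n + 1 / r n \<le> V + e) sequentially"
    and lo: "\<And>e N. e > 0 \<Longrightarrow> \<exists>n\<ge>N. t n + r n \<ge> V - e"
  shows "lagrange_const (t 0) = ennreal V"
proof (rule antisym)
  have Vpos: "V > 0" using V by (smt (verit) real_sqrt_ge_zero)
  show "lagrange_const (t 0) \<le> ennreal V"
  proof (rule lagrange_const_leI[OF Vpos])
    fix V' assume V': "V' > V"
    then obtain N0 where N0: "\<And>n. n \<ge> N0 \<Longrightarrow> t n + r n \<le> V' \<and> 1 / t n + 1 / r n \<le> V'"
      using up[of "V' - V"] unfolding eventually_sequentially by auto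
    have main: "1 \<le> V' * \<bar>c * (a - t 0 * c)\<bar>" if h: "in_H6 a b c d" and c: "c > q (Suc N0) + q' (Suc N0)" for a b c d
    proof (rule ccontr)
      assume less: "\<not> ?thesis"
      have cpos: "c > 0" using c q_nonneg[of "Suc N0"] by linarith
      have "sqrt 3 * \<bar>c * (a - t 0 * c)\<bar> \<le> V' * \<bar>c * (a - t 0 * c)\<bar>"
        using V V' by (intro mult_right_mono) auto
      then have "sqrt 3 * \<bar>c * (a - t 0 * c)\<bar> < 1" using less by linarith
      then obtain m where m: "(a = p m \<and> c = q m) \<or> (a = p' m \<and> c = q' m)"
        using good_approximation_is_convergent[OF h cpos] by blast
      have "m \<ge> Suc N0"
      proof (rule ccontr)
        assume "\<not> m \<ge> Suc N0"
        then have "q m \<le> q (Suc N0)" "q' m \<le> q' (Suc N0)" using q_mono[of m "Suc N0"] by auto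
        then show False using m c q_nonneg[of "Suc N0"] by auto
      qed
      then have m1: "m \<ge> 1" "m \<ge> N0" by auto
      from m show False
      proof
        assume "a = p m \<and> c = q m"
        then have 1: "\<bar>c * (a - t 0 * c)\<bar> * (t m + r m) = 1" using height_first_column[OF m1(1)] by simp
        have "\<bar>c * (a - t 0 * c)\<bar> * (t m + r m) \<le> \<bar>c * (a - t 0 * c)\<bar> * V'"
          using N0[OF m1(2)] by (intro mult_left_mono) auto
        then show False using less 1 by (simp add: mult.commute)
      next
        assume "a = p' m \<and> c = q' m"
        then have 1: "\<bar>c * (a - t 0 * c)\<bar> * (1 / t m + 1 / r m) = 1" using height_second_column[OF m1(1)] by simp
        have "\<bar>c * (a - t 0 * c)\<bar> * (1 / t m + 1 / r m) \<le> \<bar>c * (a - t 0 * c)\<bar> * V'"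
          using N0[OF m1(2)] by (intro mult_left_mono) auto
        then show False using less 1 by (simp add: mult.commute)
      qed
    qed
    have "1 \<le> V' * \<bar>c * (a - t 0 * c)\<bar>" if h: "in_H6 a b c d" and c: "\<bar>c\<bar> > q (Suc N0) + q' (Suc N0)" for a b c d
    proof (cases "c > 0")
      case True
      then show ?thesis using main[OF h] c by simp
    next
      case False
      moreover have "- c * (- a - t 0 * - c) = c * (a - t 0 * c)" by (simp add: algebra_simps)
      ultimately show ?thesis using main[OF in_H6_uminus[OF h]] c by simp
    qed
    then show "\<exists>N. \<forall>a b c d. in_H6 a b c d \<longrightarrow> \<bar>c\<bar> > N \<longrightarrow> 1 \<le> V' * \<bar>c * (a - t 0 * c)\<bar>" by blast
  qed
  show "ennreal V \<le> lagrange_const (t 0)"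
  proof (rule lagrange_const_geI[OF Vpos])
    fix V' N :: real assume V': "0 < V'" "V' < V"
    obtain n0 where n0: "real n0 > N" using reals_Archimedean2 by blast
    obtain n where n: "n \<ge> Suc n0" "t n + r n \<ge> V - (V - V') / 2" using lo[of "(V - V') / 2" "Suc n0"] V' by auto
    then have n1: "n \<ge> 1" and big: "V' < t n + r n" using V' by (auto simp: field_simps)
    have "\<bar>q n * (p n - t 0 * q n)\<bar> > 0" using height_first_column[OF n1] by (metis abs_ge_zero less_eq_real_def mult_zero_left zero_neq_one)
    then have "\<bar>q n * (p n - t 0 * q n)\<bar> * V' < \<bar>q n * (p n - t 0 * q n)\<bar> * (t n + r n)"
      using big by (intro mult_strict_left_mono)
    then have "V' * \<bar>q n * (p n - t 0 * q n)\<bar> < 1"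
      unfolding height_first_column[OF n1] by (simp add: mult.commute)
    moreover have "\<bar>q n\<bar> > N" using n(1) n0 q_ge[of n] by (smt (verit) Suc_leD of_nat_le_iff)
    ultimately show "\<exists>a b c d. in_H6 a b c d \<and> \<bar>c\<bar> > N \<and> V' * \<bar>c * (a - t 0 * c)\<bar> < 1"
      using in_H6_convergent by blast
  qed
qed

end

section \<open>The block maps and the limiting geodesic\<close>

text \<open>
  The point with prescribed digits, constructed as the increasing limit of finite expansions
  that end in \<open>1/2\<close>. The maps vary with \<open>n\<close>, so that the lemma serves both single digits and whole blocks.
\<close>

lemma backward_orbit_exists:
  fixes F :: "nat \<Rightarrow> real \<Rightarrow> real"
  assumes range: "\<And>n x. x \<in> {1/2..2} \<Longrightarrow> F n x \<in> {1/2..2}"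
    and mono: "\<And>n x y. x \<in> {1/2..2} \<Longrightarrow> y \<in> {1/2..2} \<Longrightarrow> x \<le> y \<Longrightarrow> F n x \<le> F n y"
    and lip: "\<And>n x y. x \<in> {1/2..2} \<Longrightarrow> y \<in> {1/2..2} \<Longrightarrow> \<bar>F n x - F n y\<bar> \<le> \<bar>x - y\<bar>"
  shows "\<exists>t. \<forall>n. t n = F n (t (Suc n)) \<and> t n \<in> {1/2..2}"
proof -
  define s where "s = rec_nat (\<lambda>n. 1/2 :: real) (\<lambda>m f n. F n (f (Suc n)))"
  have s0: "s 0 n = 1/2" and sS: "s (Suc m) n = F n (s m (Suc n))" for m n by (simp_all add: s_def)
  have I: "s m n \<in> {1/2..2}" for m n
  proof (induction m arbitrary: n)
    case (Suc m)
    then show ?case unfolding sS by (intro range)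
  qed (simp add: s0)
  have "s m n \<le> s (Suc m) n" for m n
  proof (induction m arbitrary: n)
    case 0
    then show ?case using I[of "Suc 0" n] by (simp add: s0)
  next
    case (Suc m)
    then show ?case unfolding sS[of "Suc m" n] sS[of m n] using mono I by blast
  qed
  then have inc: "incseq (\<lambda>m. s m n)" for n by (rule incseq_SucI)
  have conv: "\<exists>L. (\<lambda>m. s m n) \<longlonglongrightarrow> L" for n
    using incseq_convergent[OF inc, of n 2] I by (metis atLeastAtMost_iff)
  then obtain t where t: "\<And>n. (\<lambda>m. s m n) \<longlonglongrightarrow> t n" by metis
  have tI: "t n \<in> {1/2..2}" for n
    using LIMSEQ_le_const[OF t, of "1/2" n] LIMSEQ_le_const2[OF t, of n 2] I by auto
  have "t n = F n (t (Suc n))" for n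
  proof (rule LIMSEQ_unique)
    show "(\<lambda>m. s (Suc m) n) \<longlonglongrightarrow> t n" using t[of n] by (rule LIMSEQ_Suc)
    have "(\<lambda>m. \<bar>s m (Suc n) - t (Suc n)\<bar>) \<longlonglongrightarrow> 0"
      using t[of "Suc n"] by (simp add: LIM_zero_iff tendsto_rabs_zero_iff)
    then have "(\<lambda>m. F n (s m (Suc n)) - F n (t (Suc n))) \<longlonglongrightarrow> 0"
      by (rule Lim_null_comparison[rotated]) (use lip I tI in auto)
    then show "(\<lambda>m. s (Suc m) n) \<longlonglongrightarrow> F n (t (Suc n))" by (simp add: sS LIM_zero_iff)
  qed
  with tI show ?thesis by blast
qed

text \<open>
  The upper constant gives convergence of expansions; the lower constant bounds from below the
  distance of points whose expansions differ, which is what the dimension depends on.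
\<close>

definition bilipschitz_inc :: "real \<Rightarrow> real \<Rightarrow> (real \<Rightarrow> real) \<Rightarrow> bool" where
  "bilipschitz_inc c C f \<longleftrightarrow> c > 0 \<and> C > 0 \<and> (\<forall>x\<in>{1/2..2}. f x \<in> {1/2..2}) \<and>
     (\<forall>x\<in>{1/2..2}. \<forall>y\<in>{1/2..2}. x < y \<longrightarrow> c * (y - x) \<le> f y - f x \<and> f y - f x \<le> C * (y - x))"

lemma bilipschitz_incD:
  assumes "bilipschitz_inc c C f" and "x \<in> {1/2..2}"
  shows "f x \<in> {1/2..2}"
    and "y \<in> {1/2..2} \<Longrightarrow> x < y \<Longrightarrow> f x < f y"
    and "y \<in> {1/2..2} \<Longrightarrow> x \<le> y \<Longrightarrow> f x \<le> f y"
    and "y \<in> {1/2..2} \<Longrightarrow> x \<le> y \<Longrightarrow> c * (y - x) \<le> f y - f x"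
    and "y \<in> {1/2..2} \<Longrightarrow> x \<le> y \<Longrightarrow> f y - f x \<le> C * (y - x)"
    and "y \<in> {1/2..2} \<Longrightarrow> \<bar>f x - f y\<bar> \<le> C * \<bar>x - y\<bar>"
    and "y \<in> {1/2..2} \<Longrightarrow> c * \<bar>x - y\<bar> \<le> \<bar>f x - f y\<bar>"
proof -
  have c: "c > 0" "C > 0" using assms(1) by (simp_all add: bilipschitz_inc_def)
  have *: "c * (y - x) \<le> f y - f x \<and> f y - f x \<le> C * (y - x)"
    if "x \<in> {1/2..2}" "y \<in> {1/2..2}" "x \<le> y" for x y
    using assms(1) that by (cases "x = y") (auto simp: bilipschitz_inc_def)
  show "f x \<in> {1/2..2}" using assms by (simp add: bilipschitz_inc_def)
  show "c * (y - x) \<le> f y - f x" "f y - f x \<le> C * (y - x)" if "y \<in> {1/2..2}" "x \<le> y"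
    using *[of x y] assms(2) that by auto
  show lt: "f x < f y" if "y \<in> {1/2..2}" "x < y"
    using *[of x y] assms(2) that mult_pos_pos[OF c(1), of "y - x"] by auto
  show "f x \<le> f y" if "y \<in> {1/2..2}" "x \<le> y"
    using lt[of ] that by (cases "x = y") auto
  have c2: "0 \<le> c * (z - w)" if "w \<le> z" for w z using c that by simp
  show "\<bar>f x - f y\<bar> \<le> C * \<bar>x - y\<bar>" "c * \<bar>x - y\<bar> \<le> \<bar>f x - f y\<bar>" if "y \<in> {1/2..2}"
    using *[of x y] *[of y x] assms(2) that c2[of x y] c2[of y x] by (cases "x \<le> y"; auto simp: abs_if)+
qed

lemma bilipschitz_inc_id: "bilipschitz_inc 1 1 (\<lambda>x. x)"
  by (simp add: bilipschitz_inc_def)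

lemma bilipschitz_inc_comp:
  assumes f: "bilipschitz_inc c C f" and g: "bilipschitz_inc c' C' g"
  shows "bilipschitz_inc (c * c') (C * C') (\<lambda>x. f (g x))"
  unfolding bilipschitz_inc_def
proof (intro conjI ballI impI)
  have c: "c > 0" "C > 0" "c' > 0" "C' > 0" using f g by (auto simp: bilipschitz_inc_def)
  show "0 < c * c'" "0 < C * C'" using c by auto
  fix x :: real assume x: "x \<in> {1/2..2}"
  show "f (g x) \<in> {1/2..2}" using bilipschitz_incD(1)[OF f] bilipschitz_incD(1)[OF g] x by blast
  fix y :: real assume y: "y \<in> {1/2..2}" "x < y"
  have gx: "g x \<in> {1/2..2}" "g y \<in> {1/2..2}" "g x \<le> g y"
    using bilipschitz_incD(1,3)[OF g] x y by (auto simp: less_imp_le)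
  have "c * (c' * (y - x)) \<le> c * (g y - g x)"
    using bilipschitz_incD(4)[OF g x] y c by (intro mult_left_mono) auto
  also have "\<dots> \<le> f (g y) - f (g x)" using bilipschitz_incD(4)[OF f] gx by blast
  finally show "c * c' * (y - x) \<le> f (g y) - f (g x)" by (simp add: mult.assoc)
  have "f (g y) - f (g x) \<le> C * (g y - g x)" using bilipschitz_incD(5)[OF f] gx by blast
  also have "\<dots> \<le> C * (C' * (y - x))"
    using bilipschitz_incD(5)[OF g x] y c by (intro mult_left_mono) auto
  finally show "f (g y) - f (g x) \<le> C * C' * (y - x)" by (simp add: mult.assoc)
qed

lemma bilipschitz_inc_funpow:
  assumes "bilipschitz_inc c C f"
  shows "bilipschitz_inc (c ^ k) (C ^ k) (f ^^ k)"
proof (induction k)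
  case 0
  then show ?case using bilipschitz_inc_id by (simp add: id_def)
next
  case (Suc k)
  then show ?case using bilipschitz_inc_comp[OF assms Suc] by (simp add: o_def)
qed

lemma bilipschitz_inc_weaken:
  assumes "bilipschitz_inc c C f" "C \<le> C'"
  shows "bilipschitz_inc c C' f"
  unfolding bilipschitz_inc_def
proof (intro conjI ballI impI)
  show "0 < c" "0 < C'" using assms by (auto simp: bilipschitz_inc_def)
  fix x :: real assume x: "x \<in> {1/2..2}"
  show "f x \<in> {1/2..2}" using bilipschitz_incD(1)[OF assms(1) x] .
  fix y :: real assume y: "y \<in> {1/2..2}" "x < y"
  show "c * (y - x) \<le> f y - f x" using bilipschitz_incD(4)[OF assms(1) x] y by simp
  have "f y - f x \<le> C * (y - x)" using bilipschitz_incD(5)[OF assms(1) x] y by simp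
  also have "\<dots> \<le> C' * (y - x)" using assms(2) y by (intro mult_right_mono) auto
  finally show "f y - f x \<le> C' * (y - x)" .
qed

lemma bilipschitz_inc_mob: "bilipschitz_inc (1/36) (1/4) (mob e)"
  unfolding bilipschitz_inc_def
proof (intro conjI ballI impI)
  fix x y :: real assume *: "x \<in> {1/2..2}" "y \<in> {1/2..2}" "x < y"
  have "mob e x < mob e y" using * by (intro mob_strict_mono) auto
  then show "1 / 36 * (y - x) \<le> mob e y - mob e x" "mob e y - mob e x \<le> 1 / 4 * (y - x)"
    using mob_dist[OF *(1,2), of e] *(3) by auto
qed (use mob_range in auto)

text \<open>
  \<open>\<Phi> k\<close> prepends the block \<open>3 (24)\<^sup>k\<close> to an expansion, and \<open>\<Psi> k\<close> prepends \<open>(42)\<^sup>k 3\<close>, the same block read backwards.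
\<close>

definition g24 where "g24 x = mob D2 (mob D4 x)"
definition g42 where "g42 x = mob D4 (mob D2 x)"
definition \<Phi> where "\<Phi> k x = mob D3 ((g24 ^^ k) x)"
definition \<Psi> where "\<Psi> k x = (g42 ^^ k) (mob D3 x)"

lemma bilipschitz_g24: "bilipschitz_inc ((1/36) ^ 2) ((1/4) ^ 2) g24"
  using bilipschitz_inc_comp[OF bilipschitz_inc_mob[of D2] bilipschitz_inc_mob[of D4]]
  by (simp add: g24_def[abs_def] power2_eq_square)

lemma bilipschitz_g42: "bilipschitz_inc ((1/36) ^ 2) ((1/4) ^ 2) g42"
  using bilipschitz_inc_comp[OF bilipschitz_inc_mob[of D4] bilipschitz_inc_mob[of D2]]
  by (simp add: g42_def[abs_def] power2_eq_square)

lemmas bilipschitz_g24_pow = bilipschitz_inc_funpow[OF bilipschitz_g24]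
lemmas bilipschitz_g42_pow = bilipschitz_inc_funpow[OF bilipschitz_g42]

lemma bilipschitz_\<Phi>: "bilipschitz_inc ((1/36) ^ (2 * k + 1)) (1/4) (\<Phi> k)"
proof (rule bilipschitz_inc_weaken)
  show "bilipschitz_inc ((1/36) ^ (2 * k + 1)) (1/4 * ((1/4)\<^sup>2) ^ k) (\<Phi> k)"
    using bilipschitz_inc_comp[OF bilipschitz_inc_mob[of D3] bilipschitz_g24_pow[of k]]
    by (simp add: \<Phi>_def[abs_def] power_mult)
qed (simp add: power_le_one)

lemma bilipschitz_\<Psi>: "bilipschitz_inc ((1/36) ^ (2 * k + 1)) (1/4) (\<Psi> k)"
proof (rule bilipschitz_inc_weaken)
  show "bilipschitz_inc ((1/36) ^ (2 * k + 1)) (((1/4)\<^sup>2) ^ k * (1/4)) (\<Psi> k)"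
    using bilipschitz_inc_comp[OF bilipschitz_g42_pow[of k] bilipschitz_inc_mob[of D3]]
    by (simp add: \<Psi>_def[abs_def] power_mult)
qed (simp add: power_le_one)

lemma g24_pow_Suc: "(g24 ^^ Suc k) x = mob D2 (mob D4 ((g24 ^^ k) x))"
  by (simp add: g24_def)

lemma g42_pow_Suc: "(g42 ^^ Suc k) x = mob D4 (mob D2 ((g42 ^^ k) x))"
  by (simp add: g42_def)

lemma g24_pow_range: "k \<ge> 1 \<Longrightarrow> x \<in> {1/2..2} \<Longrightarrow> (g24 ^^ k) x \<in> {0.68..0.78}"
proof -
  assume k: "k \<ge> 1" and x: "x \<in> {1/2..2}"
  obtain j where j: "k = Suc j" using k by (cases k) auto
  have "(g24 ^^ j) x \<in> {1/2..2}" by (rule bilipschitz_incD(1)[OF bilipschitz_g24_pow x])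
  then show ?thesis unfolding j g24_pow_Suc by (intro mob_D2_range mob_range)
qed

lemma g42_pow_range: "k \<ge> 1 \<Longrightarrow> x \<in> {1/2..2} \<Longrightarrow> (g42 ^^ k) x \<in> {1.31..1.47}"
proof -
  assume k: "k \<ge> 1" and x: "x \<in> {1/2..2}"
  obtain j where j: "k = Suc j" using k by (cases k) auto
  have "(g42 ^^ j) x \<in> {1/2..2}" by (rule bilipschitz_incD(1)[OF bilipschitz_g42_pow x])
  then have 2: "mob D2 ((g42 ^^ j) x) \<in> {0.68..0.78}" by (rule mob_D2_range)
  have "1.31 \<le> mob D4 0.68" using sqrt3_bounds by (simp add: mob_def field_simps)
  also have "\<dots> \<le> mob D4 (mob D2 ((g42 ^^ j) x))" using 2 by (intro mob_mono) auto
  finally show ?thesis using mob_D4_range[of "mob D2 ((g42 ^^ j) x)"] 2 unfolding j g42_pow_Suc by auto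
qed

lemma \<Phi>_range: "x \<in> {1/2..2} \<Longrightarrow> \<Phi> k x \<in> {0.95..1.05}"
  unfolding \<Phi>_def by (rule mob_D3_range[OF bilipschitz_incD(1)[OF bilipschitz_g24_pow]])

text \<open>
  Here \<open>s\<close> stands for an expansion that starts with the digit 3. After the common prefix \<open>3 (24)\<^sup>j\<close> one expansion continues with the digit 3, the other with the smaller
  digit 2. Digits order expansions lexicographically, so \<open>\<Phi>\<close> decreases with the exponent.
\<close>

lemma \<Phi>_gap:
  assumes "j < k" and s: "s \<in> {0.95..1.05}" and t: "t \<in> {1/2..2}"
  shows "(1/36) ^ (2 * j + 1) * (1/6) \<le> \<Phi> j s - \<Phi> k t"
proof -
  define u where "u = (g24 ^^ (k - j)) t"
  have u: "u \<in> {0.68..0.78}" unfolding u_def using g24_pow_range[OF _ t] assms(1) by simp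
  have "\<Phi> k t = \<Phi> j u"
    using assms(1) by (simp add: \<Phi>_def u_def flip: funpow_add[unfolded o_def, THEN fun_cong])
  moreover have "(1/36) ^ (2 * j + 1) * (s - u) \<le> \<Phi> j s - \<Phi> j u"
    using u s by (intro bilipschitz_incD(4)[OF bilipschitz_\<Phi>]) auto
  moreover have "(1/36) ^ (2 * j + 1) * (1/6) \<le> (1/36) ^ (2 * j + 1) * (s - u)"
    using u s by (intro mult_left_mono) auto
  ultimately show ?thesis by linarith
qed

lemma \<Phi>_less:
  assumes "j < k" and "s \<in> {0.95..1.05}" and "t \<in> {1/2..2}"
  shows "\<Phi> k t < \<Phi> j s"
proof -
  have "0 < (1/36 :: real) ^ (2 * j + 1) * (1/6)" by simp
  then show ?thesis using \<Phi>_gap[OF assms] by linarith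
qed

text \<open>
  Here \<open>s\<close> stands for an expansion that starts with the digit 3, or for \<open>2/\<surd>3\<close>, the right end of the interval
  of that digit; any further power of \<open>g42\<close> starts with the larger digit 4.
\<close>

lemma g42_pow_less:
  assumes "j < k" and s: "s \<in> {1/2..1.3}" and t: "t \<in> {1/2..2}"
  shows "(g42 ^^ j) s < (g42 ^^ k) t"
proof -
  define u where "u = (g42 ^^ (k - j)) t"
  have u: "u \<in> {1.31..1.47}" unfolding u_def using g42_pow_range[OF _ t] assms(1) by simp
  have "(g42 ^^ k) t = (g42 ^^ j) u"
    using assms(1) by (simp add: u_def flip: funpow_add[unfolded o_def, THEN fun_cong])
  moreover have "(g42 ^^ j) s < (g42 ^^ j) u"
    using u s by (intro bilipschitz_incD(2)[OF bilipschitz_g42_pow]) auto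
  ultimately show ?thesis by simp
qed

lemma \<Psi>_mono:
  assumes "j \<le> k" and s: "s \<in> {1/2..2}"
  shows "\<Psi> j s \<le> \<Psi> k s"
proof (cases "j = k")
  case False
  then have "(g42 ^^ j) (mob D3 s) < (g42 ^^ k) (mob D3 s)"
    using mob_D3_range[OF s] assms(1) by (intro g42_pow_less) auto
  then show ?thesis by (simp add: \<Psi>_def)
qed simp

lemma inverse_g24_pow: "x > 0 \<Longrightarrow> 1 / (g24 ^^ k) x = (g42 ^^ k) (1 / x) \<and> (g24 ^^ k) x > 0"
proof (induction k)
  case (Suc k)
  then have pos: "(g24 ^^ k) x > 0" and eq: "1 / (g24 ^^ k) x = (g42 ^^ k) (1 / x)" by auto
  have "1 / mob D2 (mob D4 ((g24 ^^ k) x)) = mob D4 (mob D2 (1 / (g24 ^^ k) x))"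
    using inverse_mob[OF mob_pos[OF pos, of D4], of D2] inverse_mob[OF pos, of D4] by simp
  then show ?case using mob_pos[OF mob_pos[OF pos]] unfolding g24_pow_Suc g42_pow_Suc eq by simp
qed simp

text \<open>
  The point with the periodic expansion \<open>4242\<dots>\<close>; its inverse has the expansion \<open>2424\<dots>\<close>.
\<close>

definition \<eta> :: real where "\<eta> = (1 + sqrt 13) / (2 * sqrt 3)"

lemma \<eta>_eq: "\<eta> * (sqrt 3 * \<eta>) = \<eta> + sqrt 3" and \<eta>_pos: "\<eta> > 0"
proof -
  define s where "s = sqrt 3"
  define w where "w = sqrt 13"
  have s: "s * s = 3" "s > 0" and w: "w * w = 13" by (simp_all add: s_def w_def)
  have e: "\<eta> * (2 * s) = 1 + w" using s by (simp add: \<eta>_def s_def w_def)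
  have "(\<eta> * (s * \<eta>)) * (4 * s) = (\<eta> * (2 * s)) * (\<eta> * (2 * s))" by (simp add: algebra_simps)
  also have "\<dots> = 1 + 2 * w + w * w" unfolding e by (simp add: algebra_simps)
  also have "\<dots> = 2 * (\<eta> * (2 * s)) + 4 * (s * s)" unfolding e s w by simp
  also have "\<dots> = (\<eta> + s) * (4 * s)" by (simp add: algebra_simps)
  finally show "\<eta> * (sqrt 3 * \<eta>) = \<eta> + sqrt 3" using s by (simp add: s_def)
  show "\<eta> > 0" unfolding \<eta>_def by (intro divide_pos_pos add_pos_pos) auto
qed

lemma mob_\<eta>: "mob D2 \<eta> = 1 / \<eta>" "mob D4 (1 / \<eta>) = \<eta>"
proof -
  show 2: "mob D2 \<eta> = 1 / \<eta>"
  proof -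
    have "2 * \<eta> + sqrt 3 > 0" using \<eta>_pos by (simp add: add_pos_pos)
    moreover have "\<eta> * (sqrt 3 * \<eta> + 1) = 2 * \<eta> + sqrt 3"
      unfolding distrib_left \<eta>_eq by simp
    ultimately show ?thesis using \<eta>_pos by (simp add: mob_def field_simps)
  qed
  show "mob D4 (1 / \<eta>) = \<eta>" using inverse_mob[OF \<eta>_pos, of D2] 2 by simp
qed

text \<open>
  The value \<open>4/\<surd>3\<close> is the height of \<open>\<dots>2424 | 3 2424\<dots>\<close> at the marked position.
\<close>

lemma \<eta>_sum: "\<eta> + mob D3 (1 / \<eta>) = 4 / sqrt 3"
proof -
  have "1 / mob D3 \<eta> = mob D3 (1 / \<eta>)" using inverse_mob[OF \<eta>_pos, of D3] by simp
  moreover have "1 / mob D3 \<eta> = 4 / sqrt 3 - \<eta>"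
  proof -
    have "(4 / sqrt 3 - \<eta>) * (2 * \<eta> + sqrt 3) = sqrt 3 * \<eta> + 2"
    proof -
      have "sqrt 3 * ((4 / sqrt 3 - \<eta>) * (2 * \<eta> + sqrt 3)) = (4 - sqrt 3 * \<eta>) * (2 * \<eta> + sqrt 3)"
        by (simp add: right_diff_distrib flip: mult.assoc)
      also have "\<dots> = 8 * \<eta> + 4 * sqrt 3 - 2 * (\<eta> * (sqrt 3 * \<eta>)) - 3 * \<eta>"
        by (simp add: algebra_simps sqrt3_mult)
      also have "\<dots> = sqrt 3 * (sqrt 3 * \<eta> + 2)" unfolding \<eta>_eq by (simp add: algebra_simps sqrt3_mult)
      finally show ?thesis by simp
    qed
    moreover have "2 * \<eta> + sqrt 3 > 0" using \<eta>_pos by (simp add: add_pos_pos)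
    ultimately show ?thesis by (simp add: mob_def field_simps)
  qed
  ultimately show ?thesis by simp
qed

lemma \<eta>_range: "\<eta> \<in> {1.31..1.47}"
proof -
  have "3 \<le> sqrt 13" "sqrt 13 \<le> 4" by (rule real_le_rsqrt, simp) (rule real_le_lsqrt, simp_all)
  then have "\<eta> \<in> {1/2..2}" using sqrt3_bounds by (auto simp: \<eta>_def field_simps)
  moreover have "g42 \<eta> = \<eta>" by (simp add: g42_def mob_\<eta>)
  ultimately show ?thesis using g42_pow_range[of 1 \<eta>] by simp
qed

lemma g42_pow_\<eta>: "(g42 ^^ k) \<eta> = \<eta>"
  by (induction k) (simp_all add: g42_def mob_\<eta>)

lemma g24_pow_\<eta>: "(g24 ^^ k) (1 / \<eta>) = 1 / \<eta>"
  by (induction k) (simp_all add: g24_def mob_\<eta>)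

lemma \<Psi>_fixed_point:
  obtains Y where "Y \<in> {1/2..2}" "\<Psi> N Y = Y"
proof -
  have "\<exists>x\<ge>1/2. x \<le> 2 \<and> \<Psi> N x - x = 0"
  proof (rule IVT2')
    have "\<Psi> N (1/2) \<in> {1/2..2}" "\<Psi> N 2 \<in> {1/2..2}" by (rule bilipschitz_incD(1)[OF bilipschitz_\<Psi>], simp)+
    then show "\<Psi> N 2 - 2 \<le> 0" "0 \<le> \<Psi> N (1/2) - 1/2" by auto
    have "(1/4)-lipschitz_on {1/2..2} (\<Psi> N)"
      using bilipschitz_incD(6)[OF bilipschitz_\<Psi>[of N]] by (intro lipschitz_onI) (auto simp: dist_real_def)
    then show "continuous_on {1/2..2} (\<lambda>x. \<Psi> N x - x)"
      by (intro continuous_intros lipschitz_on_continuous_on)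
  qed simp
  then show ?thesis using that by auto
qed

section \<open>Words of blocks\<close>

text \<open>
  The state \<open>(i, l)\<close> means that the next digit is number \<open>l\<close> of block \<open>i\<close>. Block \<open>i\<close> is \<open>3 (24)\<^bsup>k i\<^esup>\<close>, with its \<open>2 k i + 1\<close> digits
  numbered from \<open>0\<close>.
\<close>

definition block_step :: "(nat \<Rightarrow> nat) \<Rightarrow> nat \<times> nat \<Rightarrow> nat \<times> nat" where
  "block_step k s = (if snd s < 2 * k (fst s) then (fst s, Suc (snd s)) else (Suc (fst s), 0))"

definition block_state :: "(nat \<Rightarrow> nat) \<Rightarrow> nat \<Rightarrow> nat \<times> nat" where
  "block_state k n = (block_step k ^^ n) (0, 0)"

definition block_word :: "(nat \<Rightarrow> nat) \<Rightarrow> nat \<Rightarrow> digit" where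
  "block_word k n = (let l = snd (block_state k n) in if l = 0 then D3 else if odd l then D2 else D4)"

primrec block_pos :: "(nat \<Rightarrow> nat) \<Rightarrow> nat \<Rightarrow> nat" where
  "block_pos k 0 = 0"
| "block_pos k (Suc i) = Suc (block_pos k i + 2 * k i)"

lemma block_state_Suc: "block_state k (Suc n) = block_step k (block_state k n)"
  by (simp add: block_state_def)

lemma block_state_pos: "l \<le> 2 * k i \<Longrightarrow> block_state k (block_pos k i + l) = (i, l)"
proof (induction i arbitrary: l)
  case 0
  then show ?case
    by (induction l) (auto simp: block_state_Suc block_step_def, simp add: block_state_def)
next
  case (Suc i)
  have "block_state k (block_pos k i + 2 * k i) = (i, 2 * k i)" by (rule Suc.IH) simp
  then have "block_state k (block_pos k (Suc i)) = (Suc i, 0)"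
    by (simp add: block_state_Suc block_step_def)
  with Suc.prems show ?case
    by (induction l) (auto simp: block_state_Suc block_step_def)
qed

lemma block_decomposition: "\<exists>i l. n = block_pos k i + l \<and> l \<le> 2 * k i"
proof (induction n)
  case 0
  show ?case by (intro exI[of _ 0]) simp
next
  case (Suc n)
  then obtain i l where il: "n = block_pos k i + l" "l \<le> 2 * k i" by blast
  show ?case
  proof (cases "l = 2 * k i")
    case True
    then show ?thesis using il by (intro exI[of _ "Suc i"] exI[of _ 0]) simp
  next
    case False
    then show ?thesis using il by (intro exI[of _ i] exI[of _ "Suc l"]) simp
  qed
qed

lemma block_pos_mono: "i \<le> j \<Longrightarrow> block_pos k i \<le> block_pos k j"
  by (induction j rule: dec_induct) auto

lemma block_pos_ge: "i \<le> block_pos k i"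
  by (induction i) auto

lemma block_word_digit:
  "block_word k (block_pos k i) = D3"
  "m < k i \<Longrightarrow> block_word k (Suc (block_pos k i) + 2 * m) = D2"
  "m < k i \<Longrightarrow> block_word k (Suc (Suc (block_pos k i) + 2 * m)) = D4"
  using block_state_pos[of 0 k i] block_state_pos[of "Suc (2 * m)" k i] block_state_pos[of "Suc (Suc (2 * m))" k i]
  by (simp_all add: block_word_def)

text \<open>
  At the digit 3 that opens block \<open>i\<close> the forward and backward expansions are \<open>x i\<close> and \<open>y i\<close>. Just after this digit
  they are inverted, giving \<open>w i\<close> and \<open>u i\<close>, because there the cusp \<open>0\<close> is the high one. The recursions show that \<open>x\<close> and \<open>u\<close> are of
  the same kind, the one reading exponents forwards and the other backwards, and likewise \<open>w\<close> and \<open>y\<close>.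
\<close>

locale block_expansion = digit_expansion "block_word k" t for k :: "nat \<Rightarrow> nat" and t :: "nat \<Rightarrow> real"
begin

abbreviation "pos \<equiv> block_pos k"

definition x where "x i = t (pos i)"
definition y where "y i = r (pos i)"
definition u where "u i = 1 / r (Suc (pos i))"
definition w where "w i = 1 / t (Suc (pos i))"

lemma t_after_3: "m \<le> k i \<Longrightarrow> t (Suc (pos i)) = (g24 ^^ m) (t (Suc (pos i) + 2 * m))"
proof (induction m)
  case (Suc m)
  have "t (Suc (pos i) + 2 * m) = g24 (t (Suc (pos i) + 2 * Suc m))"
    using t_Suc[of "Suc (pos i) + 2 * m"] t_Suc[of "Suc (Suc (pos i) + 2 * m)"]
      block_word_digit(2,3)[of m k i] Suc.prems by (simp add: g24_def)
  then show ?case using Suc by (simp add: funpow_swap1)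
qed simp

lemma t_block: "t (Suc (pos i)) = (g24 ^^ k i) (x (Suc i))"
  using t_after_3[of "k i" i] by (simp add: x_def)

lemma x_block: "x i = mob D3 (t (Suc (pos i)))"
  using t_Suc[of "pos i"] by (simp add: x_def block_word_digit)

lemma x_rec: "x i = \<Phi> (k i) (x (Suc i))"
  using x_block[of i] by (simp add: \<Phi>_def t_block)

lemma x_range: "x i \<in> {1/2..2}"
  unfolding x_def by (rule t_range)

lemma r_after_3: "m \<le> k i \<Longrightarrow> r (Suc (pos i) + 2 * m) = (g42 ^^ m) (r (Suc (pos i)))"
proof (induction m)
  case (Suc m)
  have "r (Suc (pos i) + 2 * Suc m) = g42 (r (Suc (pos i) + 2 * m))"
    using r_Suc[of "Suc (pos i) + 2 * m"] r_Suc[of "Suc (Suc (pos i) + 2 * m)"]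
      block_word_digit(2,3)[of m k i] Suc.prems by (simp add: g42_def)
  then show ?case using Suc by simp
qed simp

lemma r_block: "y (Suc i) = (g42 ^^ k i) (r (Suc (pos i)))"
  using r_after_3[of "k i" i] by (simp add: y_def)

lemma pos_ge_1: "i \<ge> 1 \<Longrightarrow> pos i \<ge> 1"
  using block_pos_ge[of i k] by simp

lemma r_Suc_pos: "i \<ge> 1 \<Longrightarrow> r (Suc (pos i)) = mob D3 (y i)"
  using r_Suc[OF pos_ge_1] by (simp add: y_def block_word_digit)

lemma y_rec: "i \<ge> 1 \<Longrightarrow> y (Suc i) = \<Psi> (k i) (y i)"
  by (simp add: r_block r_Suc_pos \<Psi>_def)

lemma y_1: "y 1 = (g42 ^^ k 0) (2 / sqrt 3)"
  using r_block[of 0] r_1 block_word_digit(1)[of k 0] by simp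

lemma y_range: "i \<ge> 1 \<Longrightarrow> y i \<in> {1/2..2}"
  unfolding y_def by (rule r_range[OF pos_ge_1])

lemma w_rec: "w i = \<Psi> (k i) (w (Suc i))"
proof -
  have "w i = (g42 ^^ k i) (1 / x (Suc i))"
    using inverse_g24_pow[of "x (Suc i)" "k i"] x_range[of "Suc i"] by (simp add: w_def t_block)
  moreover have "1 / x (Suc i) = mob D3 (w (Suc i))"
    using inverse_mob[OF t_pos, of D3] by (simp add: x_block w_def)
  ultimately show ?thesis by (simp add: \<Psi>_def)
qed

lemma w_range: "w i \<in> {1/2..2}"
  using t_range[of "Suc (pos i)"] by (auto simp: w_def field_simps)

lemma u_range: "u i \<in> {1/2..2}"
  using r_range[of "Suc (pos i)"] by (auto simp: u_def field_simps)

lemma u_rec: "u (Suc i) = \<Phi> (k i) (u i)"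
proof -
  have ypos: "y (Suc i) > 0" using y_range[of "Suc i"] by simp
  have "u (Suc i) = mob D3 (1 / y (Suc i))"
    using inverse_mob[OF ypos, of D3] r_Suc_pos[of "Suc i"] unfolding u_def by simp
  moreover have "u i > 0" using u_range[of i] by simp
  then have "y (Suc i) = 1 / (g24 ^^ k i) (u i)"
    using inverse_g24_pow[of "u i" "k i"] by (simp add: u_def r_block)
  then have "1 / y (Suc i) = (g24 ^^ k i) (u i)" by simp
  ultimately show ?thesis by (simp add: \<Phi>_def)
qed

text \<open>
  The fixed point of \<open>\<Psi> N\<close> belongs to the constant exponent sequence \<open>N\<close>, which is the largest one allowed.
\<close>

lemma w_le_fixed_point:
  assumes N: "\<And>i. k i \<le> N" and Y: "Y \<in> {1/2..2}" "\<Psi> N Y = Y"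
  shows "w i \<le> Y"
proof -
  have *: "w i \<le> Y + 2 * (1/4) ^ n" for i n
  proof (induction n arbitrary: i)
    case 0
    then show ?case using w_range[of i] Y by auto
  next
    case (Suc n)
    have "w i \<le> \<Psi> N (w (Suc i))" unfolding w_rec[of i] by (rule \<Psi>_mono[OF N w_range])
    also have "\<dots> \<le> Y + 2 * (1/4) ^ Suc n"
    proof (cases "w (Suc i) \<le> Y")
      case True
      then have "\<Psi> N (w (Suc i)) \<le> \<Psi> N Y" by (intro bilipschitz_incD(3)[OF bilipschitz_\<Psi> w_range Y(1)])
      then have "\<Psi> N (w (Suc i)) \<le> Y" using Y(2) by simp
      then show ?thesis by (rule order.trans) simp
    next
      case False
      then have "\<Psi> N (w (Suc i)) - \<Psi> N Y \<le> 1/4 * (w (Suc i) - Y)"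
        by (intro bilipschitz_incD(5)[OF bilipschitz_\<Psi> Y(1) w_range]) auto
      then show ?thesis using Suc[of "Suc i"] Y(2) by simp
    qed
    finally show ?case .
  qed
  have "(\<lambda>n. Y + 2 * (1/4) ^ n) \<longlonglongrightarrow> Y + 2 * 0"
    by (intro tendsto_intros LIMSEQ_realpow_zero) auto
  then show ?thesis using * by (intro LIMSEQ_le_const[of _ Y]) auto
qed

lemma y_le_fixed_point:
  assumes N: "\<And>i. k i \<le> N" and "k 0 < N" and Y: "Y \<in> {1/2..2}" "\<Psi> N Y = Y" and "i \<ge> 1"
  shows "y i \<le> Y"
  using \<open>i \<ge> 1\<close>
proof (induction i rule: dec_induct)
  case base
  have "(g42 ^^ k 0) (2 / sqrt 3) < (g42 ^^ N) (mob D3 Y)"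
    using sqrt3_bounds mob_D3_range[OF Y(1)] \<open>k 0 < N\<close>
    by (intro g42_pow_less) (auto simp: field_simps)
  then show ?case using Y(2) y_1 by (simp add: \<Psi>_def)
next
  case (step i)
  have "y (Suc i) = \<Psi> (k i) (y i)" using step by (intro y_rec) auto
  also have "\<dots> \<le> \<Psi> N (y i)" using step by (intro \<Psi>_mono N y_range) auto
  also have "\<dots> \<le> \<Psi> N Y" using step Y by (intro bilipschitz_incD(3)[OF bilipschitz_\<Psi>] y_range) auto
  finally show ?case using Y(2) by simp
qed

text \<open>
  Since \<open>4/\<surd>3 = 2.309\<dots>\<close>, the bounds by \<open>2.26\<close> here and in the lemmas that follow leave only \<open>x i + y i\<close> and
  \<open>u i + w i\<close> as heights that matter.
\<close>

lemma heights_at_3: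
  assumes "i \<ge> 2" and k: "\<And>i. k i \<ge> 1"
  shows "1 / t (pos i) + 1 / r (pos i) \<le> 2.26"
proof -
  obtain j where j: "i = Suc j" "j \<ge> 1" using assms(1) by (cases i) auto
  have "x i \<in> {0.95..1.05}" unfolding x_rec[of i] by (rule \<Phi>_range[OF x_range])
  moreover have "y i \<in> {1.31..1.47}"
    unfolding j y_rec[OF j(2)] \<Psi>_def
    by (rule g42_pow_range[OF k bilipschitz_incD(1)[OF bilipschitz_inc_mob y_range[OF j(2)]]])
  ultimately have "t (pos i) \<ge> 0.95" "r (pos i) \<ge> 1.31" by (auto simp: x_def y_def)
  then have "1 / t (pos i) \<le> 1 / 0.95" "1 / r (pos i) \<le> 1 / 1.31"
    by (intro divide_left_mono; simp)+
  then show ?thesis by simp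
qed

lemma height_after_3:
  assumes "i \<ge> 1" and k: "k i \<ge> 1"
  shows "t (Suc (pos i)) + r (Suc (pos i)) \<le> 2.26"
proof -
  have "t (Suc (pos i)) \<in> {0.68..0.78}"
    unfolding t_block by (rule g24_pow_range[OF k x_range])
  moreover have "r (Suc (pos i)) \<in> {0.95..1.05}"
    unfolding r_Suc_pos[OF assms(1)] by (rule mob_D3_range[OF y_range[OF assms(1)]])
  ultimately show ?thesis by simp
qed

lemma sum_24_bound:
  fixes a b :: real
  assumes "a \<in> {0.68..0.78}" "b \<in> {1.28..1.47}"
  shows "a + b \<le> 2.26" "1 / a + 1 / b \<le> 2.26"
proof -
  show "a + b \<le> 2.26" using assms by simp
  have "1 / a \<le> 1 / 0.68" "1 / b \<le> 1 / 1.28"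
    using assms by (intro divide_left_mono; simp)+
  then show "1 / a + 1 / b \<le> 2.26" by simp
qed

lemma heights_inside_24:
  assumes "2 \<le> l" "l \<le> 2 * k i"
  shows "t (pos i + l) + r (pos i + l) \<le> 2.26 \<and> 1 / t (pos i + l) + 1 / r (pos i + l) \<le> 2.26"
proof -
  obtain l' where l': "l = Suc l'" "l' \<ge> 1" using assms(1) by (cases l) auto
  have tt: "t (pos i + l) = mob (block_word k (pos i + l)) (t (Suc (pos i + l)))" by (rule t_Suc)
  have rr: "r (pos i + l) = mob (block_word k (pos i + l')) (r (pos i + l'))"
    using r_Suc[of "pos i + l'"] l' by simp
  have rI: "r (pos i + l') \<in> {1/2..2}" using l' by (intro r_range) simp
  have w: "block_word k (pos i + l) = (if odd l then D2 else D4)"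
    "block_word k (pos i + l') = (if odd l' then D2 else D4)"
    using block_state_pos[of l k i] block_state_pos[of l' k i] assms l' by (simp_all add: block_word_def)
  show ?thesis
  proof (cases "odd l")
    case True
    then have "t (pos i + l) \<in> {0.68..0.78}" "r (pos i + l) \<in> {1.28..1.47}"
      using tt rr w l' mob_D2_range[OF t_range] mob_D4_range[OF rI] by auto
    then show ?thesis using sum_24_bound by blast
  next
    case False
    then have "r (pos i + l) \<in> {0.68..0.78}" "t (pos i + l) \<in> {1.28..1.47}"
      using tt rr w l' mob_D4_range[OF t_range] mob_D2_range[OF rI] by auto
    then show ?thesis using sum_24_bound[of "r (pos i + l)" "t (pos i + l)"] by (simp add: add.commute)
  qed
qed

end

section \<open>Exponent sequences with markers\<close>

text \<open>
  Stage \<open>j\<close> occupies the indices from \<open>j\<^sup>2\<close> to \<open>j\<^sup>2 + 2 j\<close>. It consists of \<open>j\<close> entries \<open>m + 3\<close>, a marker \<open>m\<close> and the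
  entries \<open>b 0, \<dots>, b (j - 1)\<close>, so that longer and longer neighbourhoods of the markers look alike.
\<close>

definition marked_seq :: "nat \<Rightarrow> (nat \<Rightarrow> nat) \<Rightarrow> nat \<Rightarrow> nat" where
  "marked_seq m b i = (let j = floor_sqrt i; l = i - j\<^sup>2 in
     if l < j then m + 3 else if l = j then m else b (l - j - 1))"

lemma floor_sqrt_square_add: "l \<le> 2 * j \<Longrightarrow> floor_sqrt (j\<^sup>2 + l) = j"
  by (rule floor_sqrt_unique) (auto simp: power2_eq_square)

lemma marked_seq_before: "l < j \<Longrightarrow> marked_seq m b (j\<^sup>2 + l) = m + 3"
  by (simp add: marked_seq_def floor_sqrt_square_add)

lemma marked_seq_marker: "marked_seq m b (j\<^sup>2 + j) = m"
  by (simp add: marked_seq_def floor_sqrt_square_add)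

lemma marked_seq_after: "l < j \<Longrightarrow> marked_seq m b (Suc (j\<^sup>2 + j + l)) = b l"
  using floor_sqrt_square_add[of "Suc (j + l)" j] by (simp add: marked_seq_def add.assoc)

lemma marked_seq_bounds:
  assumes b: "\<And>l. b l \<in> {m+1..m+2}"
  shows "m \<le> marked_seq m b i" "marked_seq m b i \<le> m + 3"
    "marked_seq m b i = m \<Longrightarrow> \<exists>j. i = j\<^sup>2 + j"
proof -
  have sq: "(floor_sqrt i)\<^sup>2 \<le> i" by (rule floor_sqrt_power2_le)
  have b': "m < b l" "b l \<le> m + 2" for l using b[of l] by auto
  show "m \<le> marked_seq m b i" "marked_seq m b i \<le> m + 3"
    using b'[of "i - (floor_sqrt i)\<^sup>2 - floor_sqrt i - 1"] by (auto simp: marked_seq_def Let_def)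
  assume "marked_seq m b i = m"
  then have "i - (floor_sqrt i)\<^sup>2 = floor_sqrt i"
    using b'[of "i - (floor_sqrt i)\<^sup>2 - floor_sqrt i - 1"] by (auto simp: marked_seq_def Let_def split: if_splits)
  then have "i = (floor_sqrt i)\<^sup>2 + floor_sqrt i" using sq by linarith
  then show "\<exists>j. i = j\<^sup>2 + j" by blast
qed

text \<open>
  The height at a marker tends to \<open>Y + \<Phi> m (z 0)\<close>, the value of the two-sided sequence
  \<open>\<dots> (m+3) (m+3) | m b\<^sub>0 b\<^sub>1 \<dots>\<close>. Nothing exceeds this value in the limit: \<open>Y\<close> is an upper bound for all \<open>y i\<close> and \<open>w i\<close>,
  and \<open>x i\<close> and \<open>u i\<close> stay below \<open>\<Phi> m (z 0)\<close> unless their first exponent is \<open>m\<close>. For \<open>x i\<close> this is the height at a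
  marker; for \<open>u i\<close> the next exponent is \<open>m + 3\<close>, larger than \<open>b 0\<close>, which makes \<open>u i\<close> smaller.
\<close>

theorem marked_lagrange_const:
  assumes m: "m \<ge> 1" and b: "\<And>l. b l \<in> {m+1..m+2}"
    and z: "\<And>n. z n = \<Phi> (b n) (z (Suc n))" "\<And>n. z n \<in> {1/2..2}"
    and Y: "Y \<in> {1/2..2}" "\<Psi> (m + 3) Y = Y"
  shows "\<exists>\<xi>. Fin \<xi> \<notin> Q_H6 \<and> lagrange_const \<xi> = ennreal (Y + \<Phi> m (z 0))"
proof -
  define k where "k = marked_seq m b"
  define V where "V = Y + \<Phi> m (z 0)"
  have "\<exists>t. \<forall>n. t n = mob (block_word k n) (t (Suc n)) \<and> t n \<in> {1/2..2}"
    using bilipschitz_incD(1,3,6)[OF bilipschitz_inc_weaken[OF bilipschitz_inc_mob, of 1]]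
    by (intro backward_orbit_exists) simp_all
  then obtain t where t: "\<And>n. t n = mob (block_word k n) (t (Suc n))" "\<And>n. t n \<in> {1/2..2}" by blast
  interpret block_expansion k t by unfold_locales (fact t)+
  have k_ge: "m \<le> k i" and k_le: "k i \<le> m + 3" and k_marker: "k i = m \<Longrightarrow> \<exists>j. i = j\<^sup>2 + j" for i
    unfolding k_def using marked_seq_bounds[of b m i, OF b] by blast+
  have k_ge_1: "k i \<ge> 1" for i using k_ge[of i] m by simp
  have k0: "k 0 < m + 3" using marked_seq_marker[of m b 0] by (simp add: k_def)
  have zJ: "z n \<in> {0.95..1.05}" for n unfolding z(1)[of n] by (rule \<Phi>_range[OF z(2)])
  have yY: "y i \<le> Y" if "i \<ge> 1" for i
    by (rule y_le_fixed_point[OF k_le k0 Y that])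
  have wY: "w i \<le> Y" for i
    by (rule w_le_fixed_point[OF k_le Y])
  have YV: "Y \<ge> 1.31"
    using g42_pow_range[of "m + 3" "mob D3 Y"] mob_range[OF Y(1), of D3] Y(2) by (simp add: \<Psi>_def)
  have "\<Phi> m (z 0) \<ge> 0.95" using \<Phi>_range[OF z(2), of m 0] by simp
  then have V_ge: "V \<ge> 2.26" using YV by (simp add: V_def)
  have x_close: "\<bar>x (j\<^sup>2 + j) - \<Phi> m (z 0)\<bar> \<le> 2 * (1/4) ^ j" for j
  proof -
    have "\<bar>x (Suc (j\<^sup>2 + j + l)) - z l\<bar> \<le> 2 * (1/4) ^ d" if "l + d = j" for l d
      using that
    proof (induction d arbitrary: l)
      case 0
      then show ?case using x_range[of "Suc (j\<^sup>2 + j + l)"] z(2)[of l] by (simp add: abs_le_iff)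
    next
      case (Suc d)
      have "k (Suc (j\<^sup>2 + j + l)) = b l" using Suc.prems by (simp add: k_def marked_seq_after)
      then have eq: "x (Suc (j\<^sup>2 + j + l)) = \<Phi> (b l) (x (Suc (j\<^sup>2 + j + Suc l)))"
        using x_rec[of "Suc (j\<^sup>2 + j + l)"] by simp
      have "\<bar>x (Suc (j\<^sup>2 + j + l)) - z l\<bar> \<le> 1/4 * \<bar>x (Suc (j\<^sup>2 + j + Suc l)) - z (Suc l)\<bar>"
        unfolding eq z(1)[of l] by (rule bilipschitz_incD(6)[OF bilipschitz_\<Phi> x_range z(2)])
      then show ?case using Suc.IH[of "Suc l"] Suc.prems by simp
    qed
    from this[of 0 j] have "\<bar>x (Suc (j\<^sup>2 + j)) - z 0\<bar> \<le> 2 * (1/4) ^ j" by simp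
    moreover have "x (j\<^sup>2 + j) = \<Phi> m (x (Suc (j\<^sup>2 + j)))"
      using x_rec[of "j\<^sup>2 + j"] by (simp add: k_def marked_seq_marker)
    then have "\<bar>x (j\<^sup>2 + j) - \<Phi> m (z 0)\<bar> \<le> 1/4 * \<bar>x (Suc (j\<^sup>2 + j)) - z 0\<bar>"
      using bilipschitz_incD(6)[OF bilipschitz_\<Phi> x_range z(2)] by metis
    ultimately have "\<bar>x (j\<^sup>2 + j) - \<Phi> m (z 0)\<bar> \<le> 1/4 * (2 * (1/4) ^ j)" by simp
    also have "\<dots> \<le> 2 * (1/4) ^ j" by simp
    finally show ?thesis .
  qed
  have y_close: "\<bar>y (j\<^sup>2 + j) - Y\<bar> \<le> 2 * (1/4) ^ j" if "j \<ge> 1" for j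
  proof -
    have pos: "j\<^sup>2 + l \<ge> 1" for l using that by (simp add: Suc_le_eq)
    have "\<bar>y (j\<^sup>2 + l) - Y\<bar> \<le> 2 * (1/4) ^ l" if "l \<le> j" for l
      using that
    proof (induction l)
      case 0
      then show ?case using y_range[OF pos, of 0] Y(1) by (simp add: abs_le_iff)
    next
      case (Suc l)
      have "k (j\<^sup>2 + l) = m + 3" using Suc.prems by (simp add: k_def marked_seq_before)
      then have eq: "y (j\<^sup>2 + Suc l) = \<Psi> (m + 3) (y (j\<^sup>2 + l))" using y_rec[OF pos, of l] by simp
      have "\<bar>\<Psi> (m + 3) (y (j\<^sup>2 + l)) - \<Psi> (m + 3) Y\<bar> \<le> 1/4 * \<bar>y (j\<^sup>2 + l) - Y\<bar>"
        by (rule bilipschitz_incD(6)[OF bilipschitz_\<Psi> y_range[OF pos] Y(1)])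
      then show ?case using Suc unfolding eq Y(2) by simp
    qed
    then show ?thesis by blast
  qed
  have marker: "\<bar>x (j\<^sup>2 + j) + y (j\<^sup>2 + j) - V\<bar> \<le> 4 * (1/4) ^ j" if "j \<ge> 1" for j
    using x_close[of j] y_close[OF that] unfolding V_def by linarith
  have small: "\<exists>j0\<ge>1. 4 * (1/4 :: real) ^ j0 < e" if "e > 0" for e :: real
  proof -
    have "(\<lambda>n. 4 * (1/4 :: real) ^ n) \<longlonglongrightarrow> 4 * 0" by (intro tendsto_intros LIMSEQ_realpow_zero) auto
    then have "eventually (\<lambda>n. 4 * (1/4 :: real) ^ n < e) sequentially"
      using order_tendstoD(2)[of _ "4 * (0::real)" sequentially e] that by simp
    then obtain n0 where "\<And>n. n \<ge> n0 \<Longrightarrow> 4 * (1/4 :: real) ^ n < e" unfolding eventually_sequentially by blast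
    then show ?thesis by (intro exI[of _ "max n0 1"]) auto
  qed
  have first: "x i + y i \<le> V + e" if e: "4 * (1/4) ^ j0 < e" "j0 \<ge> 1" and i: "i \<ge> j0\<^sup>2 + j0" for e j0 i
  proof (cases "k i = m")
    case True
    then obtain j where j: "i = j\<^sup>2 + j" using k_marker by blast
    have "j0 \<le> j"
    proof (rule ccontr)
      assume "\<not> j0 \<le> j"
      then have "j\<^sup>2 + j < j0\<^sup>2 + j0" by (intro add_le_less_mono power_mono) auto
      then show False using i j by simp
    qed
    then have "4 * (1/4 :: real) ^ j \<le> 4 * (1/4) ^ j0" by (simp add: power_decreasing)
    then show ?thesis using marker[of j] e \<open>j0 \<le> j\<close> unfolding j by linarith
  next
    case False
    then have "m < k i" using k_ge[of i] by simp
    then have "x i < \<Phi> m (z 0)" unfolding x_rec[of i] by (rule \<Phi>_less[OF _ zJ x_range])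
    moreover have "i \<ge> 1" using i e(2) by simp
    then have "y i \<le> Y" by (rule yY)
    moreover have "0 < 4 * (1/4 :: real) ^ j0" by simp
    ultimately show ?thesis using e unfolding V_def by linarith
  qed
  have second: "u i + w i \<le> V" if i: "i \<ge> 2" for i
  proof -
    obtain i' where i': "i = Suc (Suc i')" using i by (metis add_2_eq_Suc le_Suc_ex)
    have "u i \<le> \<Phi> m (z 0)"
    proof (cases "k (Suc i') = m")
      case True
      then obtain j where j: "Suc i' = j\<^sup>2 + j" using k_marker by blast
      then obtain j' where j': "j = Suc j'" by (cases j) auto
      have "i' = j\<^sup>2 + j'" using j j' by simp
      then have "k i' = m + 3" using marked_seq_before[of j' j m b] j' by (simp add: k_def)
      then have "u (Suc i') = \<Phi> (m + 3) (u i')" by (simp add: u_rec)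
      also have "\<dots> < \<Phi> (b 0) (z 1)" using b[of 0] by (intro \<Phi>_less zJ u_range) auto
      also have "\<dots> = z 0" using z(1)[of 0] by simp
      finally have "\<Phi> m (u (Suc i')) \<le> \<Phi> m (z 0)"
        by (intro bilipschitz_incD(3)[OF bilipschitz_\<Phi> u_range z(2)]) simp
      then show ?thesis using True by (simp add: i' u_rec[of "Suc i'"])
    next
      case False
      then have "m < k (Suc i')" using k_ge[of "Suc i'"] by simp
      then have "\<Phi> (k (Suc i')) (u (Suc i')) < \<Phi> m (z 0)" by (rule \<Phi>_less[OF _ zJ u_range])
      then show ?thesis by (simp add: i' u_rec[of "Suc i'"])
    qed
    then show ?thesis using wY[of i] unfolding V_def by linarith
  qed
  have "lagrange_const (t 0) = ennreal V"
  proof (rule lagrange_const_eq)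
    show "sqrt 3 < V" using V_ge sqrt3_bounds by simp
  next
    fix e :: real assume e: "e > 0"
    obtain j0 where j0: "4 * (1/4 :: real) ^ j0 < e" "j0 \<ge> 1" using small[OF e] by blast
    \<comment> \<open>From block \<open>i0\<close> on, only markers of stage \<open>j0\<close> or later occur.\<close>
    define i0 where "i0 = Suc (j0\<^sup>2 + j0)"
    have i0: "i0 \<ge> 2" "i0 \<ge> j0\<^sup>2 + j0" using j0(2) by (auto simp: i0_def)
    show "\<forall>\<^sub>F n in sequentially. t n + r n \<le> V + e \<and> 1 / t n + 1 / r n \<le> V + e"
      unfolding eventually_sequentially
    proof (intro exI allI impI)
      fix n assume n: "pos i0 \<le> n"
      obtain i l where il: "n = pos i + l" "l \<le> 2 * k i" using block_decomposition by blast
      have "i0 \<le> i"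
      proof (rule ccontr)
        assume "\<not> i0 \<le> i"
        then have "pos (Suc i) \<le> pos i0" by (intro block_pos_mono) simp
        then show False using n il by simp
      qed
      then have i: "i \<ge> 2" "i \<ge> j0\<^sup>2 + j0" using i0 by auto
      consider "l = 0" | "l = 1" | "l \<ge> 2" by linarith
      then show "t n + r n \<le> V + e \<and> 1 / t n + 1 / r n \<le> V + e"
      proof cases
        case 1
        then show ?thesis using first[OF j0 i(2)] heights_at_3[OF i(1) k_ge_1] V_ge e
          by (simp add: il x_def y_def)
      next
        case 2
        then show ?thesis using second[OF i(1)] height_after_3[of i] k_ge_1[of i] i V_ge e
          by (simp add: il u_def w_def)
      next
        case 3
        then show ?thesis using heights_inside_24[OF 3 il(2)] V_ge e by (simp add: il(1))
      qed
    qed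
  next
    fix e :: real and N assume e: "e > 0"
    obtain j0 where j0: "4 * (1/4 :: real) ^ j0 < e" "j0 \<ge> 1" using small[OF e] by blast
    define j where "j = max j0 N"
    have j: "j \<ge> 1" "j \<ge> j0" "j \<ge> N" using j0 by (auto simp: j_def)
    have "4 * (1/4 :: real) ^ j \<le> 4 * (1/4) ^ j0" using j by (simp add: power_decreasing)
    then have "x (j\<^sup>2 + j) + y (j\<^sup>2 + j) \<ge> V - e" using marker[OF j(1)] j0 by linarith
    moreover have "pos (j\<^sup>2 + j) \<ge> N" using block_pos_ge[of "j\<^sup>2 + j" k] j by linarith
    ultimately show "\<exists>n\<ge>N. V - e \<le> t n + r n" unfolding x_def y_def by blast
  qed
  then show ?thesis using t_0_not_in_Q_H6 unfolding V_def by blast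
qed

section \<open>A Cantor set of Lagrange constants\<close>

definition binary_digit :: "real \<Rightarrow> nat \<Rightarrow> nat" where
  "binary_digit v l = (if odd \<lfloor>2 ^ Suc l * v\<rfloor> then 1 else 0)"

lemma floor_double: "\<lfloor>2 * x\<rfloor> = 2 * \<lfloor>x\<rfloor> + (if odd \<lfloor>2 * x :: real\<rfloor> then 1 else 0)"
proof -
  have "\<lfloor>2 * x\<rfloor> = 2 * \<lfloor>x\<rfloor> \<or> \<lfloor>2 * x\<rfloor> = 2 * \<lfloor>x\<rfloor> + 1" by linarith
  then show ?thesis by auto
qed

text \<open>
  Agreement of the first \<open>n\<close> binary digits means that \<open>2\<^sup>n v\<close> and \<open>2\<^sup>n v'\<close> have the same integer part.
\<close>

lemma binary_digits_agree:
  assumes v: "v \<in> {0..<1}" "v' \<in> {0..<1}" and eq: "\<And>l. l < n \<Longrightarrow> binary_digit v l = binary_digit v' l"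
  shows "\<bar>v - v'\<bar> \<le> (1/2) ^ n"
proof -
  have "\<lfloor>2 ^ l * v\<rfloor> = \<lfloor>2 ^ l * v'\<rfloor>" if "l \<le> n" for l
    using that
  proof (induction l)
    case 0
    have "\<lfloor>v\<rfloor> = 0" "\<lfloor>v'\<rfloor> = 0" using v by (simp_all add: floor_eq_iff)
    then show ?case by simp
  next
    case (Suc l)
    have "odd \<lfloor>2 ^ Suc l * v\<rfloor> \<longleftrightarrow> odd \<lfloor>2 ^ Suc l * v'\<rfloor>"
      using eq[of l] Suc.prems by (auto simp: binary_digit_def split: if_splits)
    then show ?case
      using floor_double[of "2 ^ l * v"] floor_double[of "2 ^ l * v'"] Suc by (simp add: mult.assoc)
  qed
  then have "\<lfloor>2 ^ n * v\<rfloor> = \<lfloor>2 ^ n * v'\<rfloor>" by simp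
  then have "\<bar>2 ^ n * v - 2 ^ n * v'\<bar> \<le> 1" by linarith
  then have "2 ^ n * \<bar>v - v'\<bar> \<le> 1" by (simp add: abs_mult flip: right_diff_distrib)
  then show ?thesis by (simp add: power_divide field_simps)
qed

lemma first_binary_difference:
  assumes v: "v \<in> {0..<1}" "v' \<in> {0..<1}" "v \<noteq> v'"
  obtains n where "\<And>l. l < n \<Longrightarrow> binary_digit v l = binary_digit v' l"
    "binary_digit v n \<noteq> binary_digit v' n" "\<bar>v - v'\<bar> \<le> (1/2) ^ n"
proof -
  have "\<exists>n. binary_digit v n \<noteq> binary_digit v' n"
  proof (rule ccontr)
    assume "\<not> ?thesis"
    then have "\<bar>v - v'\<bar> \<le> (1/2) ^ n" for n by (intro binary_digits_agree[OF v(1,2)]) auto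
    moreover have "(\<lambda>n. (1/2 :: real) ^ n) \<longlonglongrightarrow> 0" by (intro LIMSEQ_realpow_zero) auto
    ultimately have "\<bar>v - v'\<bar> \<le> 0" by (intro LIMSEQ_le_const) auto
    then show False using v(3) by simp
  qed
  then have "binary_digit v (LEAST n. binary_digit v n \<noteq> binary_digit v' n) \<noteq> binary_digit v' (LEAST n. binary_digit v n \<noteq> binary_digit v' n)"
    by (rule LeastI_ex)
  moreover have agree: "\<And>l. l < (LEAST n. binary_digit v n \<noteq> binary_digit v' n) \<Longrightarrow> binary_digit v l = binary_digit v' l"
    using not_less_Least by blast
  ultimately show ?thesis using that binary_digits_agree[OF v(1,2) agree] by blast
qed

text \<open>
  At the first difference the two expansions are apart by \<open>\<Phi>_gap\<close>, and each of the \<open>n\<close> common blocks before it shrinks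
  distances by a factor of \<open>(1/36)\<^bsup>2m+5\<^esup>\<close> at worst, the value for the largest exponent \<open>m + 2\<close>.
\<close>

lemma \<Phi>_orbits_separate:
  assumes m: "\<And>l. b l \<in> {m+1..m+2}" "\<And>l. b' l \<in> {m+1..m+2}"
    and z: "\<And>n. z n = \<Phi> (b n) (z (Suc n))" "\<And>n. z n \<in> {1/2..2}"
    and z': "\<And>n. z' n = \<Phi> (b' n) (z' (Suc n))" "\<And>n. z' n \<in> {1/2..2}"
    and agree: "\<And>l. l < n \<Longrightarrow> b l = b' l" and differ: "b n \<noteq> b' n"
  shows "(1/6) * ((1/36) ^ (2 * m + 5)) ^ (n + 1) \<le> \<bar>z 0 - z' 0\<bar>"
proof -
  define \<kappa> :: real where "\<kappa> = (1/36) ^ (2 * m + 5)"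
  have pow: "\<kappa> \<le> (1/36) ^ (2 * j + 1)" if "j \<le> m + 2" for j
    unfolding \<kappa>_def using that by (intro power_decreasing) auto
  have \<kappa>: "\<kappa> > 0" by (simp add: \<kappa>_def)
  have z01: "z l \<in> {0.95..1.05}" "z' l \<in> {0.95..1.05}" for l
    by (subst z(1) z'(1), rule \<Phi>_range[OF z(2)]) (subst z'(1), rule \<Phi>_range[OF z'(2)])
  have base: "(1/6) * \<kappa> \<le> \<bar>z n - z' n\<bar>"
  proof (cases "b n < b' n")
    case True
    have "(1/36) ^ (2 * b n + 1) * (1/6) \<le> z n - z' n"
      unfolding z(1)[of n] z'(1)[of n] by (rule \<Phi>_gap[OF True z01(1) z'(2)])
    moreover have "\<kappa> \<le> (1/36) ^ (2 * b n + 1)" using m(1)[of n] by (intro pow) auto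
    ultimately show ?thesis by linarith
  next
    case False
    then have "b' n < b n" using differ by simp
    then have "(1/36) ^ (2 * b' n + 1) * (1/6) \<le> z' n - z n"
      unfolding z(1)[of n] z'(1)[of n] by (rule \<Phi>_gap[OF _ z01(2) z(2)])
    moreover have "\<kappa> \<le> (1/36) ^ (2 * b' n + 1)" using m(2)[of n] by (intro pow) auto
    ultimately show ?thesis by linarith
  qed
  have "(1/6) * \<kappa> * \<kappa> ^ d \<le> \<bar>z l - z' l\<bar>" if "l + d = n" for l d
    using that
  proof (induction d arbitrary: l)
    case 0
    then show ?case using base by simp
  next
    case (Suc d)
    have bl: "b l = b' l" using Suc.prems by (intro agree) simp
    have "(1/6) * \<kappa> * \<kappa> ^ Suc d = \<kappa> * ((1/6) * \<kappa> * \<kappa> ^ d)" by simp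
    also have "\<dots> \<le> (1/36) ^ (2 * b l + 1) * \<bar>z (Suc l) - z' (Suc l)\<bar>"
      using Suc \<kappa> m(1)[of l] by (intro mult_mono pow) auto
    also have "\<dots> \<le> \<bar>z l - z' l\<bar>"
      unfolding z(1)[of l] z'(1)[of l] bl by (rule bilipschitz_incD(7)[OF bilipschitz_\<Phi> z(2) z'(2)])
    finally show ?case .
  qed
  from this[of 0 n] show ?thesis by (simp add: \<kappa>_def[symmetric])
qed

text \<open>
  Both parts are compared with the limiting geodesic: \<open>Y\<close> is below \<open>\<eta>\<close>, and \<open>\<Phi> m z\<close> shares the prefix \<open>3 (24)\<^sup>m\<close> with
  \<open>mob D3 (1 / \<eta>)\<close>.
\<close>

lemma marked_value_le:
  assumes z: "z \<in> {1/2..2}" and Y: "Y \<in> {1/2..2}" "\<Psi> N Y = Y"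
  shows "Y + \<Phi> m z \<le> 4 / sqrt 3 + (1/16) ^ m"
proof -
  have eI: "\<eta> \<in> {1/2..2}" "1 / \<eta> \<in> {1/2..2}" using \<eta>_range by (auto simp: field_simps)
  have "(g42 ^^ N) (mob D3 Y) \<le> (g42 ^^ N) \<eta>"
    using mob_D3_range[OF Y(1)] \<eta>_range by (intro bilipschitz_incD(3)[OF bilipschitz_g42_pow]) auto
  then have "Y \<le> \<eta>" using Y(2) by (simp add: \<Psi>_def g42_pow_\<eta>)
  moreover have "\<Phi> m z \<le> mob D3 (1 / \<eta>) + (1/16) ^ m"
  proof -
    define P :: real where "P = (1/16) ^ m"
    have "\<bar>(g24 ^^ m) z - (g24 ^^ m) (1 / \<eta>)\<bar> \<le> ((1/4)\<^sup>2) ^ m * \<bar>z - 1 / \<eta>\<bar>"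
      by (rule bilipschitz_incD(6)[OF bilipschitz_g24_pow z eI(2)])
    also have "((1/4)\<^sup>2) ^ m = P" by (simp add: P_def power2_eq_square)
    also have "P * \<bar>z - 1 / \<eta>\<bar> \<le> P * 2"
      using z eI(2) by (intro mult_left_mono) (auto simp: P_def)
    finally have g: "\<bar>(g24 ^^ m) z - 1 / \<eta>\<bar> \<le> P * 2" by (simp add: g24_pow_\<eta>)
    have "\<bar>mob D3 ((g24 ^^ m) z) - mob D3 (1 / \<eta>)\<bar> \<le> \<bar>(g24 ^^ m) z - 1 / \<eta>\<bar> / 4"
      by (rule mob_dist(1)[OF bilipschitz_incD(1)[OF bilipschitz_g24_pow z] eI(2)])
    then have "\<Phi> m z - mob D3 (1 / \<eta>) \<le> \<bar>(g24 ^^ m) z - 1 / \<eta>\<bar> / 4"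
      unfolding \<Phi>_def by (rule order.trans[OF abs_ge_self])
    also have "\<dots> \<le> P * 2 / 4" using g by (rule divide_right_mono) simp
    also have "\<dots> \<le> P" by (simp add: P_def)
    finally show ?thesis by (simp add: P_def)
  qed
  ultimately show ?thesis using \<eta>_sum by linarith
qed

text \<open>
  The exponent \<open>s\<close> is the one for which \<open>\<kappa>\<^sup>s = 1/2\<close>: two numbers whose binary digits first differ
  at index \<open>n\<close> are at most \<open>(1/2)\<^sup>n\<close> apart, and their Lagrange constants at least a fixed multiple of \<open>\<kappa>\<^sup>n\<close>.
\<close>

lemma lagrange_spectrum_dim_pos:
  assumes "\<epsilon> > 0"
  shows "hausdorff_dim (enn2real ` (lagrange_spectrum \<inter> {0..<ennreal (4 / sqrt 3 + \<epsilon>)})) > 0"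
proof -
  have "(\<lambda>n. (1/16 :: real) ^ n) \<longlonglongrightarrow> 0" by (intro LIMSEQ_realpow_zero) auto
  then have "eventually (\<lambda>n. (1/16 :: real) ^ n < \<epsilon>) sequentially"
    using assms by (rule order_tendstoD(2))
  then obtain n0 where "\<And>n. n \<ge> n0 \<Longrightarrow> (1/16 :: real) ^ n < \<epsilon>" unfolding eventually_sequentially by blast
  then obtain m where m: "m \<ge> 1" "(1/16 :: real) ^ m < \<epsilon>" by (metis le_add1 le_add2)
  obtain Y where Y: "Y \<in> {1/2..2}" "\<Psi> (m + 3) Y = Y" by (rule \<Psi>_fixed_point)
  define b where "b v l = m + 1 + binary_digit v l" for v l
  have b: "b v l \<in> {m+1..m+2}" for v l by (simp add: b_def binary_digit_def)
  have "\<exists>z. \<forall>n. z n = \<Phi> (b v n) (z (Suc n)) \<and> z n \<in> {1/2..2}" for v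
    using bilipschitz_incD(1,3,6)[OF bilipschitz_inc_weaken[OF bilipschitz_\<Phi>, of 1]]
    by (intro backward_orbit_exists) simp_all
  then obtain z where z: "\<And>v n. z v n = \<Phi> (b v n) (z v (Suc n))" "\<And>v n. z v n \<in> {1/2..2}" by metis
  define E where "E v = Y + \<Phi> m (z v 0)" for v
  define A where "A = enn2real ` (lagrange_spectrum \<inter> {0..<ennreal (4 / sqrt 3 + \<epsilon>)})"
  have "E v \<in> A" for v
  proof -
    obtain \<xi> where \<xi>: "Fin \<xi> \<notin> Q_H6" "lagrange_const \<xi> = ennreal (E v)"
      using marked_lagrange_const[where b = "b v" and z = "z v", OF m(1) b z Y] unfolding E_def by blast
    have "E v \<ge> 0" using Y(1) \<Phi>_range[OF z(2), of m v 0] by (simp add: E_def)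
    moreover have "E v < 4 / sqrt 3 + \<epsilon>"
      using marked_value_le[OF z(2)[of v 0] Y, of m] m(2) by (simp add: E_def)
    ultimately have "ennreal (E v) \<in> lagrange_spectrum \<inter> {0..<ennreal (4 / sqrt 3 + \<epsilon>)}"
      using \<xi> by (auto simp: lagrange_spectrum_def ennreal_less_iff intro!: exI[of _ \<xi>])
    moreover have "E v = enn2real (ennreal (E v))" using \<open>E v \<ge> 0\<close> by simp
    ultimately show ?thesis unfolding A_def by blast
  qed
  then have EA: "E ` {0..<1} \<subseteq> A" by blast
  define \<kappa> :: real where "\<kappa> = (1/36) ^ (2 * m + 5)"
  have \<kappa>: "0 < \<kappa>" "\<kappa> < 1" by (auto simp: \<kappa>_def power_less_one_iff)
  define s where "s = ln (1/2) / ln \<kappa>"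
  have s: "s > 0" using \<kappa> by (auto simp: s_def intro!: divide_neg_neg)
  have \<kappa>s: "(\<kappa> ^ n) powr s = (1/2) ^ n" for n
  proof -
    have "\<kappa> powr s = 1/2" using \<kappa> by (simp add: powr_def s_def)
    moreover have "(\<kappa> ^ n) powr s = (\<kappa> powr s) ^ n"
      using \<kappa> by (simp add: powr_powr powr_power mult.commute flip: powr_realpow)
    ultimately show ?thesis by metis
  qed
  define c where "c = \<kappa>\<^sup>2 / 6"
  have c: "c > 0" using \<kappa> by (simp add: c_def)
  have "ennreal s \<le> hausdorff_dim A"
  proof (rule hausdorff_dim_ge_of_expanding[OF _ s EA])
    show "(1 / c) powr s > 0" using c by simp
    fix v v' :: real assume v: "v \<in> {0..<1}" "v' \<in> {0..<1}"
    show "\<bar>v - v'\<bar> \<le> (1 / c) powr s * \<bar>E v - E v'\<bar> powr s"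
    proof (cases "v = v'")
      case False
      obtain n where n: "\<And>l. l < n \<Longrightarrow> binary_digit v l = binary_digit v' l"
        "binary_digit v n \<noteq> binary_digit v' n" "\<bar>v - v'\<bar> \<le> (1/2) ^ n"
        using first_binary_difference[OF v False] by blast
      have "1/6 * \<kappa> ^ (n + 1) \<le> \<bar>z v 0 - z v' 0\<bar>"
        using \<Phi>_orbits_separate[where b = "b v" and b' = "b v'" and z = "z v" and z' = "z v'" and n = n, OF b b z z] n(1,2) by (simp add: \<kappa>_def b_def)
      then have "\<kappa> * (1/6 * \<kappa> ^ (n + 1)) \<le> (1/36) ^ (2 * m + 1) * \<bar>z v 0 - z v' 0\<bar>"
        unfolding \<kappa>_def by (intro mult_mono power_decreasing) auto
      also have "\<dots> \<le> \<bar>\<Phi> m (z v 0) - \<Phi> m (z v' 0)\<bar>"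
        by (rule bilipschitz_incD(7)[OF bilipschitz_\<Phi> z(2) z(2)])
      also have "\<dots> = \<bar>E v - E v'\<bar>" by (simp add: E_def)
      finally have "c * \<kappa> ^ n \<le> \<bar>E v - E v'\<bar>" by (simp add: c_def power2_eq_square)
      then have "\<kappa> ^ n \<le> 1 / c * \<bar>E v - E v'\<bar>" using c by (simp add: field_simps)
      then have "(\<kappa> ^ n) powr s \<le> (1 / c * \<bar>E v - E v'\<bar>) powr s" using \<kappa> s by (intro powr_mono2) auto
      also have "\<dots> = (1 / c) powr s * \<bar>E v - E v'\<bar> powr s" by (rule powr_mult)
      finally show ?thesis using n(3) \<kappa>s by simp
    qed simp
  qed
  moreover have "0 < ennreal s" using s by simp
  ultimately show ?thesis unfolding A_def by (rule less_le_trans[rotated])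
qed

theorem theorem1p1:
  fixes \<epsilon> :: real
  assumes "\<epsilon> > 0"
  shows "hausdorff_dim (enn2real ` (markoff_spectrum \<inter> {0..<ennreal (4 / sqrt 3 + \<epsilon>)}))
           \<ge> hausdorff_dim (enn2real ` (lagrange_spectrum \<inter> {0..<ennreal (4 / sqrt 3 + \<epsilon>)}))
       \<and> hausdorff_dim (enn2real ` (lagrange_spectrum \<inter> {0..<ennreal (4 / sqrt 3 + \<epsilon>)})) > 0"
proof
  have "lagrange_spectrum \<inter> {0..<ennreal (4 / sqrt 3 + \<epsilon>)} \<subseteq> markoff_spectrum"
  proof
    fix v assume v: "v \<in> lagrange_spectrum \<inter> {0..<ennreal (4 / sqrt 3 + \<epsilon>)}"
    then obtain \<xi> where \<xi>: "v = lagrange_const \<xi>" "Fin \<xi> \<notin> Q_H6" by (auto simp: lagrange_spectrum_def)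
    have "lagrange_const \<xi> < \<infinity>" using v \<xi>(1) by (auto intro: less_trans)
    then show "v \<in> markoff_spectrum" using lagrange_const_in_markoff_spectrum[OF \<xi>(2)] \<xi>(1) by simp
  qed
  then show "hausdorff_dim (enn2real ` (lagrange_spectrum \<inter> {0..<ennreal (4 / sqrt 3 + \<epsilon>)}))
      \<le> hausdorff_dim (enn2real ` (markoff_spectrum \<inter> {0..<ennreal (4 / sqrt 3 + \<epsilon>)}))"
    by (intro hausdorff_dim_mono image_mono) blast
  show "hausdorff_dim (enn2real ` (lagrange_spectrum \<inter> {0..<ennreal (4 / sqrt 3 + \<epsilon>)})) > 0"
    using assms by (rule lagrange_spectrum_dim_pos)
qed

end
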